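(* Let $\alpha,\beta>0$ and consider the fork-join model described in the context, with arrival probability $p^{(N)}=1-\frac{\alpha}{N}-\frac{\beta}{N^2}$, service probability $q^{(N)}=1-\frac{\alpha}{N}$, initial queue lengths $Q_i^{(N)}(0)$ and maximum queue length process $Q^{(N)}_{(\alpha,\beta)}(\cdot)$. Suppose that: (1) for every $N$, the random variables $(Q_i^{(N)}(0),\, i\le N)$ are i.i.d. and non-negative; (2) $Q_i^{(N)}(0)=\lfloor r_N U_i\rfloor$, where $(r_N)$ is a positive deterministic scaling sequence and $(U_i)_{i\geq 1}$ is a sequence of i.i.d. random variables whose law does not depend on $N$, and $\frac{Q^{(N)}_{(\alpha,\beta)}(0)}{N\log N}\to q(0)$ in probability as $N\to\infty$, for a constant $q(0)\ge 0$; (3) at least one of the following holds: (a) $U_i$ has a finite right endpoint; (b) $U_i$ is a continuous random variable (with $\mathbb{P}(U_i>t)>0$ for all $t$) and for all $v\in[0,1]$ the limit $h(v)=\lim_{t\to\infty}\frac{-\log \mathbb{P}(U_i>vt)}{-\log\mathbb{P}(U_i>t)}$ exists. Then for all $T>0$ and all $\epsilon>0$, $$\mathbb{P}\left(\sup_{0\le t\le T}\left|\frac{Q^{(N)}_{(\alpha,\beta)}(tN^3\log N)}{N\log N}-q(t)\right|>\epsilon\right)\longrightarrow 0\quad (N\to\infty),$$ where $$q(t)=\max\left(\left(\sqrt{2\alpha t}-\beta t\right)\mathbf{1}\left(t<\tfrac{\alpha}{2\beta^2}\right)+\tfrac{\alpha}{2\beta}\mathbf{1}\left(t\ge\tfrac{\alpha}{2\beta^2}\right),\;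 g(t,q(0))-\beta t\right),$$ and the function $g(t,q(0))$ is given as follows: if (a) holds, $g(t,q(0))=q(0)+\sqrt{2\alpha t}$; if (b) holds, $$g(t,q(0))=\sup_{(u,v)}\left\{\sqrt{2\alpha t}\,u+q(0)v \;:\; u^2+h(v)\le 1,\ 0\le u\le 1,\ 0\le v\le 1\right\}.$$
   Context: Model. For each integer $N\ge 2$ large enough that $\frac{\alpha}{N}+\frac{\beta}{N^2}<1$, let $(X^{(N)}(j))_{j\ge1}$ be Bernoulli random variables with parameter $p^{(N)}$ and $(Y_i^{(N)}(j))_{j\ge 1,\, i\le N}$ Bernoulli random variables with parameter $q^{(N)}$, all mutually independent. For real $n\ge 0$ put $A^{(N)}(n)=\sum_{j=1}^{\lfloor n\rfloor}X^{(N)}(j)$ (arrivals) and $S_i^{(N)}(n)=\sum_{j=1}^{\lfloor n\rfloor}Y_i^{(N)}(j)$ (potential services of server $i$). Let $Q_i^{(N)}(0)$ be the number of jobs in front of server $i\le N$ at time $0$; the initial queue lengths are independent of the arrival and service variables. The maximum queue length at time $n\ge0$ is $$Q^{(N)}_{(\alpha,\beta)}(n)=\max_{i\le N}\max\left(\sup_{0\le k\le n}\left[\left(A^{(N)}(n)-A^{(N)}(k)\right)-\left(S_i^{(N)}(n)-S_i^{(N)}(k)\right)\right],\; Q_i^{(N)}(0)+A^{(N)}(n)-S_i^{(N)}(n)\right).$$ In particular $Q^{(N)}_{(\alpha,\beta)}(0)=\max_{i\le N}Q_i^{(N)}(0)$. The right endpoint of $U_i$ is $\sup\{x:\mathbb{P}(U_i>x)>0\}$.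 *)

theory Defs
  imports "HOL-Probability.Probability"
begin

definition arrival_prob :: "real \<Rightarrow> real \<Rightarrow> nat \<Rightarrow> real" where
  "arrival_prob \<alpha> \<beta> N = 1 - \<alpha> / real N - \<beta> / (real N)\<^sup>2"

definition service_prob :: "real \<Rightarrow> nat \<Rightarrow> real" where
  "service_prob \<alpha> N = 1 - \<alpha> / real N"

text \<open>The system sizes for which the model is defined.\<close>
definition admissible :: "real \<Rightarrow> real \<Rightarrow> nat \<Rightarrow> bool" where
  "admissible \<alpha> \<beta> N \<longleftrightarrow> N \<ge> 2 \<and> \<alpha> / real N + \<beta> / (real N)\<^sup>2 < 1"

definition (in prob_space) iid_vars :: "'b measure \<Rightarrow> ('i \<Rightarrow> 'a \<Rightarrow> 'b) \<Rightarrow> 'i set \<Rightarrow> bool" where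
  "iid_vars S Z I \<longleftrightarrow>
     indep_vars (\<lambda>_. S) Z I \<and> (\<forall>i\<in>I. \<forall>j\<in>I. distr M S (Z i) = distr M S (Z j))"

text \<open>
  \<open>X N j\<close> is the arrival indicator of slot \<open>j\<close> in the system with \<open>N\<close> servers, \<open>Y N i j\<close> the
  potential service indicator of server \<open>i\<close> in slot \<open>j\<close>, and \<open>Q0 N i\<close> the initial number of jobs at
  server \<open>i\<close>. Slots and servers are numbered from 1.
  To state mutual independence, arrivals and services of one system are merged into one family over
  a sum type: \<open>Inl j\<close> for the arrival in slot \<open>j\<close>, \<open>Inr (i, j)\<close> for the service of server \<open>i\<close> in slot
  \<open>j\<close>. No joint assumption is made across different \<open>N\<close>.
  Independence of the initial lengths from the primitives is independence of the generated
  sigma-algebras (\<^const>\<open>prob_space.indep_var\<close> would require both vectors to have the same type).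
\<close>

definition primitives ::
    "(nat \<Rightarrow> nat \<Rightarrow> 'a \<Rightarrow> bool) \<Rightarrow> (nat \<Rightarrow> nat \<Rightarrow> nat \<Rightarrow> 'a \<Rightarrow> bool) \<Rightarrow> nat
      \<Rightarrow> nat + nat \<times> nat \<Rightarrow> 'a \<Rightarrow> bool" where
  "primitives X Y N = case_sum (X N) (\<lambda>(i, j). Y N i j)"

definition primitive_indices :: "nat \<Rightarrow> (nat + nat \<times> nat) set" where
  "primitive_indices N = {1..} <+> ({1..N} \<times> {1..})"

locale fork_join_model = prob_space M for M :: "'a measure" +
  fixes \<alpha> \<beta> :: real
    and X :: "nat \<Rightarrow> nat \<Rightarrow> 'a \<Rightarrow> bool"
    and Y :: "nat \<Rightarrow> nat \<Rightarrow> nat \<Rightarrow> 'a \<Rightarrow> bool"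
    and Q0 :: "nat \<Rightarrow> nat \<Rightarrow> 'a \<Rightarrow> int"
  assumes arrival_bernoulli:
    "\<And>N j. admissible \<alpha> \<beta> N \<Longrightarrow> j \<ge> 1 \<Longrightarrow>
       distr M (count_space UNIV) (X N j) = measure_pmf (bernoulli_pmf (arrival_prob \<alpha> \<beta> N))"
  and service_bernoulli:
    "\<And>N i j. admissible \<alpha> \<beta> N \<Longrightarrow> i \<in> {1..N} \<Longrightarrow> j \<ge> 1 \<Longrightarrow>
       distr M (count_space UNIV) (Y N i j) = measure_pmf (bernoulli_pmf (service_prob \<alpha> N))"
  and primitives_indep:
    "\<And>N. admissible \<alpha> \<beta> N \<Longrightarrow>
       indep_vars (\<lambda>_. count_space UNIV) (primitives X Y N) (primitive_indices N)"
  and initial_measurable: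
    "\<And>N i. admissible \<alpha> \<beta> N \<Longrightarrow> i \<in> {1..N} \<Longrightarrow> random_variable (count_space UNIV) (Q0 N i)"
  and initial_indep:
    "\<And>N. admissible \<alpha> \<beta> N \<Longrightarrow>
       indep_set
         (sets (vimage_algebra (space M) (\<lambda>\<omega>. \<lambda>i\<in>{1..N}. Q0 N i \<omega>)
            (PiM {1..N} (\<lambda>_. count_space UNIV))))
         (sets (vimage_algebra (space M) (\<lambda>\<omega>. \<lambda>k\<in>primitive_indices N. primitives X Y N k \<omega>)
            (PiM (primitive_indices N) (\<lambda>_. count_space UNIV))))"

definition arrivals :: "(nat \<Rightarrow> nat \<Rightarrow> 'a \<Rightarrow> bool) \<Rightarrow> nat \<Rightarrow> real \<Rightarrow> 'a \<Rightarrow> real" where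
  "arrivals X N n \<omega> = (\<Sum>j = 1..nat \<lfloor>n\<rfloor>. of_bool (X N j \<omega>))"

definition services :: "(nat \<Rightarrow> nat \<Rightarrow> nat \<Rightarrow> 'a \<Rightarrow> bool) \<Rightarrow> nat \<Rightarrow> nat \<Rightarrow> real \<Rightarrow> 'a \<Rightarrow> real" where
  "services Y N i n \<omega> = (\<Sum>j = 1..nat \<lfloor>n\<rfloor>. of_bool (Y N i j \<omega>))"

definition max_queue ::
    "(nat \<Rightarrow> nat \<Rightarrow> 'a \<Rightarrow> bool) \<Rightarrow> (nat \<Rightarrow> nat \<Rightarrow> nat \<Rightarrow> 'a \<Rightarrow> bool)
      \<Rightarrow> (nat \<Rightarrow> nat \<Rightarrow> 'a \<Rightarrow> int) \<Rightarrow> nat \<Rightarrow> real \<Rightarrow> 'a \<Rightarrow> real" where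
  "max_queue X Y Q0 N n \<omega> =
     Max ((\<lambda>i. max
        (SUP k\<in>{0..n}. (arrivals X N n \<omega> - arrivals X N k \<omega>)
                        - (services Y N i n \<omega> - services Y N i k \<omega>))
        (real_of_int (Q0 N i \<omega>) + arrivals X N n \<omega> - services Y N i n \<omega>)) ` {1..N})"

definition tail_prob :: "'a measure \<Rightarrow> ('a \<Rightarrow> real) \<Rightarrow> real \<Rightarrow> real" where
  "tail_prob M Z x = measure M {\<omega> \<in> space M. Z \<omega> > x}"

definition right_endpoint :: "'a measure \<Rightarrow> ('a \<Rightarrow> real) \<Rightarrow> ereal" where
  "right_endpoint M Z = (SUP x\<in>{x. tail_prob M Z x > 0}. ereal x)"

definition finite_right_endpoint :: "'a measure \<Rightarrow> ('a \<Rightarrow> real) \<Rightarrow> bool" where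
  "finite_right_endpoint M Z \<longleftrightarrow> \<bar>right_endpoint M Z\<bar> \<noteq> \<infinity>"

definition log_tail_ratio :: "'a measure \<Rightarrow> ('a \<Rightarrow> real) \<Rightarrow> real \<Rightarrow> real \<Rightarrow> real" where
  "log_tail_ratio M Z v t = (- ln (tail_prob M Z (v * t))) / (- ln (tail_prob M Z t))"

definition tail_exponent :: "'a measure \<Rightarrow> ('a \<Rightarrow> real) \<Rightarrow> real \<Rightarrow> real" where
  "tail_exponent M Z v = Lim at_top (log_tail_ratio M Z v)"

text \<open>``Continuous random variable'' means that the distribution function is continuous; a
  density is not required.\<close>
definition regular_unbounded_tail :: "'a measure \<Rightarrow> ('a \<Rightarrow> real) \<Rightarrow> bool" where
  "regular_unbounded_tail M Z \<longleftrightarrow>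
     continuous_on UNIV (cdf (distr M borel Z)) \<and>
     (\<forall>t. tail_prob M Z t > 0) \<and>
     (\<forall>v\<in>{0..1}. \<exists>l. (log_tail_ratio M Z v \<longlongrightarrow> l) at_top)"

text \<open>A finite right endpoint excludes \<^const>\<open>regular_unbounded_tail\<close>, so the case distinction is
  unambiguous; the second branch is meant only under \<^const>\<open>regular_unbounded_tail\<close>.\<close>
definition initial_growth :: "'a measure \<Rightarrow> ('a \<Rightarrow> real) \<Rightarrow> real \<Rightarrow> real \<Rightarrow> real \<Rightarrow> real" where
  "initial_growth M Z \<alpha> t q0 =
     (if finite_right_endpoint M Z then q0 + sqrt (2 * \<alpha> * t)
      else Sup {sqrt (2 * \<alpha> * t) * u + q0 * v | u v.
                  u\<^sup>2 + tail_exponent M Z v \<le> 1 \<and> 0 \<le> u \<and> u \<le> 1 \<and> 0 \<le> v \<and> v \<le> 1})"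

definition fluid_limit :: "'a measure \<Rightarrow> ('a \<Rightarrow> real) \<Rightarrow> real \<Rightarrow> real \<Rightarrow> real \<Rightarrow> real \<Rightarrow> real" where
  "fluid_limit M Z \<alpha> \<beta> q0 t =
     max ((sqrt (2 * \<alpha> * t) - \<beta> * t) * of_bool (t < \<alpha> / (2 * \<beta>\<^sup>2))
            + \<alpha> / (2 * \<beta>) * of_bool (t \<ge> \<alpha> / (2 * \<beta>\<^sup>2)))
         (initial_growth M Z \<alpha> t q0 - \<beta> * t)"

end

theory Submission
  imports Defs "HOL-Real_Asymp.Real_Asymp"
begin

text \<open>
  Over \<open>t N\<^sup>3 log N\<close> slots a server fails to offer service about \<open>\<alpha> t N\<^sup>2 log N\<close> times, so its centred
  service noise, divided by \<open>N log N\<close>, is close to a Gaussian variable of variance \<open>\<alpha> t / log N\<close>: it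
  exceeds \<open>x\<close> with probability \<open>N\<close> to the power \<open>- x\<^sup>2 / (2 \<alpha> t) + o(1)\<close>. Only this exponent matters,
  and both bounds for it follow from the exponential moments of a Bernoulli variable
  (\<open>gaussian_log_mgf_upper_tail\<close>, \<open>gaussian_log_mgf_lower_tail\<close>). Among \<open>N\<close> independent servers an event
  of probability \<open>N\<close> to the power \<open>-e\<close> occurs if \<open>e < 1\<close> and does not if \<open>e > 1\<close>; hence the largest noise is
  \<open>sqrt (2 \<alpha> t)\<close>. The arrivals are shared by all servers, so there is no maximum to take and their
  noise is negligible, while the difference of the success probabilities gives the drift \<open>-\<beta> t\<close>.

  Whatever happens to its initial jobs, the backlog that a server builds up by itself is the largest
  increment of its walk over a final stretch of time \<open>s \<le> t\<close>. The maximum over the servers is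
  therefore the maximum of \<open>sqrt (2 \<alpha> s) - \<beta> s\<close> over \<open>s \<le> t\<close>, which is the first component of the limit.

  For the second component the exponent of a large start is added. If a start of size \<open>v q0\<close> has
  probability \<open>N\<close> to the power \<open>-H v\<close>, then, by independence, a start \<open>v q0\<close> together with a noise
  \<open>u sqrt (2 \<alpha> t)\<close> has exponent \<open>u\<^sup>2 + H v\<close>, and some server realises the pair precisely when this is
  at most 1. Maximising the sum gives the constrained supremum
  (\<open>whp_ex_start_plus_noise_gt\<close>, \<open>whp_start_plus_noise_le\<close>). The locale \<open>fork_join_start_profile\<close>
  isolates what is required of \<open>H\<close>. If \<open>q0 = 0\<close>, every \<open>H\<close> with \<open>H 0 = 0\<close> and values in the unit interval qualifies. If the
  right endpoint is finite, a positive fraction of the servers starts near the maximum, so \<open>H = 0\<close>.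
  In the regular case, convergence of the maximal start forces the \<open>1/N\<close>-quantile of the law to lie
  near \<open>q0 N log N / r\<^sub>N\<close>, and the tail at \<open>v\<close> times this quantile is \<open>N\<close> to the power \<open>-h(v)\<close> by
  definition of \<open>h\<close>. The function \<open>h\<close> may be discontinuous at 0 and 1; the argument never passes
  to a limit in \<open>v\<close>.

  Convergence becomes uniform in time because Lindley's formula is Lipschitz in the walk
  (\<open>lindley_modulus\<close>) and the walks oscillate little over short blocks (\<open>whp_walk_modulus\<close>). For a block
  of \<open>\<Delta> N\<^sup>3 log N\<close> slots with small \<open>\<Delta>\<close>, an excursion of size \<open>\<epsilon> N log N\<close> at a given slot has probability
  at most a large negative power of \<open>N\<close>, so that a union bound over all slots and all servers suffices.
\<close>

section \<open>Events of probability tending to one\<close>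

text \<open>
  \<open>P N\<close> holds with probability tending to 1. The exceptional sets are required to be measurable whereas
  \<open>P N\<close> itself may fail to be, so that \<open>whp\<close> is closed under implication and can be applied to suprema over
  uncountably many times.
\<close>
definition (in prob_space) whp :: "(nat \<Rightarrow> 'a \<Rightarrow> bool) \<Rightarrow> bool" where
  "whp P \<longleftrightarrow> (\<exists>B. (\<forall>N. B N \<in> events) \<and> (\<lambda>N. prob (B N)) \<longlonglongrightarrow> 0 \<and>
     (\<forall>\<^sub>F N in sequentially. \<forall>\<omega>\<in>space M - B N. P N \<omega>))"

context prob_space
begin

lemma whp_mono:
  assumes "whp P" "\<forall>\<^sub>F N in sequentially. \<forall>\<omega>\<in>space M. P N \<omega> \<longrightarrow> Q N \<omega>"
  shows "whp Q"
proof -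
  obtain B where B: "\<forall>N. B N \<in> events" "(\<lambda>N. prob (B N)) \<longlonglongrightarrow> 0"
    "\<forall>\<^sub>F N in sequentially. \<forall>\<omega>\<in>space M - B N. P N \<omega>"
    using assms(1) unfolding whp_def by blast
  have "\<forall>\<^sub>F N in sequentially. \<forall>\<omega>\<in>space M - B N. Q N \<omega>"
    using B(3) assms(2) by eventually_elim blast
  with B(1,2) show ?thesis unfolding whp_def by blast
qed

lemma whp_eventually: "\<forall>\<^sub>F N in sequentially. \<forall>\<omega>\<in>space M. P N \<omega> \<Longrightarrow> whp P"
  unfolding whp_def by (intro exI[of _ "\<lambda>_. {}"]) (auto elim: eventually_mono)

lemma whp_conj:
  assumes "whp P" "whp Q"
  shows "whp (\<lambda>N \<omega>. P N \<omega> \<and> Q N \<omega>)"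
proof -
  obtain B where B: "\<forall>N. B N \<in> events" "(\<lambda>N. prob (B N)) \<longlonglongrightarrow> 0"
    "\<forall>\<^sub>F N in sequentially. \<forall>\<omega>\<in>space M - B N. P N \<omega>"
    using assms(1) unfolding whp_def by blast
  obtain C where C: "\<forall>N. C N \<in> events" "(\<lambda>N. prob (C N)) \<longlonglongrightarrow> 0"
    "\<forall>\<^sub>F N in sequentially. \<forall>\<omega>\<in>space M - C N. Q N \<omega>"
    using assms(2) unfolding whp_def by blast
  have "(\<lambda>N. prob (B N \<union> C N)) \<longlonglongrightarrow> 0"
  proof (rule tendsto_sandwich[OF _ _ tendsto_const])
    show "\<forall>\<^sub>F N in sequentially. prob (B N \<union> C N) \<le> prob (B N) + prob (C N)"
      using B(1) C(1) by (intro always_eventually) (simp add: measure_Un_le)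
    show "(\<lambda>N. prob (B N) + prob (C N)) \<longlonglongrightarrow> 0"
      using tendsto_add[OF B(2) C(2)] by simp
  qed auto
  moreover have "\<forall>\<^sub>F N in sequentially. \<forall>\<omega>\<in>space M - (B N \<union> C N). P N \<omega> \<and> Q N \<omega>"
    using B(3) C(3) by eventually_elim blast
  ultimately show ?thesis
    unfolding whp_def using B(1) C(1) by (intro exI[of _ "\<lambda>N. B N \<union> C N"]) auto
qed

lemma whp_mono2:
  assumes "whp P" "whp Q" "\<forall>\<^sub>F N in sequentially. \<forall>\<omega>\<in>space M. P N \<omega> \<longrightarrow> Q N \<omega> \<longrightarrow> R N \<omega>"
  shows "whp R"
  by (rule whp_mono[OF whp_conj[OF assms(1,2)]]) (use assms(3) in \<open>auto elim: eventually_mono\<close>)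

lemma whp_elim:
  assumes "whp P" "\<And>N \<omega>. N \<ge> 2 \<Longrightarrow> P N \<omega> \<Longrightarrow> R N \<omega>"
  shows "whp R"
  using whp_mono[OF assms(1)] eventually_mono[OF eventually_ge_at_top[of "2::nat"]] assms(2) by auto

lemma whp_elim2:
  assumes "whp P" "whp Q" "\<And>N \<omega>. N \<ge> 2 \<Longrightarrow> P N \<omega> \<Longrightarrow> Q N \<omega> \<Longrightarrow> R N \<omega>"
  shows "whp R"
  by (rule whp_elim[OF whp_conj[OF assms(1,2)]]) (use assms(3) in auto)

lemma whp_elim3:
  assumes "whp P" "whp Q" "whp S" "\<And>N \<omega>. N \<ge> 2 \<Longrightarrow> P N \<omega> \<Longrightarrow> Q N \<omega> \<Longrightarrow> S N \<omega> \<Longrightarrow> R N \<omega>"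
  shows "whp R"
  by (rule whp_elim2[OF whp_conj[OF assms(1,2)] assms(3)]) (use assms(4) in auto)

lemma whp_ball_finite:
  assumes "finite J" "\<And>j. j \<in> J \<Longrightarrow> whp (P j)"
  shows "whp (\<lambda>N \<omega>. \<forall>j\<in>J. P j N \<omega>)"
  using assms
proof (induction J rule: finite_induct)
  case empty
  then show ?case by (intro whp_eventually) auto
next
  case (insert j J)
  then have "whp (\<lambda>N \<omega>. P j N \<omega> \<and> (\<forall>j\<in>J. P j N \<omega>))" by (intro whp_conj) auto
  then show ?case by (rule whp_mono) auto
qed

lemma whp_prob_boundI:
  assumes "\<forall>\<^sub>F N in sequentially. {\<omega>\<in>space M. \<not> P N \<omega>} \<in> events \<and> prob {\<omega>\<in>space M. \<not> P N \<omega>} \<le> f N"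
    and "f \<longlonglongrightarrow> 0"
  shows "whp P"
proof -
  define B where "B N = (if {\<omega>\<in>space M. \<not> P N \<omega>} \<in> events then {\<omega>\<in>space M. \<not> P N \<omega>} else {})" for N
  have "\<forall>N. B N \<in> events" by (auto simp: B_def)
  moreover have "\<forall>\<^sub>F N in sequentially. \<forall>\<omega>\<in>space M - B N. P N \<omega>"
    using assms(1) by eventually_elim (auto simp: B_def)
  moreover have "(\<lambda>N. prob (B N)) \<longlonglongrightarrow> 0"
    by (rule tendsto_sandwich[OF _ _ tendsto_const assms(2)])
       (use assms(1) in \<open>auto simp: B_def elim: eventually_mono\<close>)
  ultimately show ?thesis unfolding whp_def by blast
qed

lemma whp_AE:
  assumes "\<forall>\<^sub>F N in sequentially. AE \<omega> in M. P N \<omega>"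
  shows "whp P"
proof -
  have "\<exists>S. S \<in> events \<and> prob S = 0 \<and> ((AE \<omega> in M. P N \<omega>) \<longrightarrow> (\<forall>\<omega>\<in>space M - S. P N \<omega>))" for N
  proof (cases "AE \<omega> in M. P N \<omega>")
    case True
    then obtain S where S: "{\<omega>\<in>space M. \<not> P N \<omega>} \<subseteq> S" "emeasure M S = 0" "S \<in> events"
      by (rule AE_E)
    then show ?thesis by (intro exI[of _ S]) (auto simp: measure_def)
  qed (auto intro!: exI[of _ "{}"])
  then obtain B where B: "\<And>N. B N \<in> events" "\<And>N. prob (B N) = 0"
    "\<And>N. (AE \<omega> in M. P N \<omega>) \<Longrightarrow> \<forall>\<omega>\<in>space M - B N. P N \<omega>" by metis
  have "\<forall>\<^sub>F N in sequentially. \<forall>\<omega>\<in>space M - B N. P N \<omega>"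
    using assms by eventually_elim (rule B(3))
  then show ?thesis unfolding whp_def using B(1,2) by (intro exI[of _ B]) auto
qed

text \<open>
  The set need not be measurable; in that case its measure is 0 by convention.
\<close>
lemma whp_imp_prob_tendsto_0:
  assumes "whp P"
  shows "(\<lambda>N. prob {\<omega>\<in>space M. \<not> P N \<omega>}) \<longlonglongrightarrow> 0"
proof -
  obtain B where B: "\<And>N. B N \<in> events" "(\<lambda>N. prob (B N)) \<longlonglongrightarrow> 0"
    "\<forall>\<^sub>F N in sequentially. \<forall>\<omega>\<in>space M - B N. P N \<omega>"
    using assms unfolding whp_def by blast
  have "\<forall>\<^sub>F N in sequentially. prob {\<omega>\<in>space M. \<not> P N \<omega>} \<le> prob (B N)"
    using B(3)
  proof eventually_elim
    case (elim N)
    have "{\<omega>\<in>space M. \<not> P N \<omega>} \<subseteq> B N" using elim by blast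
    then show ?case using B(1)[of N] finite_measure_mono by blast
  qed
  then show ?thesis
    by (intro tendsto_sandwich[OF _ _ tendsto_const B(2)]) auto
qed

end

section \<open>Moderate deviations from exponential moments\<close>

text \<open>
  The logarithmic moment generating function at speed \<open>log N\<close> converges to that of a centred Gaussian
  with variance \<open>c\<close>. The sequence \<open>\<kappa>\<close> does not depend on the index \<open>i\<close>, which makes all bounds
  derived from it uniform over the servers.
\<close>
definition (in prob_space) gaussian_log_mgf ::
    "real \<Rightarrow> (nat \<Rightarrow> 'i set) \<Rightarrow> (nat \<Rightarrow> 'i \<Rightarrow> 'a \<Rightarrow> real) \<Rightarrow> bool" where
  "gaussian_log_mgf c I Z \<longleftrightarrow> (\<forall>\<theta>. \<exists>\<kappa>. \<kappa> \<longlonglongrightarrow> c * \<theta>\<^sup>2 / 2 \<and>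
     (\<forall>\<^sub>F N in sequentially. \<forall>i\<in>I N. Z N i \<in> borel_measurable M \<and>
        integrable M (\<lambda>\<omega>. exp (\<theta> * ln (real N) * Z N i \<omega>)) \<and>
        expectation (\<lambda>\<omega>. exp (\<theta> * ln (real N) * Z N i \<omega>)) = exp (ln (real N) * \<kappa> N)))"

context prob_space
begin

lemma gaussian_log_mgfE:
  assumes "gaussian_log_mgf c I Z"
  obtains \<kappa> where "\<kappa> \<longlonglongrightarrow> c * \<theta>\<^sup>2 / 2"
    "\<forall>\<^sub>F N in sequentially. \<forall>i\<in>I N. Z N i \<in> borel_measurable M \<and>
        integrable M (\<lambda>\<omega>. exp (\<theta> * ln (real N) * Z N i \<omega>)) \<and>
        expectation (\<lambda>\<omega>. exp (\<theta> * ln (real N) * Z N i \<omega>)) = exp (ln (real N) * \<kappa> N)"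
  using assms unfolding gaussian_log_mgf_def by blast

lemma gaussian_log_mgf_uminus:
  assumes "gaussian_log_mgf c I Z"
  shows "gaussian_log_mgf c I (\<lambda>N i \<omega>. - Z N i \<omega>)"
  unfolding gaussian_log_mgf_def
proof
  fix \<theta> :: real
  obtain \<kappa> where "\<kappa> \<longlonglongrightarrow> c * (-\<theta>)\<^sup>2 / 2"
    "\<forall>\<^sub>F N in sequentially. \<forall>i\<in>I N. Z N i \<in> borel_measurable M \<and>
        integrable M (\<lambda>\<omega>. exp (-\<theta> * ln (real N) * Z N i \<omega>)) \<and>
        expectation (\<lambda>\<omega>. exp (-\<theta> * ln (real N) * Z N i \<omega>)) = exp (ln (real N) * \<kappa> N)"
    by (rule gaussian_log_mgfE[OF assms])
  then show "\<exists>\<kappa>. \<kappa> \<longlonglongrightarrow> c * \<theta>\<^sup>2 / 2 \<and>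
     (\<forall>\<^sub>F N in sequentially. \<forall>i\<in>I N. (\<lambda>\<omega>. - Z N i \<omega>) \<in> borel_measurable M \<and>
        integrable M (\<lambda>\<omega>. exp (\<theta> * ln (real N) * - Z N i \<omega>)) \<and>
        expectation (\<lambda>\<omega>. exp (\<theta> * ln (real N) * - Z N i \<omega>)) = exp (ln (real N) * \<kappa> N))"
    by (intro exI[of _ \<kappa>]) (auto elim!: eventually_mono)
qed

text \<open>
  Chernoff's bound, with the parameter \<open>x / c\<close> that is optimal for a Gaussian of variance \<open>c\<close>.
\<close>
lemma gaussian_log_mgf_upper_tail:
  assumes Z: "gaussian_log_mgf c I Z" and "c > 0" "x \<ge> 0" "d < x\<^sup>2 / (2 * c)"
  shows "\<forall>\<^sub>F N in sequentially. \<forall>i\<in>I N. Z N i \<in> borel_measurable M \<and>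
           prob {\<omega>\<in>space M. Z N i \<omega> > x} \<le> real N powr (-d)"
proof -
  define \<theta> where "\<theta> = x / c"
  obtain \<kappa> where k: "\<kappa> \<longlonglongrightarrow> c * \<theta>\<^sup>2 / 2" and
    mgf: "\<forall>\<^sub>F N in sequentially. \<forall>i\<in>I N. Z N i \<in> borel_measurable M \<and>
        integrable M (\<lambda>\<omega>. exp (\<theta> * ln (real N) * Z N i \<omega>)) \<and>
        expectation (\<lambda>\<omega>. exp (\<theta> * ln (real N) * Z N i \<omega>)) = exp (ln (real N) * \<kappa> N)"
    by (rule gaussian_log_mgfE[OF Z])
  have "c * \<theta>\<^sup>2 / 2 - \<theta> * x = - (x\<^sup>2 / (2 * c))"
    using \<open>c > 0\<close> by (simp add: \<theta>_def power2_eq_square field_simps)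
  then have "c * \<theta>\<^sup>2 / 2 < \<theta> * x - d" using assms(4) by linarith
  then have "\<forall>\<^sub>F N in sequentially. \<kappa> N < \<theta> * x - d" by (rule order_tendstoD(2)[OF k])
  with mgf eventually_ge_at_top[of 2] show ?thesis
  proof eventually_elim
    case (elim N)
    have L: "ln (real N) > 0" using elim by simp
    show ?case
    proof
      fix i assume i: "i \<in> I N"
      note mgf_i = bspec[OF elim(1) i]
      then have [measurable]: "Z N i \<in> borel_measurable M" by simp
      have th: "\<theta> \<ge> 0" using assms(2,3) by (simp add: \<theta>_def)
      have "prob {\<omega>\<in>space M. Z N i \<omega> > x}
          \<le> prob {\<omega>\<in>space M. exp (\<theta> * ln (real N) * Z N i \<omega>) \<ge> exp (\<theta> * ln (real N) * x)}"
        using th L by (intro finite_measure_mono) (auto intro!: mult_left_mono)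
      also have "\<dots> \<le> expectation (\<lambda>\<omega>. exp (\<theta> * ln (real N) * Z N i \<omega>)) / exp (\<theta> * ln (real N) * x)"
        using mgf_i by (intro integral_Markov_inequality_measure[where A = "{}"]) auto
      also have "\<dots> = exp (ln (real N) * (\<kappa> N - \<theta> * x))"
        using mgf_i by (simp add: exp_diff algebra_simps)
      also have "\<dots> \<le> exp (ln (real N) * (-d))"
        using L elim by (intro exp_le_cancel_iff[THEN iffD2] mult_left_mono) auto
      also have "\<dots> = real N powr (-d)" using elim by (simp add: powr_def algebra_simps)
      finally show "Z N i \<in> borel_measurable M \<and>
           prob {\<omega>\<in>space M. Z N i \<omega> > x} \<le> real N powr (-d)" by simp
    qed
  qed
qed

text \<open>
  For the lower bound on a tail, the exponential moment at \<open>\<theta>\<close> has to be carried by values near its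
  tilted mean. Below \<open>a\<close> and above \<open>b\<close> the weight is compared with the moments at \<open>\<theta> - \<eta>\<close> and \<open>\<theta> + \<eta>\<close>,
  which will be of smaller exponential order; what is left is the probability of exceeding \<open>a\<close>.
\<close>
lemma exp_split_around_tilted_mean:
  fixes L :: real
  assumes "L \<ge> 0" "\<theta> \<ge> 0" "\<eta> \<ge> 0"
  shows "exp (\<theta> * L * z) \<le> exp (\<eta> * L * a) * exp ((\<theta> - \<eta>) * L * z)
     + exp (\<theta> * L * b) * indicator {a<..} z + exp (- \<eta> * L * b) * exp ((\<theta> + \<eta>) * L * z)"
proof -
  consider "z \<le> a" | "a < z" "z \<le> b" | "z > b" by linarith
  then show ?thesis
  proof cases
    case 1
    then have "0 \<le> \<eta> * L * (a - z)" using assms by simp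
    then have "exp (\<theta> * L * z) \<le> exp (\<eta> * L * a) * exp ((\<theta> - \<eta>) * L * z)"
      unfolding exp_add[symmetric] exp_le_cancel_iff by (simp add: algebra_simps)
    then show ?thesis using 1 by (simp add: add_increasing2)
  next
    case 2
    then have "exp (\<theta> * L * z) \<le> exp (\<theta> * L * b)" using assms by (simp add: mult_left_mono)
    then show ?thesis using 2 by (simp add: add_increasing add_increasing2)
  next
    case 3
    then have "0 \<le> \<eta> * L * (z - b)" using assms by simp
    then have "exp (\<theta> * L * z) \<le> exp (- \<eta> * L * b) * exp ((\<theta> + \<eta>) * L * z)"
      unfolding exp_add[symmetric] exp_le_cancel_iff by (simp add: algebra_simps)
    moreover have "exp (\<eta> * L * a) * exp ((\<theta> - \<eta>) * L * z) + exp (\<theta> * L * b) * indicator {a<..} z \<ge> 0"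
      by (simp add: indicator_def)
    ultimately show ?thesis by linarith
  qed
qed

text \<open>
  Cramer's lower bound by exponential tilting: the tilt that moves the mean to a point \<open>y\<close> slightly
  above \<open>x\<close> concentrates within \<open>\<delta> = y - x\<close> of \<open>y\<close>, and costs at most \<open>\<theta> (y + \<delta>)\<close> in the exponent.
\<close>
lemma gaussian_log_mgf_lower_tail:
  assumes Z: "gaussian_log_mgf c I Z" and "c > 0" "x \<ge> 0" "x\<^sup>2 / (2 * c) < d"
  shows "\<forall>\<^sub>F N in sequentially. \<forall>i\<in>I N. Z N i \<in> borel_measurable M \<and>
           real N powr (-d) \<le> prob {\<omega>\<in>space M. Z N i \<omega> > x}"
proof -
  (* The cost of the tilt to y is continuous in y and equals the Gaussian exponent at y = x. *)
  have "((\<lambda>y. y / c * (2 * y - x) - c * (y / c)\<^sup>2 / 2) \<longlongrightarrow>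
          x / c * (2 * x - x) - c * (x / c)\<^sup>2 / 2) (at_right x)"
    by (intro tendsto_intros) (use \<open>c > 0\<close> in auto)
  moreover have "x / c * (2 * x - x) - c * (x / c)\<^sup>2 / 2 = x\<^sup>2 / (2 * c)"
    using \<open>c > 0\<close> by (simp add: power2_eq_square field_simps)
  ultimately have "\<forall>\<^sub>F y in at_right x. y / c * (2 * y - x) - c * (y / c)\<^sup>2 / 2 < d"
    using assms(4) by (auto intro: order_tendstoD(2))
  then have "\<forall>\<^sub>F y in at_right x. y / c * (2 * y - x) - c * (y / c)\<^sup>2 / 2 < d \<and> y > x"
    by (intro eventually_conj) (auto simp: eventually_at_right_less)
  then obtain y where y: "y / c * (2 * y - x) - c * (y / c)\<^sup>2 / 2 < d" "y > x"
    using eventually_happens'[OF trivial_limit_at_right_real] by blast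
  define \<theta> where "\<theta> = y / c"
  define \<delta> where "\<delta> = y - x"
  define \<eta> where "\<eta> = \<delta> / c"
  define m where "m = c * \<theta>\<^sup>2 / 2"
  (* 2 tau is at most the gain of the shift by eta and at most the slack in the exponent d. *)
  define \<tau> where "\<tau> = min (\<delta>\<^sup>2 / (6 * c)) ((d - (\<theta> * (y + \<delta>) - m)) / 2)"
  have th: "\<theta> \<ge> 0" "\<eta> \<ge> 0" using assms(2,3) y by (auto simp: \<theta>_def \<eta>_def \<delta>_def)
  have \<delta>: "\<delta> > 0" using y by (simp add: \<delta>_def)
  have gap: "\<theta> * (y + \<delta>) - m < d"
    using y(1) by (simp add: \<theta>_def \<delta>_def m_def)
  have \<tau>: "\<tau> > 0" "2 * \<tau> < \<delta>\<^sup>2 / (2 * c)" "2 * \<tau> \<le> d - (\<theta> * (y + \<delta>) - m)"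
  proof -
    have "\<delta>\<^sup>2 / c > 0" using \<delta> \<open>c > 0\<close> by simp
    then show "\<tau> > 0" "2 * \<tau> < \<delta>\<^sup>2 / (2 * c)" "2 * \<tau> \<le> d - (\<theta> * (y + \<delta>) - m)"
      using gap by (auto simp: \<tau>_def min_def field_simps)
  qed
  obtain \<kappa> where k: "\<kappa> \<longlonglongrightarrow> c * \<theta>\<^sup>2 / 2" and
    mgf: "\<forall>\<^sub>F N in sequentially. \<forall>i\<in>I N. Z N i \<in> borel_measurable M \<and>
        integrable M (\<lambda>\<omega>. exp (\<theta> * ln (real N) * Z N i \<omega>)) \<and>
        expectation (\<lambda>\<omega>. exp (\<theta> * ln (real N) * Z N i \<omega>)) = exp (ln (real N) * \<kappa> N)"
    by (rule gaussian_log_mgfE[OF Z])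
  obtain \<kappa>1 where k1: "\<kappa>1 \<longlonglongrightarrow> c * (\<theta> - \<eta>)\<^sup>2 / 2" and
    mgf1: "\<forall>\<^sub>F N in sequentially. \<forall>i\<in>I N. Z N i \<in> borel_measurable M \<and>
        integrable M (\<lambda>\<omega>. exp ((\<theta> - \<eta>) * ln (real N) * Z N i \<omega>)) \<and>
        expectation (\<lambda>\<omega>. exp ((\<theta> - \<eta>) * ln (real N) * Z N i \<omega>)) = exp (ln (real N) * \<kappa>1 N)"
    by (rule gaussian_log_mgfE[OF Z])
  obtain \<kappa>2 where k2: "\<kappa>2 \<longlonglongrightarrow> c * (\<theta> + \<eta>)\<^sup>2 / 2" and
    mgf2: "\<forall>\<^sub>F N in sequentially. \<forall>i\<in>I N. Z N i \<in> borel_measurable M \<and>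
        integrable M (\<lambda>\<omega>. exp ((\<theta> + \<eta>) * ln (real N) * Z N i \<omega>)) \<and>
        expectation (\<lambda>\<omega>. exp ((\<theta> + \<eta>) * ln (real N) * Z N i \<omega>)) = exp (ln (real N) * \<kappa>2 N)"
    by (rule gaussian_log_mgfE[OF Z])
  (* Shifting the tilt by eta = delta / c loses delta^2 / (2 c) on either side of the window. *)
  have e1: "c * (\<theta> - \<eta>)\<^sup>2 / 2 = m - \<delta>\<^sup>2 / (2 * c) - \<eta> * x"
    and e2: "c * (\<theta> + \<eta>)\<^sup>2 / 2 = m - \<delta>\<^sup>2 / (2 * c) + \<eta> * (y + \<delta>)"
    using \<open>c > 0\<close> by (simp_all add: m_def \<theta>_def \<eta>_def \<delta>_def power2_eq_square field_simps)
  have "\<forall>\<^sub>F N in sequentially. \<kappa> N > m - \<tau>"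
    using order_tendstoD(1)[OF k, of "m - \<tau>"] \<tau>(1) by (simp add: m_def)
  moreover have "\<forall>\<^sub>F N in sequentially. \<kappa>1 N < m - 2 * \<tau> - \<eta> * x"
    by (rule order_tendstoD(2)[OF k1]) (use \<tau> e1 in linarith)
  moreover have "\<forall>\<^sub>F N in sequentially. \<kappa>2 N < m - 2 * \<tau> + \<eta> * (y + \<delta>)"
    by (rule order_tendstoD(2)[OF k2]) (use \<tau> e2 in linarith)
  moreover have "\<forall>\<^sub>F N::nat in sequentially. exp (- (ln (real N) * \<tau>)) < 1 / 3"
    by (rule order_tendstoD(2)) (use \<tau>(1) in real_asymp, simp)
  ultimately show ?thesis
    using mgf mgf1 mgf2 eventually_ge_at_top[of 2]
  proof eventually_elim
    case (elim N)
    define L where "L = ln (real N)"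
    have L: "L > 0" using elim by (simp add: L_def)
    show ?case
    proof
      fix i assume i: "i \<in> I N"
      note A = bspec[OF elim(5) i, folded L_def] bspec[OF elim(6) i, folded L_def]
        bspec[OF elim(7) i, folded L_def]
      from A have [measurable]: "Z N i \<in> borel_measurable M" by simp
      let ?p = "prob {\<omega>\<in>space M. Z N i \<omega> > x}"
      have ind: "integrable M (indicator {\<omega>\<in>space M. Z N i \<omega> > x} :: 'a \<Rightarrow> real)"
        by (rule integrable_real_indicator) (auto simp: less_top[symmetric])
      have "exp (L * \<kappa> N) = expectation (\<lambda>\<omega>. exp (\<theta> * L * Z N i \<omega>))" using A by simp
      also have "\<dots> \<le> expectation (\<lambda>\<omega>. exp (\<eta> * L * x) * exp ((\<theta> - \<eta>) * L * Z N i \<omega>)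
         + exp (\<theta> * L * (y + \<delta>)) * indicator {\<omega>\<in>space M. Z N i \<omega> > x} \<omega>
         + exp (- \<eta> * L * (y + \<delta>)) * exp ((\<theta> + \<eta>) * L * Z N i \<omega>))"
      proof (rule integral_mono)
        fix \<omega> assume w: "\<omega> \<in> space M"
        show "exp (\<theta> * L * Z N i \<omega>) \<le> exp (\<eta> * L * x) * exp ((\<theta> - \<eta>) * L * Z N i \<omega>)
         + exp (\<theta> * L * (y + \<delta>)) * indicator {\<omega>\<in>space M. Z N i \<omega> > x} \<omega>
         + exp (- \<eta> * L * (y + \<delta>)) * exp ((\<theta> + \<eta>) * L * Z N i \<omega>)"
          using exp_split_around_tilted_mean[of L \<theta> \<eta> "Z N i \<omega>" x "y + \<delta>"] L th w
          by (simp add: indicator_def)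
      qed (use A ind in auto)
      also have "\<dots> = exp (\<eta> * L * x) * exp (L * \<kappa>1 N) + exp (\<theta> * L * (y + \<delta>)) * ?p
          + exp (- \<eta> * L * (y + \<delta>)) * exp (L * \<kappa>2 N)"
        using A ind by (simp add: Int_def conj_commute)
      finally have main: "exp (L * \<kappa> N) \<le> exp (\<eta> * L * x) * exp (L * \<kappa>1 N) + exp (\<theta> * L * (y + \<delta>)) * ?p
          + exp (- \<eta> * L * (y + \<delta>)) * exp (L * \<kappa>2 N)" .
      have b1: "exp (\<eta> * L * x) * exp (L * \<kappa>1 N) \<le> exp (L * (m - 2 * \<tau>))"
        unfolding exp_add[symmetric] exp_le_cancel_iff
        using mult_left_mono[OF less_imp_le[OF elim(2)], of L] L by (simp add: algebra_simps)
      have b2: "exp (- \<eta> * L * (y + \<delta>)) * exp (L * \<kappa>2 N) \<le> exp (L * (m - 2 * \<tau>))"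
        unfolding exp_add[symmetric] exp_le_cancel_iff
        using mult_left_mono[OF less_imp_le[OF elim(3)], of L] L by (simp add: algebra_simps)
      have b3: "3 * exp (L * (m - 2 * \<tau>)) \<le> exp (L * \<kappa> N)"
      proof -
        have "3 * exp (L * (m - 2 * \<tau>)) = 3 * exp (- (L * \<tau>)) * exp (L * (m - \<tau>))"
          by (simp add: exp_add[symmetric] algebra_simps)
        also have "\<dots> \<le> exp (L * (m - \<tau>))"
          using elim(4) by (simp add: L_def)
        also have "\<dots> \<le> exp (L * \<kappa> N)" using elim(1) L by simp
        finally show ?thesis .
      qed
      have "exp (L * (m - 2 * \<tau>)) \<le> exp (\<theta> * L * (y + \<delta>)) * ?p"
        using main b1 b2 b3 by linarith
      then have "exp (L * (m - 2 * \<tau>)) * exp (- (\<theta> * L * (y + \<delta>))) \<le> ?p"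
        by (subst exp_minus) (simp add: divide_simps mult_ac flip: divide_inverse)
      moreover have "real N powr (-d) \<le> exp (L * (m - 2 * \<tau>)) * exp (- (\<theta> * L * (y + \<delta>)))"
      proof -
        have "L * (-d) \<le> L * (m - 2 * \<tau> - \<theta> * (y + \<delta>))"
          using \<tau>(3) L by (intro mult_left_mono) auto
        then show ?thesis
          unfolding exp_add[symmetric] using elim by (simp add: powr_def L_def algebra_simps)
      qed
      ultimately show "Z N i \<in> borel_measurable M \<and> real N powr (-d) \<le> ?p" by simp
    qed
  qed
qed

end

section \<open>Exponential moments of centred Bernoulli sums\<close>

lemma (in prob_space) bernoulli_sum_mgf:
  fixes B :: "'i \<Rightarrow> 'a \<Rightarrow> bool"
  assumes J: "finite J" and ind: "indep_vars (\<lambda>_. count_space UNIV) B J"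
    and B: "\<And>j. j \<in> J \<Longrightarrow> distr M (count_space UNIV) (B j) = measure_pmf (bernoulli_pmf p)"
    and p: "0 \<le> p" "p \<le> 1"
  shows "integrable M (\<lambda>\<omega>. exp (\<theta> * (\<Sum>j\<in>J. p - of_bool (B j \<omega>))))" (is ?int)
    and "expectation (\<lambda>\<omega>. exp (\<theta> * (\<Sum>j\<in>J. p - of_bool (B j \<omega>))))
      = (exp (- (\<theta> * (1 - p))) * (1 + (1 - p) * (exp \<theta> - 1))) ^ card J" (is ?mgf)
proof -
  define f where "f b = exp (\<theta> * (p - of_bool b))" for b
  have prod: "exp (\<theta> * (\<Sum>j\<in>J. p - of_bool (B j \<omega>))) = (\<Prod>j\<in>J. f (B j \<omega>))" for \<omega>
    unfolding f_def sum_distrib_left by (rule exp_sum[OF J])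
  have fB: "indep_vars (\<lambda>_. borel) (\<lambda>j \<omega>. f (B j \<omega>)) J"
    by (rule indep_vars_compose2[OF ind]) simp
  have rv: "random_variable (count_space UNIV) (B j)" if "j \<in> J" for j
    using ind that by (simp add: indep_vars_def)
  have int: "integrable M (\<lambda>\<omega>. f (B j \<omega>))" if "j \<in> J" for j
    by (rule integrable_const_bound[where B = "max (f True) (f False)"])
       (use measurable_compose[OF rv[OF that], of f borel] in \<open>auto simp: f_def intro!: AE_I2 split: split_of_bool\<close>)
  have exp_f: "expectation (\<lambda>\<omega>. f (B j \<omega>)) = exp (- (\<theta> * (1 - p))) * (1 + (1 - p) * (exp \<theta> - 1))"
    if "j \<in> J" for j
  proof -
    have "expectation (\<lambda>\<omega>. f (B j \<omega>)) = integral\<^sup>L (distr M (count_space UNIV) (B j)) f"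
      by (rule integral_distr[symmetric]) (use rv[OF that] in auto)
    also have "\<dots> = measure_pmf.expectation (bernoulli_pmf p) f" by (simp add: B[OF that])
    also have "\<dots> = p * f True + (1 - p) * f False" using p by simp
    also have "\<dots> = exp (- (\<theta> * (1 - p))) * (1 + (1 - p) * (exp \<theta> - 1))"
    proof -
      have "f True = exp (- (\<theta> * (1 - p)))" "f False = exp (- (\<theta> * (1 - p))) * exp \<theta>"
        by (simp_all add: f_def algebra_simps flip: exp_add)
      then show ?thesis by (simp add: algebra_simps)
    qed
    finally show ?thesis .
  qed
  show ?int unfolding prod by (rule indep_vars_integrable[OF J fB int])
  show ?mgf unfolding prod
    by (subst indep_vars_lebesgue_integral[OF J fB int]) (simp_all add: exp_f)
qed

text \<open>
  The logarithmic moment generating function of \<open>(1 - c) - B\<close> for a Bernoulli variable \<open>B\<close> with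
  parameter \<open>1 - c\<close>. It is written in terms of the small failure probability \<open>c\<close>.
\<close>
definition log_mgf :: "real \<Rightarrow> real \<Rightarrow> real" where
  "log_mgf c \<theta> = - \<theta> * c + ln (1 + c * (exp \<theta> - 1))"

lemma exp_log_mgf:
  assumes "0 \<le> c" "c < 1"
  shows "exp (- (\<theta> * c)) * (1 + c * (exp \<theta> - 1)) = exp (log_mgf c \<theta>)"
proof -
  have "1 + c * (exp \<theta> - 1) = (1 - c) + c * exp \<theta>" by (simp add: algebra_simps)
  also have "\<dots> > 0" using assms by (intro add_pos_nonneg) auto
  finally show ?thesis by (simp add: log_mgf_def exp_diff exp_minus field_simps)
qed

text \<open>
  A failure probability of order \<open>\<alpha> / N\<close> gives variance \<open>\<alpha> / N\<close> per slot, hence \<open>\<alpha> \<theta>\<^sup>2 / 2\<close> for \<open>N\<^sup>3\<close> slots at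
  parameter \<open>\<theta> / N\<close>. The correction \<open>\<gamma> / N\<^sup>2\<close> covers services (\<open>\<gamma> = 0\<close>) and arrivals (\<open>\<gamma> = \<beta>\<close>) alike.
\<close>
lemma log_mgf_asymp:
  fixes \<alpha> \<gamma> \<theta> :: real
  assumes "\<alpha> > 0"
  shows "(\<lambda>N. real N ^ 3 * log_mgf (\<alpha> / real N + \<gamma> / (real N)\<^sup>2) (\<theta> / real N)) \<longlonglongrightarrow> \<alpha> * \<theta>\<^sup>2 / 2"
  unfolding log_mgf_def power2_eq_square[of \<theta>] using assms by real_asymp

definition slot :: "nat \<Rightarrow> real \<Rightarrow> nat" where
  "slot N t = nat \<lfloor>t * real N ^ 3 * ln (real N)\<rfloor>"

lemma slot_mono: "s \<le> t \<Longrightarrow> slot N s \<le> slot N t"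
proof (cases "N = 0")
  case False
  assume "s \<le> t"
  then show ?thesis unfolding slot_def using False
    by (intro nat_mono floor_mono mult_right_mono) auto
qed (simp add: slot_def)

lemma slot_0 [simp]: "slot N 0 = 0" by (simp add: slot_def)

lemma slot_asymp:
  assumes "t \<ge> 0"
  shows "(\<lambda>N. real (slot N t) / (real N ^ 3 * ln (real N))) \<longlonglongrightarrow> t"
proof (cases "t = 0")
  case False
  with assms have "t > 0" by simp
  then show ?thesis unfolding slot_def by real_asymp
qed simp

lemma slot_diff_asymp:
  assumes "0 \<le> s" "s \<le> t"
  shows "(\<lambda>N. real (slot N t - slot N s) / (real N ^ 3 * ln (real N))) \<longlonglongrightarrow> t - s"
proof -
  have "(\<lambda>N. real (slot N t) / (real N ^ 3 * ln (real N)) - real (slot N s) / (real N ^ 3 * ln (real N))) \<longlonglongrightarrow> t - s"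
    using assms by (intro tendsto_diff slot_asymp) auto
  then show ?thesis using slot_mono[OF assms(2)] by (simp add: of_nat_diff diff_divide_distrib)
qed

lemma slot_le:
  assumes "t \<ge> 0"
  shows "real (slot N t) \<le> t * real N ^ 3 * ln (real N)"
proof (cases "N = 0")
  case False
  then have "t * real N ^ 3 * ln (real N) \<ge> 0" using assms by (intro mult_nonneg_nonneg) auto
  then show ?thesis unfolding slot_def by (simp add: of_nat_nat)
qed (simp add: slot_def)

definition centred :: "real \<Rightarrow> (nat \<Rightarrow> 'a \<Rightarrow> bool) \<Rightarrow> nat \<Rightarrow> nat \<Rightarrow> 'a \<Rightarrow> real" where
  "centred c B m n \<omega> = (\<Sum>j\<in>{m<..n}. (1 - c) - of_bool (B j \<omega>))"

definition (in prob_space) bernoulli_stream :: "real \<Rightarrow> (nat \<Rightarrow> 'a \<Rightarrow> bool) \<Rightarrow> bool" where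
  "bernoulli_stream c B \<longleftrightarrow> indep_vars (\<lambda>_. count_space UNIV) B {1..} \<and>
     (\<forall>j\<ge>1. distr M (count_space UNIV) (B j) = measure_pmf (bernoulli_pmf (1 - c)))"

context prob_space
begin

lemma bernoulli_stream_measurable:
  assumes "bernoulli_stream c B" "j \<ge> 1"
  shows "random_variable (count_space UNIV) (B j)"
  using assms by (auto simp: bernoulli_stream_def indep_vars_def)

lemma centred_measurable:
  assumes "bernoulli_stream c B"
  shows "centred c B m n \<in> borel_measurable M"
proof -
  have "(\<lambda>\<omega>. of_bool (B j \<omega>) :: real) \<in> borel_measurable M" if "j \<in> {m<..n}" for j
    using measurable_compose[OF bernoulli_stream_measurable[OF assms, of j], of of_bool borel] that
    by simp
  then show ?thesis unfolding centred_def[abs_def]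
    by (intro borel_measurable_sum borel_measurable_diff) auto
qed

lemma centred_mgf:
  assumes B: "bernoulli_stream c B" and c: "0 \<le> c" "c < 1"
  shows "integrable M (\<lambda>\<omega>. exp (\<theta> * centred c B m n \<omega>))"
    and "expectation (\<lambda>\<omega>. exp (\<theta> * centred c B m n \<omega>)) = exp (real (n - m) * log_mgf c \<theta>)"
proof -
  have "{m<..n} \<subseteq> {1..}" by auto
  then have ind: "indep_vars (\<lambda>_. count_space UNIV) B {m<..n}"
    using B unfolding bernoulli_stream_def by (blast intro: indep_vars_subset)
  have d: "distr M (count_space UNIV) (B j) = measure_pmf (bernoulli_pmf (1 - c))" if "j \<in> {m<..n}" for j
    using B that unfolding bernoulli_stream_def by auto
  note mgf = bernoulli_sum_mgf[OF _ ind d, of \<theta>]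
  show "integrable M (\<lambda>\<omega>. exp (\<theta> * centred c B m n \<omega>))"
    unfolding centred_def using c by (intro mgf(1)) auto
  have "expectation (\<lambda>\<omega>. exp (\<theta> * centred c B m n \<omega>)) = exp (log_mgf c \<theta>) ^ (n - m)"
    unfolding centred_def using c by (subst mgf(2)) (simp_all add: exp_log_mgf)
  then show "expectation (\<lambda>\<omega>. exp (\<theta> * centred c B m n \<omega>)) = exp (real (n - m) * log_mgf c \<theta>)"
    by (simp add: exp_of_nat_mult)
qed

lemma eventually_unit_interval:
  fixes \<alpha> \<gamma> :: real
  assumes "\<alpha> > 0"
  shows "\<forall>\<^sub>F N::nat in sequentially. 0 \<le> \<alpha> / real N + \<gamma> / (real N)\<^sup>2 \<and> \<alpha> / real N + \<gamma> / (real N)\<^sup>2 < 1"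
  using assms by (intro eventually_conj; real_asymp)

lemma stream_gaussian_log_mgf:
  assumes "\<alpha> > 0" and t: "0 \<le> s" "s < t"
    and B: "\<forall>\<^sub>F N in sequentially. \<forall>i\<in>I N. bernoulli_stream (\<alpha> / real N + \<gamma> / (real N)\<^sup>2) (B N i)"
  shows "gaussian_log_mgf (\<alpha> * (t - s)) I
    (\<lambda>N i \<omega>. centred (\<alpha> / real N + \<gamma> / (real N)\<^sup>2) (B N i) (slot N s) (slot N t) \<omega> / (real N * ln (real N)))"
proof -
  define c where "c N = \<alpha> / real N + \<gamma> / (real N)\<^sup>2" for N
  define Z where "Z N i \<omega> = centred (c N) (B N i) (slot N s) (slot N t) \<omega> / (real N * ln (real N))" for N i \<omega>
  have "\<exists>\<kappa>. \<kappa> \<longlonglongrightarrow> \<alpha> * (t - s) * \<theta>\<^sup>2 / 2 \<and>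
     (\<forall>\<^sub>F N in sequentially. \<forall>i\<in>I N. Z N i \<in> borel_measurable M \<and>
        integrable M (\<lambda>\<omega>. exp (\<theta> * ln (real N) * Z N i \<omega>)) \<and>
        expectation (\<lambda>\<omega>. exp (\<theta> * ln (real N) * Z N i \<omega>)) = exp (ln (real N) * \<kappa> N))" for \<theta> :: real
  proof -
    define \<kappa> where "\<kappa> N = real (slot N t - slot N s) * log_mgf (c N) (\<theta> / real N) / ln (real N)" for N
    have "(\<lambda>N. (real (slot N t - slot N s) / (real N ^ 3 * ln (real N))) * (real N ^ 3 * log_mgf (c N) (\<theta> / real N)))
        \<longlonglongrightarrow> (t - s) * (\<alpha> * \<theta>\<^sup>2 / 2)"
      unfolding c_def using t by (intro tendsto_mult slot_diff_asymp log_mgf_asymp[OF \<open>\<alpha> > 0\<close>]) auto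
    moreover have "\<forall>\<^sub>F N in sequentially. (real (slot N t - slot N s) / (real N ^ 3 * ln (real N))) *
        (real N ^ 3 * log_mgf (c N) (\<theta> / real N)) = \<kappa> N"
      using eventually_gt_at_top[of 1] by eventually_elim (auto simp: \<kappa>_def)
    ultimately have "\<kappa> \<longlonglongrightarrow> (t - s) * (\<alpha> * \<theta>\<^sup>2 / 2)" by (rule Lim_transform_eventually)
    then have lim: "\<kappa> \<longlonglongrightarrow> \<alpha> * (t - s) * \<theta>\<^sup>2 / 2" by (simp add: mult_ac)
    have "\<forall>\<^sub>F N in sequentially. \<forall>i\<in>I N.
       Z N i \<in> borel_measurable M \<and>
       integrable M (\<lambda>\<omega>. exp (\<theta> * ln (real N) * Z N i \<omega>)) \<and>
       expectation (\<lambda>\<omega>. exp (\<theta> * ln (real N) * Z N i \<omega>))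
         = exp (ln (real N) * \<kappa> N)"
      using B eventually_unit_interval[OF \<open>\<alpha> > 0\<close>, of \<gamma>] eventually_gt_at_top[of 1]
    proof eventually_elim
      case (elim N)
      show ?case
      proof
        fix i assume i: "i \<in> I N"
        have Bi: "bernoulli_stream (c N) (B N i)" and c: "0 \<le> c N" "c N < 1"
          using elim i by (auto simp: c_def)
        have eq: "\<theta> * ln (real N) * (x / (real N * ln (real N))) = \<theta> / real N * x" for x
          using elim by simp
        have k: "ln (real N) * \<kappa> N = real (slot N t - slot N s) * log_mgf (c N) (\<theta> / real N)"
          using elim by (simp add: \<kappa>_def)
        show "Z N i \<in> borel_measurable M \<and>
       integrable M (\<lambda>\<omega>. exp (\<theta> * ln (real N) * Z N i \<omega>)) \<and>
       expectation (\<lambda>\<omega>. exp (\<theta> * ln (real N) * Z N i \<omega>))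
         = exp (ln (real N) * \<kappa> N)"
          unfolding Z_def[abs_def] eq k
          by (intro conjI centred_mgf[OF Bi c] borel_measurable_divide centred_measurable[OF Bi] borel_measurable_const)
      qed
    qed
    with lim show ?thesis by blast
  qed
  then show ?thesis unfolding gaussian_log_mgf_def Z_def[abs_def] c_def by blast
qed

text \<open>
  Chernoff's bound with a parameter of order \<open>1 / \<Delta>\<close> gives \<open>N\<close> to the power \<open>-6\<close> at each slot of the
  block once \<open>\<Delta> \<le> \<epsilon>\<^sup>2 / (48 \<alpha>)\<close>. There are of order \<open>N\<^sup>4 log N\<close> pairs of a stream and a slot, so the sum
  of all these probabilities still tends to 0.
\<close>
lemma stream_modulus:
  assumes "\<alpha> > 0" "\<epsilon> > 0" and s: "s \<ge> 0" and \<Delta>: "\<Delta> > 0" "\<Delta> \<le> \<epsilon>\<^sup>2 / (48 * \<alpha>)"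
    and I: "\<And>N. finite (I N)" "\<And>N. card (I N) \<le> N + 1"
    and B: "\<forall>\<^sub>F N in sequentially. \<forall>i\<in>I N. bernoulli_stream (\<alpha> / real N + \<gamma> / (real N)\<^sup>2) (B N i)"
  shows "whp (\<lambda>N \<omega>. \<forall>i\<in>I N. \<forall>k\<in>{slot N s..slot N (s + \<Delta>)}.
     \<bar>centred (\<alpha> / real N + \<gamma> / (real N)\<^sup>2) (B N i) (slot N s) k \<omega>\<bar> \<le> \<epsilon> * (real N * ln (real N)))"
proof -
  define c where "c N = \<alpha> / real N + \<gamma> / (real N)\<^sup>2" for N
  (* With at most 2 Delta N^3 log N slots, and the logarithmic moment bounded by twice its limit, the exponent is
     2 Delta alpha theta^2 - theta epsilon. This theta minimises it, with value - epsilon^2 / (8 alpha Delta) <= -6. *)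
  define \<theta> where "\<theta> = \<epsilon> / (4 * \<alpha> * \<Delta>)"
  define K where "K N = {slot N s..slot N (s + \<Delta>)}" for N
  define E where "E N = (\<lambda>(i, k). {\<omega>\<in>space M. \<bar>centred (c N) (B N i) (slot N s) k \<omega>\<bar> > \<epsilon> * (real N * ln (real N))})" for N
  have \<theta>: "\<theta> > 0" using assms by (simp add: \<theta>_def)
  have ev_mgf: "\<forall>\<^sub>F N in sequentially. real N ^ 3 * log_mgf (c N) (x / real N) < \<alpha> * \<theta>\<^sup>2"
    if "x\<^sup>2 = \<theta>\<^sup>2" for x
    unfolding c_def
    by (rule order_tendstoD(2)[OF log_mgf_asymp[OF \<open>\<alpha> > 0\<close>]]) (use \<theta> \<open>\<alpha> > 0\<close> that in simp)
  have "(\<lambda>N. real (slot N (s + \<Delta>) - slot N s) / (real N ^ 3 * ln (real N))) \<longlonglongrightarrow> s + \<Delta> - s"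
    by (rule slot_diff_asymp) (use s \<Delta> in auto)
  then have ev_slot: "\<forall>\<^sub>F N in sequentially. real (slot N (s + \<Delta>) - slot N s) / (real N ^ 3 * ln (real N)) < 2 * \<Delta>"
    by (rule order_tendstoD(2)) (use \<Delta> in simp)
  have "2 * \<Delta> * (\<alpha> * \<theta>\<^sup>2) - \<theta> * \<epsilon> = - (\<epsilon>\<^sup>2 / (8 * \<alpha> * \<Delta>))"
    using assms by (simp add: \<theta>_def power2_eq_square field_simps)
  also have "\<dots> \<le> -6"
    using assms by (simp add: field_simps)
  finally have exponent: "2 * \<Delta> * (\<alpha> * \<theta>\<^sup>2) - \<theta> * \<epsilon> \<le> -6" .
  have bound: "\<forall>\<^sub>F N in sequentially. {\<omega>\<in>space M. \<not> (\<forall>i\<in>I N. \<forall>k\<in>K N.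
       \<bar>centred (c N) (B N i) (slot N s) k \<omega>\<bar> \<le> \<epsilon> * (real N * ln (real N)))} \<in> events \<and>
     prob {\<omega>\<in>space M. \<not> (\<forall>i\<in>I N. \<forall>k\<in>K N.
       \<bar>centred (c N) (B N i) (slot N s) k \<omega>\<bar> \<le> \<epsilon> * (real N * ln (real N)))}
     \<le> (real N + 1) * (2 * \<Delta> * (real N ^ 3 * ln (real N)) + 1) * (2 * real N powr (-6))"
    using B eventually_unit_interval[OF \<open>\<alpha> > 0\<close>, of \<gamma>] eventually_gt_at_top[of 1] ev_slot
      ev_mgf[of \<theta>, OF refl] ev_mgf[of "-\<theta>", OF power2_minus]
  proof eventually_elim
    case (elim N)
    define L where "L = ln (real N)"
    have L: "L > 0" "real N > 0" using elim by (auto simp: L_def)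
    have c: "0 \<le> c N" "c N < 1" using elim by (auto simp: c_def)
    have stream: "bernoulli_stream (c N) (B N i)" if "i \<in> I N" for i
      using elim that by (auto simp: c_def)
    have [measurable]: "centred (c N) (B N i) (slot N s) k \<in> borel_measurable M" if "i \<in> I N" for i k
      by (rule centred_measurable[OF stream[OF that]])
    have D: "real (slot N (s + \<Delta>) - slot N s) \<le> 2 * \<Delta> * (real N ^ 3 * L)"
      using elim(4) L by (simp add: L_def divide_simps)
    have one_sided: "prob {\<omega>\<in>space M. x * centred (c N) (B N i) (slot N s) k \<omega> \<ge> \<theta> * \<epsilon> * (real N * L)} \<le> real N powr (-6)"
      if ik: "i \<in> I N" "k \<in> K N" and x: "x\<^sup>2 = \<theta>\<^sup>2" "real N ^ 3 * log_mgf (c N) (x / real N) < \<alpha> * \<theta>\<^sup>2" for i k x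
    proof -
      note mgf = centred_mgf[OF stream[OF ik(1)] c, of "x / real N" "slot N s" k]
      have "prob {\<omega>\<in>space M. x * centred (c N) (B N i) (slot N s) k \<omega> \<ge> \<theta> * \<epsilon> * (real N * L)}
        = prob {\<omega>\<in>space M. exp (x / real N * centred (c N) (B N i) (slot N s) k \<omega>) \<ge> exp (\<theta> * \<epsilon> * L)}"
        using L by (simp add: field_simps)
      also have "\<dots> \<le> expectation (\<lambda>\<omega>. exp (x / real N * centred (c N) (B N i) (slot N s) k \<omega>)) / exp (\<theta> * \<epsilon> * L)"
        using mgf by (intro integral_Markov_inequality_measure[where A = "{}"]) auto
      also have "\<dots> = exp (real (k - slot N s) * log_mgf (c N) (x / real N) - \<theta> * \<epsilon> * L)"
        unfolding mgf(2) exp_diff ..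
      also have "\<dots> \<le> exp (L * (-6))"
      proof -
        have "real (k - slot N s) * log_mgf (c N) (x / real N)
            \<le> real (k - slot N s) * (\<alpha> * \<theta>\<^sup>2 / real N ^ 3)"
          using x L by (intro mult_left_mono) (auto simp: field_simps)
        also have "\<dots> \<le> (2 * \<Delta> * (real N ^ 3 * L)) * (\<alpha> * \<theta>\<^sup>2 / real N ^ 3)"
          using D ik \<open>\<alpha> > 0\<close> by (intro mult_right_mono order_trans[OF _ D]) (auto simp: K_def)
        also have "\<dots> = L * (2 * \<Delta> * (\<alpha> * \<theta>\<^sup>2))" using L by simp
        finally have "real (k - slot N s) * log_mgf (c N) (x / real N) - \<theta> * \<epsilon> * L
           \<le> L * (2 * \<Delta> * (\<alpha> * \<theta>\<^sup>2) - \<theta> * \<epsilon>)" by (simp add: algebra_simps)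
        also have "\<dots> \<le> L * (-6)" using exponent L by (intro mult_left_mono) auto
        finally show ?thesis by simp
      qed
      also have "\<dots> = real N powr (-6)" using L by (simp add: powr_def L_def)
      finally show ?thesis .
    qed
    have E: "E N ik \<in> events \<and> prob (E N ik) \<le> 2 * real N powr (-6)" if "ik \<in> I N \<times> K N" for ik
    proof -
      obtain i k where ik: "ik = (i, k)" "i \<in> I N" "k \<in> K N" using \<open>ik \<in> I N \<times> K N\<close> by auto
      have [measurable]: "centred (c N) (B N i) (slot N s) k \<in> borel_measurable M" using ik by measurable
      have "E N ik \<subseteq> {\<omega>\<in>space M. \<theta> * centred (c N) (B N i) (slot N s) k \<omega> \<ge> \<theta> * \<epsilon> * (real N * L)}
           \<union> {\<omega>\<in>space M. - \<theta> * centred (c N) (B N i) (slot N s) k \<omega> \<ge> \<theta> * \<epsilon> * (real N * L)}" (is "_ \<subseteq> ?P \<union> ?Q")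
      proof
        fix \<omega> assume "\<omega> \<in> E N ik"
        then have w: "\<omega> \<in> space M" "\<epsilon> * (real N * L) < \<bar>centred (c N) (B N i) (slot N s) k \<omega>\<bar>"
          by (auto simp: E_def ik L_def)
        then have "\<theta> * (\<epsilon> * (real N * L)) \<le> \<theta> * \<bar>centred (c N) (B N i) (slot N s) k \<omega>\<bar>"
          using \<theta> by (intro mult_left_mono) auto
        then show "\<omega> \<in> ?P \<union> ?Q" using w(1) by (auto simp: abs_if mult.assoc split: if_splits)
      qed
      then have "prob (E N ik) \<le> prob (?P \<union> ?Q)" by (intro finite_measure_mono) auto
      also have "\<dots> \<le> prob ?P + prob ?Q" by (intro measure_Un_le) auto
      also have "\<dots> \<le> real N powr (-6) + real N powr (-6)"
        using elim ik by (intro add_mono one_sided) auto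
      finally show ?thesis using ik(2) by (auto simp: E_def ik(1))
    qed
    have "{\<omega>\<in>space M. \<not> (\<forall>i\<in>I N. \<forall>k\<in>K N.
       \<bar>centred (c N) (B N i) (slot N s) k \<omega>\<bar> \<le> \<epsilon> * (real N * ln (real N)))} = (\<Union>ik\<in>I N \<times> K N. E N ik)"
      by (auto simp: E_def not_le)
    moreover have "(\<Union>ik\<in>I N \<times> K N. E N ik) \<in> events"
      using E I by (intro sets.finite_UN) (auto simp: K_def)
    moreover have "prob (\<Union>ik\<in>I N \<times> K N. E N ik)
        \<le> (real N + 1) * (2 * \<Delta> * (real N ^ 3 * ln (real N)) + 1) * (2 * real N powr (-6))"
    proof -
      have "prob (\<Union>ik\<in>I N \<times> K N. E N ik) \<le> (\<Sum>ik\<in>I N \<times> K N. prob (E N ik))"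
        using E I by (intro measure_UNION_le) (auto simp: K_def)
      also have "\<dots> \<le> real (card (I N \<times> K N)) * (2 * real N powr (-6))"
        using E by (intro sum_bounded_above) blast
      also have "\<dots> \<le> (real N + 1) * (2 * \<Delta> * (real N ^ 3 * ln (real N)) + 1) * (2 * real N powr (-6))"
      proof (rule mult_right_mono)
        have "real (card (K N)) = real (slot N (s + \<Delta>) - slot N s) + 1"
          using slot_mono[of s "s + \<Delta>" N] \<Delta> by (simp add: K_def Suc_diff_le)
        then have "real (card (K N)) \<le> 2 * \<Delta> * (real N ^ 3 * ln (real N)) + 1"
          using D by (simp add: L_def)
        moreover have "real (card (I N)) \<le> real N + 1" using I(2)[of N] by linarith
        ultimately show "real (card (I N \<times> K N)) \<le> (real N + 1) * (2 * \<Delta> * (real N ^ 3 * ln (real N)) + 1)"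
          unfolding card_cartesian_product of_nat_mult by (intro mult_mono) auto
      qed auto
      finally show ?thesis .
    qed
    ultimately show ?case by simp
  qed
  have "(\<lambda>N::nat. (real N + 1) * (2 * \<Delta> * (real N ^ 3 * ln (real N)) + 1) * (2 * real N powr (-6))) \<longlonglongrightarrow> 0"
    using \<Delta>(1) by real_asymp
  from whp_prob_boundI[OF bound this] show ?thesis unfolding K_def c_def .
qed

end

section \<open>Independence across servers and of the initial lengths\<close>

lemma (in prob_space) indep_vars_prob_Ball:
  assumes "indep_vars M' Z I" "J \<subseteq> I" "finite J" "J \<noteq> {}" "\<And>i. i \<in> J \<Longrightarrow> A i \<in> sets (M' i)"
  shows "prob {\<omega>\<in>space M. \<forall>i\<in>J. Z i \<omega> \<in> A i} = (\<Prod>i\<in>J. prob {\<omega>\<in>space M. Z i \<omega> \<in> A i})"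
proof -
  have *: "indep_sets (\<lambda>i. {Z i -` A \<inter> space M |A. A \<in> sets (M' i)}) I"
    using assms(1) by (simp add: indep_vars_def2)
  have "prob (\<Inter>i\<in>J. Z i -` A i \<inter> space M) = (\<Prod>i\<in>J. prob (Z i -` A i \<inter> space M))"
    by (rule indep_setsD[OF *]) (use assms in auto)
  moreover have "(\<Inter>i\<in>J. Z i -` A i \<inter> space M) = {\<omega>\<in>space M. \<forall>i\<in>J. Z i \<omega> \<in> A i}"
    using \<open>J \<noteq> {}\<close> by auto
  moreover have "Z i -` A i \<inter> space M = {\<omega>\<in>space M. Z i \<omega> \<in> A i}" for i by auto
  ultimately show ?thesis by simp
qed

lemma (in prob_space) indep_events_prob_none:
  assumes "indep_events E I" "finite I"
  shows "prob {\<omega>\<in>space M. \<forall>i\<in>I. \<omega> \<notin> E i} = (\<Prod>i\<in>I. 1 - prob (E i))"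
proof (cases "I = {}")
  case True
  then show ?thesis by (simp add: prob_space)
next
  case False
  have "indep_sets (\<lambda>i. {E i}) I" using assms(1) by (simp add: indep_events_def_alt)
  then have *: "indep_sets (\<lambda>i. sigma_sets (space M) {E i}) I"
    by (rule indep_sets_sigma) (simp add: Int_stable_def)
  have "prob (\<Inter>i\<in>I. space M - E i) = (\<Prod>i\<in>I. prob (space M - E i))"
    by (rule indep_setsD[OF * _ False \<open>finite I\<close>]) (auto intro: sigma_sets.intros)
  also have "\<dots> = (\<Prod>i\<in>I. 1 - prob (E i))"
    using assms(1) by (intro prod.cong refl prob_compl) (auto simp: indep_events_def)
  also have "(\<Inter>i\<in>I. space M - E i) = {\<omega>\<in>space M. \<forall>i\<in>I. \<omega> \<notin> E i}" using False by auto
  finally show ?thesis .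
qed

text \<open>
  If the expected number of occurrences among \<open>N\<close> independent events diverges, some event occurs.
\<close>
lemma (in prob_space) whp_ex_indep_event:
  assumes "\<forall>\<^sub>F N in sequentially. indep_events (E N) {1..N} \<and> (\<forall>i\<in>{1..N}. e N \<le> prob (E N i))"
    and "filterlim (\<lambda>N. real N * e N) at_top sequentially"
  shows "whp (\<lambda>N \<omega>. \<exists>i\<in>{1..N}. \<omega> \<in> E N i)"
proof (rule whp_prob_boundI)
  show "(\<lambda>N. exp (- (real N * e N))) \<longlonglongrightarrow> 0"
    by (rule filterlim_compose[OF exp_at_bot]) (use assms(2) in \<open>simp add: filterlim_uminus_at_top\<close>)
  show "\<forall>\<^sub>F N in sequentially. {\<omega> \<in> space M. \<not> (\<exists>i\<in>{1..N}. \<omega> \<in> E N i)} \<in> events \<and>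
      prob {\<omega> \<in> space M. \<not> (\<exists>i\<in>{1..N}. \<omega> \<in> E N i)} \<le> exp (- (real N * e N))"
    using assms(1)
  proof eventually_elim
    case (elim N)
    then have ev: "E N i \<in> events" if "i \<in> {1..N}" for i
      using that by (auto simp: indep_events_def)
    have "{\<omega> \<in> space M. \<forall>i\<in>{1..N}. \<omega> \<notin> E N i} \<in> events"
      using ev by (intro sets.sets_Collect_finite_All sets.sets_Collect_neg) auto
    moreover have "prob {\<omega> \<in> space M. \<forall>i\<in>{1..N}. \<omega> \<notin> E N i} = (\<Prod>i\<in>{1..N}. 1 - prob (E N i))"
      using elim by (intro indep_events_prob_none) auto
    moreover have "\<dots> \<le> (\<Prod>i\<in>{1..N}. exp (- e N))"
    proof (intro prod_mono conjI)
      fix i assume i: "i \<in> {1..N}"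
      have "1 - prob (E N i) \<le> 1 + - e N" using elim i by auto
      also have "\<dots> \<le> exp (- e N)" by (rule exp_ge_add_one_self)
      finally show "1 - prob (E N i) \<le> exp (- e N)" .
    qed auto
    moreover have "\<dots> = exp (- (real N * e N))" by (simp flip: exp_of_nat_mult)
    ultimately show ?case by simp
  qed
qed

context fork_join_model
begin

definition service_noise :: "nat \<Rightarrow> nat \<Rightarrow> nat \<Rightarrow> nat \<Rightarrow> 'a \<Rightarrow> real" where
  "service_noise N i = centred (\<alpha> / real N) (Y N i)"

definition arrival_noise :: "nat \<Rightarrow> nat \<Rightarrow> nat \<Rightarrow> 'a \<Rightarrow> real" where
  "arrival_noise N = centred (\<alpha> / real N + \<beta> / (real N)\<^sup>2) (X N)"

lemma eventually_admissible: "\<forall>\<^sub>F N in sequentially. admissible \<alpha> \<beta> N"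
proof -
  have "\<forall>\<^sub>F N::nat in sequentially. \<alpha> / real N + \<beta> / (real N)\<^sup>2 < 1" by real_asymp
  with eventually_ge_at_top[of 2] show ?thesis
    by eventually_elim (simp add: admissible_def)
qed

text \<open>
  Functions of disjoint blocks of the primitives are independent; streams are extracted with blocks of
  size one and the noises of the servers with the block of all slots of a server.
\<close>
lemma indep_vars_blocks:
  assumes "admissible \<alpha> \<beta> N" "\<And>l. l \<in> L \<Longrightarrow> K l \<subseteq> primitive_indices N" "disjoint_family_on K L"
    and "\<And>l. l \<in> L \<Longrightarrow> g l \<in> measurable (PiM (K l) (\<lambda>_. count_space UNIV)) (S l)"
  shows "indep_vars S (\<lambda>l \<omega>. g l (\<lambda>k\<in>K l. primitives X Y N k \<omega>)) L"
  by (rule indep_vars_compose2[OF indep_vars_restrict[OF primitives_indep[OF assms(1)] assms(2,3)] assms(4)])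

lemma arrival_stream:
  assumes "admissible \<alpha> \<beta> N"
  shows "bernoulli_stream (\<alpha> / real N + \<beta> / (real N)\<^sup>2) (X N)"
proof -
  have "indep_vars (\<lambda>_. count_space UNIV)
      (\<lambda>j \<omega>. (\<lambda>f. f (Inl j)) (\<lambda>k\<in>{Inl j}. primitives X Y N k \<omega>)) {1..}"
    by (rule indep_vars_blocks[OF assms])
       (auto simp: primitive_indices_def disjoint_family_on_def intro!: measurable_component_singleton)
  then have "indep_vars (\<lambda>_. count_space UNIV) (X N) {1..}"
    by (simp add: primitives_def)
  then show ?thesis
    using arrival_bernoulli[OF assms] by (simp add: bernoulli_stream_def arrival_prob_def diff_diff_eq)
qed

lemma service_stream:
  assumes "admissible \<alpha> \<beta> N" "i \<in> {1..N}"
  shows "bernoulli_stream (\<alpha> / real N) (Y N i)"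
proof -
  have "indep_vars (\<lambda>_. count_space UNIV)
      (\<lambda>j \<omega>. (\<lambda>f. f (Inr (i, j))) (\<lambda>k\<in>{Inr (i, j)}. primitives X Y N k \<omega>)) {1..}"
    by (rule indep_vars_blocks[OF assms(1)])
       (use assms(2) in \<open>auto simp: primitive_indices_def disjoint_family_on_def intro!: measurable_component_singleton\<close>)
  then have "indep_vars (\<lambda>_. count_space UNIV) (Y N i) {1..}"
    by (simp add: primitives_def)
  then show ?thesis
    using service_bernoulli[OF assms] by (simp add: bernoulli_stream_def service_prob_def)
qed

lemma service_noise_eq_block:
  "service_noise N i m n \<omega> =
     (\<Sum>j\<in>{m<..n}. (1 - \<alpha> / real N) - of_bool ((\<lambda>k\<in>Inr ` ({i} \<times> {1..}). primitives X Y N k \<omega>) (Inr (i, j))))"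
  unfolding service_noise_def centred_def by (intro sum.cong refl) (auto simp: primitives_def)

lemma indep_service_noise:
  assumes "admissible \<alpha> \<beta> N"
  shows "indep_vars (\<lambda>_. borel) (\<lambda>i. service_noise N i m n) {1..N}"
  unfolding service_noise_eq_block[abs_def]
proof (rule indep_vars_blocks[OF assms,
    where g = "\<lambda>i f. \<Sum>j\<in>{m<..n}. (1 - \<alpha> / real N) - of_bool (f (Inr (i, j)))"])
  fix i assume "i \<in> {1..N}"
  have "(\<lambda>f. of_bool (f (Inr (i, j))) :: real) \<in> borel_measurable (PiM (Inr ` ({i} \<times> {1..})) (\<lambda>_. count_space UNIV))"
    if "j \<in> {m<..n}" for j
    by (rule measurable_compose[OF measurable_component_singleton]) (use that in auto)
  then show "(\<lambda>f. \<Sum>j\<in>{m<..n}. (1 - \<alpha> / real N) - of_bool (f (Inr (i, j))))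
      \<in> borel_measurable (PiM (Inr ` ({i} \<times> {1..})) (\<lambda>_. count_space UNIV))"
    by (intro borel_measurable_sum borel_measurable_diff) auto
qed (auto simp: primitive_indices_def disjoint_family_on_def)

text \<open>
  Independence is given for the sigma-algebras generated by the two vectors. Both events are
  measurable in the respective sigma-algebra because each depends on finitely many coordinates.
\<close>
lemma prob_initial_and_noise:
  assumes N: "admissible \<alpha> \<beta> N" and J: "J \<subseteq> {1..N}" and C: "C \<in> sets borel"
  shows "prob {\<omega>\<in>space M. (\<forall>i\<in>J. Q0 N i \<omega> \<in> D) \<and> (\<forall>i\<in>J. service_noise N i m n \<omega> \<in> C)} =
    prob {\<omega>\<in>space M. \<forall>i\<in>J. Q0 N i \<omega> \<in> D} * prob {\<omega>\<in>space M. \<forall>i\<in>J. service_noise N i m n \<omega> \<in> C}"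
proof -
  define V where "V = vimage_algebra (space M) (\<lambda>\<omega>. \<lambda>i\<in>{1..N}. Q0 N i \<omega>) (PiM {1..N} (\<lambda>_. count_space UNIV))"
  define W where "W = vimage_algebra (space M) (\<lambda>\<omega>. \<lambda>k\<in>primitive_indices N. primitives X Y N k \<omega>)
      (PiM (primitive_indices N) (\<lambda>_. count_space UNIV))"
  have sp: "space V = space M" "space W = space M" by (simp_all add: V_def W_def)
  have J': "finite J" using J finite_subset by blast
  have "(\<lambda>\<omega>. \<lambda>i\<in>{1..N}. Q0 N i \<omega>) \<in> measurable V (PiM {1..N} (\<lambda>_. count_space UNIV))"
    unfolding V_def by (rule measurable_vimage_algebra1) (auto simp: space_PiM)
  note mV = measurable_compose[OF this measurable_component_singleton]
  have Q: "(\<lambda>\<omega>. Q0 N i \<omega>) \<in> measurable V (count_space UNIV)" if "i \<in> J" for i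
    using mV[of i] that J by auto
  have "(\<lambda>\<omega>. \<lambda>k\<in>primitive_indices N. primitives X Y N k \<omega>)
      \<in> measurable W (PiM (primitive_indices N) (\<lambda>_. count_space UNIV))"
    unfolding W_def by (rule measurable_vimage_algebra1) (auto simp: space_PiM)
  note mW = measurable_compose[OF this measurable_component_singleton]
  have Y: "(\<lambda>\<omega>. of_bool (Y N i j \<omega>) :: real) \<in> borel_measurable W" if "i \<in> J" "j \<in> {m<..n}" for i j
  proof -
    have "Inr (i, j) \<in> primitive_indices N" using that J by (auto simp: primitive_indices_def)
    then have "Y N i j \<in> measurable W (count_space UNIV)"
      using mW[of "Inr (i, j)"] by (simp add: primitives_def)
    from measurable_compose[OF this, of of_bool borel] show ?thesis by simp
  qed
  have S: "service_noise N i m n \<in> borel_measurable W" if "i \<in> J" for i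
    unfolding service_noise_def centred_def[abs_def]
    by (intro borel_measurable_sum borel_measurable_diff Y that) auto
  have "{\<omega>\<in>space V. \<forall>i\<in>J. Q0 N i \<omega> \<in> D} \<in> sets V"
    by (intro sets.sets_Collect_finite_All[OF _ J'] measurable_sets_Collect[OF Q]) auto
  moreover have "{\<omega>\<in>space W. \<forall>i\<in>J. service_noise N i m n \<omega> \<in> C} \<in> sets W"
    by (intro sets.sets_Collect_finite_All[OF _ J'] measurable_sets_Collect[OF S]) (use C in auto)
  ultimately have "prob ({\<omega>\<in>space M. \<forall>i\<in>J. Q0 N i \<omega> \<in> D} \<inter> {\<omega>\<in>space M. \<forall>i\<in>J. service_noise N i m n \<omega> \<in> C}) =
    prob {\<omega>\<in>space M. \<forall>i\<in>J. Q0 N i \<omega> \<in> D} * prob {\<omega>\<in>space M. \<forall>i\<in>J. service_noise N i m n \<omega> \<in> C}"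
    unfolding sp by (intro indep_setD[OF initial_indep[OF N]]) (auto simp: V_def W_def)
  also have "{\<omega>\<in>space M. \<forall>i\<in>J. Q0 N i \<omega> \<in> D} \<inter> {\<omega>\<in>space M. \<forall>i\<in>J. service_noise N i m n \<omega> \<in> C} =
    {\<omega>\<in>space M. (\<forall>i\<in>J. Q0 N i \<omega> \<in> D) \<and> (\<forall>i\<in>J. service_noise N i m n \<omega> \<in> C)}" by auto
  finally show ?thesis .
qed

end

locale fork_join_iid_start = fork_join_model +
  assumes alpha_pos: "\<alpha> > 0" and beta_pos: "\<beta> > 0"
    and initial_iid: "\<And>N. admissible \<alpha> \<beta> N \<Longrightarrow> iid_vars (count_space UNIV) (Q0 N) {1..N}"
    and initial_nonneg: "\<And>N i. admissible \<alpha> \<beta> N \<Longrightarrow> i \<in> {1..N} \<Longrightarrow> AE \<omega> in M. Q0 N i \<omega> \<ge> 0"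
begin

definition initial_tail :: "nat \<Rightarrow> real \<Rightarrow> real" where
  "initial_tail N y = prob {\<omega>\<in>space M. real_of_int (Q0 N 1 \<omega>) > y}"

lemma prob_initial_eq:
  assumes "admissible \<alpha> \<beta> N" "i \<in> {1..N}"
  shows "prob {\<omega>\<in>space M. real_of_int (Q0 N i \<omega>) > y} = initial_tail N y"
proof -
  have "1 \<in> {1..N}" using assms(2) by auto
  then have "distr M (count_space UNIV) (Q0 N i) = distr M (count_space UNIV) (Q0 N 1)"
    using initial_iid[OF assms(1)] assms(2) unfolding iid_vars_def by blast
  then have "measure (distr M (count_space UNIV) (Q0 N i)) {k. real_of_int k > y} =
      measure (distr M (count_space UNIV) (Q0 N 1)) {k. real_of_int k > y}" by simp
  then show ?thesis
    using initial_measurable[OF assms(1)] assms(2) \<open>1 \<in> {1..N}\<close>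
    by (simp add: measure_distr initial_tail_def vimage_def Int_def conj_commute)
qed

lemma prob_joint_tail:
  assumes "admissible \<alpha> \<beta> N" "i \<in> {1..N}"
  shows "prob {\<omega>\<in>space M. real_of_int (Q0 N i \<omega>) > y \<and> service_noise N i m n \<omega> > x} =
      initial_tail N y * prob {\<omega>\<in>space M. service_noise N i m n \<omega> > x}"
  using prob_initial_and_noise[OF assms(1), of "{i}" "{x<..}" "{k. real_of_int k > y}" m n] assms
  by (simp add: prob_initial_eq[OF assms])

lemma indep_joint_tails:
  assumes N: "admissible \<alpha> \<beta> N"
  shows "indep_events (\<lambda>i. {\<omega>\<in>space M. real_of_int (Q0 N i \<omega>) > y \<and> service_noise N i m n \<omega> > x}) {1..N}"
proof -
  define D where "D = {k::int. real_of_int k > y}"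
  have iv: "indep_vars (\<lambda>_. count_space UNIV) (Q0 N) {1..N}"
    using initial_iid[OF N] by (simp add: iid_vars_def)
  have ev: "{\<omega>\<in>space M. real_of_int (Q0 N i \<omega>) > y \<and> service_noise N i m n \<omega> > x} \<in> events"
    if "i \<in> {1..N}" for i
  proof -
    have [measurable]: "Q0 N i \<in> measurable M (count_space UNIV)" "service_noise N i m n \<in> borel_measurable M"
      using initial_measurable[OF N that] centred_measurable[OF service_stream[OF N that]]
      by (auto simp: service_noise_def)
    show ?thesis by measurable
  qed
  show ?thesis unfolding indep_events_def
  proof (intro conjI allI impI)
    show "(\<lambda>i. {\<omega>\<in>space M. real_of_int (Q0 N i \<omega>) > y \<and> service_noise N i m n \<omega> > x}) ` {1..N} \<subseteq> events"
      using ev by blast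
    fix J assume J: "J \<subseteq> {1..N}" "J \<noteq> {}" "finite J"
    have "(\<Inter>i\<in>J. {\<omega>\<in>space M. real_of_int (Q0 N i \<omega>) > y \<and> service_noise N i m n \<omega> > x}) =
      {\<omega>\<in>space M. (\<forall>i\<in>J. Q0 N i \<omega> \<in> D) \<and> (\<forall>i\<in>J. service_noise N i m n \<omega> \<in> {x<..})}"
      using J(2) by (auto simp: D_def)
    also have "prob \<dots> = prob {\<omega>\<in>space M. \<forall>i\<in>J. Q0 N i \<omega> \<in> D} *
        prob {\<omega>\<in>space M. \<forall>i\<in>J. service_noise N i m n \<omega> \<in> {x<..}}"
      by (rule prob_initial_and_noise[OF N J(1)]) simp
    also have "\<dots> = (\<Prod>i\<in>J. prob {\<omega>\<in>space M. Q0 N i \<omega> \<in> D}) *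
        (\<Prod>i\<in>J. prob {\<omega>\<in>space M. service_noise N i m n \<omega> \<in> {x<..}})"
      by (subst indep_vars_prob_Ball[OF iv J(1,3,2)] indep_vars_prob_Ball[OF indep_service_noise[OF N] J(1,3,2)]; simp)+
    also have "\<dots> = (\<Prod>i\<in>J. prob {\<omega>\<in>space M. real_of_int (Q0 N i \<omega>) > y \<and> service_noise N i m n \<omega> > x})"
      unfolding prod.distrib[symmetric]
    proof (intro prod.cong refl)
      fix i assume "i \<in> J"
      then have i: "i \<in> {1..N}" using J(1) by auto
      show "prob {\<omega> \<in> space M. Q0 N i \<omega> \<in> D} * prob {\<omega> \<in> space M. service_noise N i m n \<omega> \<in> {x<..}} =
        prob {\<omega> \<in> space M. y < real_of_int (Q0 N i \<omega>) \<and> x < service_noise N i m n \<omega>}"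
        using prob_joint_tail[OF N i, of y x m n] prob_initial_eq[OF N i, of y] by (simp add: D_def)
    qed
    finally show "prob (\<Inter>i\<in>J. {\<omega>\<in>space M. real_of_int (Q0 N i \<omega>) > y \<and> service_noise N i m n \<omega> > x}) =
      (\<Prod>i\<in>J. prob {\<omega>\<in>space M. real_of_int (Q0 N i \<omega>) > y \<and> service_noise N i m n \<omega> > x})" .
  qed
qed

end

section \<open>Maxima over the servers at size of order N log N\<close>

definition nlogn :: "nat \<Rightarrow> real" where
  "nlogn N = real N * ln (real N)"

lemma nlogn_pos: "N \<ge> 2 \<Longrightarrow> nlogn N > 0"
  by (simp add: nlogn_def)

lemma filterlim_nlogn: "filterlim nlogn at_top sequentially"
  unfolding nlogn_def by real_asymp

text \<open>
  The supremum of \<open>a u + q v\<close> over the pairs \<open>(u, v)\<close> that some server out of \<open>N\<close> realises: noise \<open>a u\<close> has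
  exponent \<open>u\<^sup>2\<close> and start \<open>q v\<close> has exponent \<open>H v\<close>.
\<close>
definition constrained_growth :: "(real \<Rightarrow> real) \<Rightarrow> real \<Rightarrow> real \<Rightarrow> real" where
  "constrained_growth H a q = Sup {a * u + q * v | u v. u\<^sup>2 + H v \<le> 1 \<and> 0 \<le> u \<and> u \<le> 1 \<and> 0 \<le> v \<and> v \<le> 1}"

lemma constrained_growth_bdd:
  assumes "0 \<le> a" "0 \<le> q"
  shows "bdd_above {a * u + q * v | u v. u\<^sup>2 + H v \<le> 1 \<and> 0 \<le> u \<and> u \<le> 1 \<and> 0 \<le> v \<and> v \<le> (1::real)}"
proof (rule bdd_aboveI[where M = "a + q"])
  fix z assume "z \<in> {a * u + q * v | u v. u\<^sup>2 + H v \<le> 1 \<and> 0 \<le> u \<and> u \<le> 1 \<and> 0 \<le> v \<and> v \<le> 1}"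
  then obtain u v where "z = a * u + q * v" "u \<le> 1" "v \<le> 1" by blast
  then show "z \<le> a + q" using assms mult_left_mono[of u 1 a] mult_left_mono[of v 1 q] by simp
qed

lemma constrained_growth_upper:
  assumes "0 \<le> a" "0 \<le> q" "u\<^sup>2 + H v \<le> 1" "0 \<le> u" "u \<le> 1" "0 \<le> v" "v \<le> 1"
  shows "a * u + q * v \<le> constrained_growth H a q"
  unfolding constrained_growth_def
  by (rule cSup_upper[OF _ constrained_growth_bdd]) (use assms in auto)

lemma less_constrained_growthE:
  assumes "x < constrained_growth H a q" "H 0 \<le> 1" "0 \<le> a" "0 \<le> q"
  obtains u v where "x < a * u + q * v" "u\<^sup>2 + H v \<le> 1" "0 \<le> u" "u \<le> 1" "0 \<le> v" "v \<le> 1"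
proof -
  let ?S = "{a * u + q * v | u v. u\<^sup>2 + H v \<le> 1 \<and> 0 \<le> u \<and> u \<le> 1 \<and> 0 \<le> v \<and> v \<le> 1}"
  have "a * 0 + q * 0 \<in> ?S" using assms(2) by (intro CollectI exI[of _ 0]) auto
  then have "?S \<noteq> {}" by blast
  then have "\<exists>z\<in>?S. x < z"
    using assms(1) unfolding constrained_growth_def
    by (subst (asm) less_cSup_iff[OF _ constrained_growth_bdd]) (use assms in auto)
  then show ?thesis using that by blast
qed

context fork_join_iid_start
begin

definition scaled_noise :: "nat \<Rightarrow> nat \<Rightarrow> real \<Rightarrow> real \<Rightarrow> 'a \<Rightarrow> real" where
  "scaled_noise N i s t \<omega> = service_noise N i (slot N s) (slot N t) \<omega> / nlogn N"

lemma scaled_noise_gaussian: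
  assumes "0 \<le> s" "s < t"
  shows "gaussian_log_mgf (\<alpha> * (t - s)) (\<lambda>N. {1..N}) (\<lambda>N i. scaled_noise N i s t)"
proof -
  have "\<forall>\<^sub>F N in sequentially. \<forall>i\<in>{1..N}. bernoulli_stream (\<alpha> / real N + 0 / (real N)\<^sup>2) (Y N i)"
    using eventually_admissible by eventually_elim (simp add: service_stream)
  from stream_gaussian_log_mgf[OF alpha_pos assms this] show ?thesis
    by (simp add: scaled_noise_def[abs_def] service_noise_def nlogn_def)
qed

lemma whp_initial_nonneg: "whp (\<lambda>N \<omega>. \<forall>i\<in>{1..N}. Q0 N i \<omega> \<ge> 0)"
  by (rule whp_AE) (use eventually_admissible initial_nonneg in \<open>auto elim!: eventually_mono intro!: AE_finite_allI\<close>)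

lemma initial_tail_neg:
  assumes "admissible \<alpha> \<beta> N" "y < 0"
  shows "initial_tail N y = 1"
proof -
  have N: "1 \<in> {1..N}" using assms(1) by (simp add: admissible_def)
  have [measurable]: "Q0 N 1 \<in> measurable M (count_space UNIV)" by (rule initial_measurable[OF assms(1) N])
  have "AE \<omega> in M. real_of_int (Q0 N 1 \<omega>) > y"
    using initial_nonneg[OF assms(1) N] by eventually_elim (use assms(2) in linarith)
  moreover have "{\<omega>\<in>space M. real_of_int (Q0 N 1 \<omega>) > y} \<in> events" by measurable
  ultimately show ?thesis unfolding initial_tail_def by (simp only: prob_Collect_eq_1)
qed

lemma whp_ex_joint:
  assumes "\<forall>\<^sub>F N in sequentially. 0 \<le> a N \<and> a N \<le> initial_tail N (y N)"
    and "\<forall>\<^sub>F N in sequentially. \<forall>i\<in>{1..N}. b N \<le> prob {\<omega>\<in>space M. scaled_noise N i s t \<omega> > x}"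
    and "\<forall>\<^sub>F N in sequentially. 0 \<le> b N"
    and "filterlim (\<lambda>N. real N * (a N * b N)) at_top sequentially"
  shows "whp (\<lambda>N \<omega>. \<exists>i\<in>{1..N}. real_of_int (Q0 N i \<omega>) > y N \<and> scaled_noise N i s t \<omega> > x)"
proof -
  define E where "E N i = {\<omega>\<in>space M. real_of_int (Q0 N i \<omega>) > y N \<and>
     service_noise N i (slot N s) (slot N t) \<omega> > x * nlogn N}" for N i
  have eq: "scaled_noise N i s t \<omega> > x \<longleftrightarrow> service_noise N i (slot N s) (slot N t) \<omega> > x * nlogn N"
    if "N \<ge> 2" for N i \<omega>
    using nlogn_pos[OF that] by (simp add: scaled_noise_def field_simps)
  have "\<forall>\<^sub>F N in sequentially. indep_events (E N) {1..N} \<and> (\<forall>i\<in>{1..N}. a N * b N \<le> prob (E N i))"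
    using assms(1-3) eventually_admissible
  proof eventually_elim
    case (elim N)
    then have N: "N \<ge> 2" by (simp add: admissible_def)
    have "a N * b N \<le> prob (E N i)" if i: "i \<in> {1..N}" for i
    proof -
      have "b N \<le> prob {\<omega>\<in>space M. service_noise N i (slot N s) (slot N t) \<omega> > x * nlogn N}"
        using elim(2) i by (simp add: eq[OF N])
      then show ?thesis
        unfolding E_def prob_joint_tail[OF elim(4) i] using elim by (intro mult_mono) auto
    qed
    moreover have "indep_events (E N) {1..N}"
      unfolding E_def by (rule indep_joint_tails[OF elim(4)])
    ultimately show ?case by blast
  qed
  from whp_ex_indep_event[OF this assms(4)] show ?thesis
    by (rule whp_mono) (use eventually_ge_at_top[of 2] in eventually_elim, auto simp: E_def eq)
qed

text \<open>
  First moment bound: the expected number of servers that have both a large start and a large noise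
  tends to 0.
\<close>
lemma whp_no_joint:
  assumes "\<forall>\<^sub>F N in sequentially. initial_tail N (y N) \<le> a N"
    and "\<forall>\<^sub>F N in sequentially. \<forall>i\<in>{1..N}. prob {\<omega>\<in>space M. scaled_noise N i s t \<omega> > x} \<le> b N"
    and "(\<lambda>N. real N * (a N * b N)) \<longlonglongrightarrow> 0"
  shows "whp (\<lambda>N \<omega>. \<forall>i\<in>{1..N}. real_of_int (Q0 N i \<omega>) > y N \<longrightarrow> scaled_noise N i s t \<omega> \<le> x)"
  (is "whp ?R")
proof (rule whp_prob_boundI[OF _ assms(3)])
  define E where "E N i = {\<omega>\<in>space M. real_of_int (Q0 N i \<omega>) > y N \<and>
     service_noise N i (slot N s) (slot N t) \<omega> > x * nlogn N}" for N i
  have eq: "scaled_noise N i s t \<omega> > x \<longleftrightarrow> service_noise N i (slot N s) (slot N t) \<omega> > x * nlogn N"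
    if "N \<ge> 2" for N i \<omega>
    using nlogn_pos[OF that] by (simp add: scaled_noise_def field_simps)
  show "\<forall>\<^sub>F N in sequentially.
     {\<omega>\<in>space M. \<not> ?R N \<omega>} \<in> events \<and>
     prob {\<omega>\<in>space M. \<not> ?R N \<omega>}
       \<le> real N * (a N * b N)"
    using assms(1,2) eventually_admissible
  proof eventually_elim
    case (elim N)
    then have N: "N \<ge> 2" by (simp add: admissible_def)
    have ev: "E N i \<in> events" if "i \<in> {1..N}" for i
      using indep_joint_tails[OF elim(3)] that unfolding indep_events_def E_def by blast
    have le: "prob (E N i) \<le> a N * b N" if i: "i \<in> {1..N}" for i
    proof -
      have "prob {\<omega>\<in>space M. service_noise N i (slot N s) (slot N t) \<omega> > x * nlogn N} \<le> b N"
        using elim(2) i by (simp add: eq[OF N])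
      then show ?thesis
        unfolding E_def prob_joint_tail[OF elim(3) i] using elim(1)
        by (intro mult_mono) (auto intro: order_trans[OF measure_nonneg] simp: initial_tail_def)
    qed
    have "{\<omega>\<in>space M. \<not> ?R N \<omega>}
        = (\<Union>i\<in>{1..N}. E N i)"
      using eq[OF N] by (auto simp: E_def not_le)
    moreover have "prob (\<Union>i\<in>{1..N}. E N i) \<le> (\<Sum>i\<in>{1..N}. prob (E N i))"
      using ev by (intro measure_UNION_le) auto
    moreover have "(\<Sum>i\<in>{1..N}. prob (E N i)) \<le> real (card {1..N}) * (a N * b N)"
      using le by (intro sum_bounded_above) auto
    ultimately show ?case using ev by auto
  qed
qed

text \<open>
  The start is left unrestricted by the threshold \<open>-1\<close>, which nonnegative starts exceed.
\<close>
lemma whp_max_noise_le: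
  assumes "0 \<le> s" "s < t" "x > sqrt (2 * \<alpha> * (t - s))"
  shows "whp (\<lambda>N \<omega>. \<forall>i\<in>{1..N}. scaled_noise N i s t \<omega> \<le> x)"
proof -
  have c: "\<alpha> * (t - s) > 0" using alpha_pos assms by simp
  have "sqrt (2 * \<alpha> * (t - s)) > 0" using c by simp
  then have x: "x > 0" using assms(3) by linarith
  have "2 * \<alpha> * (t - s) < x\<^sup>2"
    using real_less_rsqrt assms(3) x by (metis not_le real_le_rsqrt mult.assoc)
  then have "1 < x\<^sup>2 / (2 * (\<alpha> * (t - s)))" using c by (simp add: field_simps)
  then obtain d where d: "1 < d" "d < x\<^sup>2 / (2 * (\<alpha> * (t - s)))" using dense by blast
  have "whp (\<lambda>N \<omega>. \<forall>i\<in>{1..N}. real_of_int (Q0 N i \<omega>) > -1 \<longrightarrow> scaled_noise N i s t \<omega> \<le> x)"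
  proof (rule whp_no_joint[where a = "\<lambda>_. 1" and b = "\<lambda>N. real N powr (-d)"])
    show "\<forall>\<^sub>F N in sequentially. initial_tail N (- 1) \<le> 1"
      by (simp add: initial_tail_def)
    show "\<forall>\<^sub>F N in sequentially. \<forall>i\<in>{1..N}. prob {\<omega> \<in> space M. x < scaled_noise N i s t \<omega>} \<le> real N powr - d"
      using gaussian_log_mgf_upper_tail[OF scaled_noise_gaussian[OF assms(1,2)] c _ d(2)] x
      by (auto elim: eventually_mono)
    show "(\<lambda>N. real N * (1 * real N powr - d)) \<longlonglongrightarrow> 0" using d(1) by real_asymp
  qed
  then show ?thesis
    by (rule whp_mono2[OF _ whp_initial_nonneg]) (intro always_eventually, force)
qed

lemma whp_ex_noise_gt:
  assumes "0 \<le> s" "s < t" "x < sqrt (2 * \<alpha> * (t - s))"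
  shows "whp (\<lambda>N \<omega>. \<exists>i\<in>{1..N}. scaled_noise N i s t \<omega> > x)"
proof -
  define x' where "x' = max 0 x"
  have c: "\<alpha> * (t - s) > 0" using alpha_pos assms by simp
  have x': "0 \<le> x'" "x' < sqrt (2 * \<alpha> * (t - s))" using assms(3) c by (auto simp: x'_def)
  then have "x'\<^sup>2 < 2 * \<alpha> * (t - s)" by (metis real_sqrt_less_iff real_sqrt_unique)
  then have "x'\<^sup>2 / (2 * (\<alpha> * (t - s))) < 1" using c by (simp add: field_simps)
  then obtain d where d: "d < 1" "x'\<^sup>2 / (2 * (\<alpha> * (t - s))) < d" using dense by blast
  have "whp (\<lambda>N \<omega>. \<exists>i\<in>{1..N}. real_of_int (Q0 N i \<omega>) > -1 \<and> scaled_noise N i s t \<omega> > x')"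
  proof (rule whp_ex_joint[where a = "\<lambda>_. 1" and b = "\<lambda>N. real N powr (-d)"])
    show "\<forall>\<^sub>F N in sequentially. 0 \<le> (1::real) \<and> 1 \<le> initial_tail N (- 1)"
      using eventually_admissible by eventually_elim (simp add: initial_tail_neg)
    show "\<forall>\<^sub>F N in sequentially. \<forall>i\<in>{1..N}. real N powr - d \<le> prob {\<omega> \<in> space M. x' < scaled_noise N i s t \<omega>}"
      using gaussian_log_mgf_lower_tail[OF scaled_noise_gaussian[OF assms(1,2)] c x'(1) d(2)]
      by (auto elim: eventually_mono)
    show "filterlim (\<lambda>N. real N * (1 * real N powr - d)) at_top sequentially" using d(1) by real_asymp
  qed simp
  then show ?thesis by (rule whp_mono) (force simp: x'_def intro!: always_eventually)
qed

end

text \<open>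
  \<open>H v\<close> is the exponent of the probability that a server starts with \<open>v q0 N log N\<close> jobs. The bounds
  \<open>initial_tail_ge\<close> and \<open>initial_tail_le\<close> leave a margin \<open>\<delta>\<close> in \<open>v q0\<close>, so \<open>H\<close> may be discontinuous. At
  \<open>v = 1\<close> an exponent is too coarse: if \<open>H 1 = 1\<close>, it does not decide whether a largest start of that
  size exists. This is the reason for the assumptions \<open>whp_initial_le\<close> and \<open>initial_count\<close>.
\<close>
locale fork_join_start_profile = fork_join_iid_start +
  fixes q0 :: real and H :: "real \<Rightarrow> real"
  assumes q0_nonneg: "q0 \<ge> 0"
    and whp_initial_le: "\<And>\<delta>. \<delta> > 0 \<Longrightarrow> whp (\<lambda>N \<omega>. \<forall>i\<in>{1..N}. real_of_int (Q0 N i \<omega>) \<le> (q0 + \<delta>) * nlogn N)"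
    and initial_count: "\<And>\<delta>. \<delta> > 0 \<Longrightarrow>
      filterlim (\<lambda>N. real N * initial_tail N ((q0 - \<delta>) * nlogn N)) at_top sequentially"
    and H_0: "H 0 = 0" and H_1: "H 1 \<le> 1"
    and initial_tail_ge: "\<And>v \<delta> e. \<lbrakk>0 \<le> v; v \<le> 1; \<delta> > 0; e > H v\<rbrakk> \<Longrightarrow>
      \<forall>\<^sub>F N in sequentially. real N powr (-e) \<le> initial_tail N ((v * q0 - \<delta>) * nlogn N)"
    and initial_tail_le: "\<And>v \<delta> e. \<lbrakk>0 \<le> v; v \<le> 1; \<delta> > 0; e < H v\<rbrakk> \<Longrightarrow>
      \<forall>\<^sub>F N in sequentially. initial_tail N ((v * q0 + \<delta>) * nlogn N) \<le> real N powr (-e)"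
begin

text \<open>
  A nearly optimal pair \<open>(u, v)\<close> is made strictly feasible by lowering \<open>u\<close> a little. This is impossible
  for \<open>u = 0\<close>; then only a start near \<open>q0\<close> is needed, and the noise of that server merely has to avoid
  being very negative.
\<close>
lemma whp_ex_start_plus_noise_gt:
  assumes t: "t > 0" and x: "x < constrained_growth H (sqrt (2 * \<alpha> * t)) q0"
  shows "whp (\<lambda>N \<omega>. \<exists>i\<in>{1..N}. real_of_int (Q0 N i \<omega>) / nlogn N + scaled_noise N i 0 t \<omega> > x)"
proof -
  define a where "a = sqrt (2 * \<alpha> * t)"
  have a: "a > 0" "a\<^sup>2 = 2 * \<alpha> * t" using alpha_pos t by (auto simp: a_def)
  have c: "\<alpha> * (t - 0) > 0" using alpha_pos t by simp
  obtain u v where uv: "x < a * u + q0 * v" "u\<^sup>2 + H v \<le> 1" "0 \<le> u" "u \<le> 1" "0 \<le> v" "v \<le> 1"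
    by (rule less_constrained_growthE[OF x]) (use q0_nonneg H_0 a in \<open>auto simp: a_def\<close>)
  define \<delta> where "\<delta> = (a * u + q0 * v - x) / 2"
  have \<delta>: "\<delta> > 0" using uv(1) by (simp add: \<delta>_def)
  have "\<exists>w z. x \<le> w + z \<and> whp (\<lambda>N \<omega>. \<exists>i\<in>{1..N}. real_of_int (Q0 N i \<omega>) > w * nlogn N \<and> scaled_noise N i 0 t \<omega> > z)"
  proof (cases "u = 0")
    case True
    have "x \<le> (q0 - \<delta>) + (-\<delta>)"
    proof -
      have "q0 * v \<le> q0" using q0_nonneg uv by (simp add: mult_left_le)
      moreover have "x = q0 * v - 2 * \<delta>" using True by (simp add: \<delta>_def field_simps)
      ultimately show ?thesis by linarith
    qed
    moreover have "whp (\<lambda>N \<omega>. \<exists>i\<in>{1..N}. real_of_int (Q0 N i \<omega>) > (q0 - \<delta>) * nlogn N \<and> scaled_noise N i 0 t \<omega> > -\<delta>)"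
    proof (rule whp_ex_joint[where b = "\<lambda>_. 1/2"])
      show "\<forall>\<^sub>F N in sequentially. 0 \<le> initial_tail N ((q0 - \<delta>) * nlogn N) \<and>
          initial_tail N ((q0 - \<delta>) * nlogn N) \<le> initial_tail N ((q0 - \<delta>) * nlogn N)"
        by (simp add: initial_tail_def)
      show "filterlim (\<lambda>N. real N * (initial_tail N ((q0 - \<delta>) * nlogn N) * (1 / 2))) at_top sequentially"
        using filterlim_tendsto_pos_mult_at_top[OF tendsto_const _ initial_count[OF \<delta>], of "1/2"]
        by (simp add: mult_ac)
      define d where "d = (\<delta>/2)\<^sup>2 / (2 * (\<alpha> * (t - 0))) / 2"
      have d: "d > 0" "d < (\<delta>/2)\<^sup>2 / (2 * (\<alpha> * (t - 0)))" 
      proof -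
        have "(\<delta>/2)\<^sup>2 / (2 * (\<alpha> * (t - 0))) > 0" using \<delta> c by (intro divide_pos_pos) auto
        then show "d > 0" "d < (\<delta>/2)\<^sup>2 / (2 * (\<alpha> * (t - 0)))"  unfolding d_def by auto
      qed
      have "(\<lambda>N::nat. real N powr (-d)) \<longlonglongrightarrow> 0" using d(1) by real_asymp
      then have "\<forall>\<^sub>F N::nat in sequentially. real N powr (-d) < 1/2" by (rule order_tendstoD) simp
      moreover have "\<forall>\<^sub>F N in sequentially. \<forall>i\<in>{1..N}. (\<lambda>\<omega>. - scaled_noise N i 0 t \<omega>) \<in> borel_measurable M \<and>
           prob {\<omega>\<in>space M. - scaled_noise N i 0 t \<omega> > \<delta>/2} \<le> real N powr (-d)"
        by (rule gaussian_log_mgf_upper_tail[OF gaussian_log_mgf_uminus[OF scaled_noise_gaussian] c _ d(2)])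
           (use t \<delta> in auto)
      ultimately show "\<forall>\<^sub>F N in sequentially. \<forall>i\<in>{1..N}. 1/2 \<le> prob {\<omega> \<in> space M. scaled_noise N i 0 t \<omega> > -\<delta>}"
      proof eventually_elim
        case (elim N)
        show ?case
        proof
          fix i assume "i \<in> {1..N}"
          with elim(2) have m: "(\<lambda>\<omega>. - scaled_noise N i 0 t \<omega>) \<in> borel_measurable M"
            and p: "prob {\<omega>\<in>space M. - scaled_noise N i 0 t \<omega> > \<delta>/2} \<le> real N powr (-d)" by auto
          have [measurable]: "scaled_noise N i 0 t \<in> borel_measurable M"
            using borel_measurable_uminus[OF m] by simp
          have "1 - real N powr (-d) \<le> 1 - prob {\<omega>\<in>space M. - scaled_noise N i 0 t \<omega> > \<delta>/2}" using p by simp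
          also have "\<dots> = prob {\<omega>\<in>space M. \<not> (- scaled_noise N i 0 t \<omega> > \<delta>/2)}"
            by (rule prob_neg[symmetric]) measurable
          also have "\<dots> \<le> prob {\<omega> \<in> space M. scaled_noise N i 0 t \<omega> > -\<delta>}"
            using \<delta> by (intro finite_measure_mono) auto
          finally show "1/2 \<le> prob {\<omega> \<in> space M. scaled_noise N i 0 t \<omega> > -\<delta>}" using elim(1) by simp
        qed
      qed
    qed simp
    ultimately show ?thesis by blast
  next
    case False
    define z where "z = max 0 (a * u - \<delta>)"
    have "z < a * u" using False uv a \<delta> by (auto simp: z_def)
    then have "z\<^sup>2 < (a * u)\<^sup>2" by (intro power_strict_mono) (auto simp: z_def)
    then have "z\<^sup>2 / a\<^sup>2 < u\<^sup>2" using a(1) by (simp add: power_mult_distrib pos_divide_less_eq mult.commute)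
    define G where "G = 1 - z\<^sup>2 / a\<^sup>2 - H v"
    define e1 where "e1 = z\<^sup>2 / a\<^sup>2 + G / 3"
    define e2 where "e2 = H v + G / 3"
    have "G > 0" using \<open>z\<^sup>2 / a\<^sup>2 < u\<^sup>2\<close> uv unfolding G_def by linarith
    moreover have "z\<^sup>2 / a\<^sup>2 + H v = 1 - G" by (simp add: G_def)
    ultimately have e: "z\<^sup>2 / a\<^sup>2 < e1" "H v < e2" "e1 + e2 < 1" by (simp_all add: e1_def e2_def)
    have "whp (\<lambda>N \<omega>. \<exists>i\<in>{1..N}. real_of_int (Q0 N i \<omega>) > (v * q0 - \<delta>) * nlogn N \<and> scaled_noise N i 0 t \<omega> > z)"
    proof (rule whp_ex_joint[where a = "\<lambda>N. real N powr (-e2)" and b = "\<lambda>N. real N powr (-e1)"])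
      show "\<forall>\<^sub>F N in sequentially. 0 \<le> real N powr - e2 \<and> real N powr - e2 \<le> initial_tail N ((v * q0 - \<delta>) * nlogn N)"
        using initial_tail_ge[of v \<delta> e2] uv \<delta> e by simp
      have "z\<^sup>2 / (2 * (\<alpha> * (t - 0))) < e1" using e(1) a by (simp add: mult.assoc)
      from gaussian_log_mgf_lower_tail[OF scaled_noise_gaussian c _ this] t
      show "\<forall>\<^sub>F N in sequentially. \<forall>i\<in>{1..N}. real N powr - e1 \<le> prob {\<omega> \<in> space M. z < scaled_noise N i 0 t \<omega>}"
        by (auto simp: z_def elim: eventually_mono)
      show "filterlim (\<lambda>N. real N * (real N powr - e2 * real N powr - e1)) at_top sequentially"
        using e(3) by real_asymp
    qed simp
    moreover have "x \<le> (v * q0 - \<delta>) + z"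
    proof -
      have "x = a * u + v * q0 - 2 * \<delta>" by (simp add: \<delta>_def field_simps)
      moreover have "a * u - \<delta> \<le> z" by (simp add: z_def)
      ultimately show ?thesis by linarith
    qed
    ultimately show ?thesis by blast
  qed
  then obtain w z where wz: "x \<le> w + z"
    and whp: "whp (\<lambda>N \<omega>. \<exists>i\<in>{1..N}. real_of_int (Q0 N i \<omega>) > w * nlogn N \<and> scaled_noise N i 0 t \<omega> > z)" by blast
  show ?thesis
  proof (rule whp_elim[OF whp])
    fix N :: nat and \<omega>
    assume N: "N \<ge> 2" and "\<exists>i\<in>{1..N}. real_of_int (Q0 N i \<omega>) > w * nlogn N \<and> scaled_noise N i 0 t \<omega> > z"
    then obtain i where i: "i \<in> {1..N}" "real_of_int (Q0 N i \<omega>) > w * nlogn N" "scaled_noise N i 0 t \<omega> > z" by blast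
    have "real_of_int (Q0 N i \<omega>) / nlogn N > w" using i(2) nlogn_pos[OF N] by (simp add: field_simps)
    then show "\<exists>i\<in>{1..N}. x < real_of_int (Q0 N i \<omega>) / nlogn N + scaled_noise N i 0 t \<omega>"
      using i wz by (intro bexI[of _ i]) auto
  qed
qed

text \<open>
  The starts are sorted into \<open>m\<close> levels between \<open>0\<close> and \<open>q0\<close>. On level \<open>j\<close> a sum above \<open>x\<close> needs a noise
  above \<open>z j\<close>, and the pair of exponents at that corner exceeds 1, as otherwise the corner itself would be
  feasible with a value above the supremum.
\<close>
lemma whp_start_plus_noise_le:
  assumes t: "t > 0" and x: "x > constrained_growth H (sqrt (2 * \<alpha> * t)) q0"
  shows "whp (\<lambda>N \<omega>. \<forall>i\<in>{1..N}. real_of_int (Q0 N i \<omega>) / nlogn N + scaled_noise N i 0 t \<omega> \<le> x)"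
proof -
  define a where "a = sqrt (2 * \<alpha> * t)"
  define g where "g = constrained_growth H a q0"
  have a: "a > 0" "a\<^sup>2 = 2 * \<alpha> * t" using alpha_pos t by (auto simp: a_def)
  have c: "\<alpha> * (t - 0) > 0" using alpha_pos t by simp
  define \<delta> where "\<delta> = (x - g) / 3"
  have \<delta>: "\<delta> > 0" using x by (simp add: \<delta>_def g_def a_def)
  obtain m :: nat where m: "q0 / \<delta> < real m" using reals_Archimedean2 by blast
  have m0: "m > 0"
  proof -
    have "0 \<le> q0 / \<delta>" using q0_nonneg \<delta> by simp
    then have "0 < real m" using m by linarith
    then show ?thesis by simp
  qed
  (* One third of the gap x - g pays for the mesh of the levels and one third for the margin delta. *)
  have mesh: "q0 / real m < \<delta>" using m m0 \<delta> by (simp add: field_simps)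
  define z where "z j = x - (real (Suc j) / real m * q0 + \<delta>)" for j
  have z_gt: "g < z j + real j / real m * q0" for j
  proof -
    have "real (Suc j) / real m * q0 = real j / real m * q0 + q0 / real m"
      using m0 by (simp add: field_simps)
    moreover have "x = g + 3 * \<delta>" by (simp add: \<delta>_def field_simps)
    ultimately show ?thesis using mesh \<delta> unfolding z_def by linarith
  qed
  have g_a: "a \<le> g" using constrained_growth_upper[of a q0 1 H 0] a q0_nonneg H_0 by (simp add: g_def)
  have g_q0: "q0 \<le> g" using constrained_growth_upper[of a q0 0 H 1] a q0_nonneg H_1 by (simp add: g_def)
  have level: "whp (\<lambda>N \<omega>. \<forall>i\<in>{1..N}.
      (j > 0 \<longrightarrow> real_of_int (Q0 N i \<omega>) > (real j / real m * q0 + \<delta>) * nlogn N) \<longrightarrow> scaled_noise N i 0 t \<omega> \<le> z j)"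
    if j: "j < m" for j
  proof (cases "z j > a")
    case True
    then have "whp (\<lambda>N \<omega>. \<forall>i\<in>{1..N}. scaled_noise N i 0 t \<omega> \<le> z j)"
      by (intro whp_max_noise_le) (use t in \<open>auto simp: a_def\<close>)
    then show ?thesis by (rule whp_mono) auto
  next
    case False
    define v where "v = real j / real m"
    have v: "0 \<le> v" "v \<le> 1" using j by (auto simp: v_def)
    have j0: "j > 0" using False z_gt[of 0] g_a by (cases j) auto
    have "v * q0 \<le> q0" using v q0_nonneg by (simp add: mult_left_le_one_le)
    then have z: "z j > 0" using z_gt[of j] g_q0 unfolding v_def by linarith
    have "(z j / a)\<^sup>2 + H v > 1"
    proof (rule ccontr)
      assume "\<not> ?thesis"
      then have "a * (z j / a) + q0 * v \<le> g"
        unfolding g_def using a q0_nonneg z False v by (intro constrained_growth_upper) auto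
      then show False using z_gt[of j] a by (simp add: v_def mult_ac)
    qed
    define G where "G = (z j)\<^sup>2 / a\<^sup>2 + H v - 1"
    define e1 where "e1 = (z j)\<^sup>2 / a\<^sup>2 - G / 3"
    define e2 where "e2 = H v - G / 3"
    have "G > 0" using \<open>(z j / a)\<^sup>2 + H v > 1\<close> by (simp add: G_def power_divide)
    moreover have "(z j)\<^sup>2 / a\<^sup>2 + H v = 1 + G" by (simp add: G_def)
    ultimately have e: "e1 < (z j)\<^sup>2 / a\<^sup>2" "e2 < H v" "e1 + e2 > 1" by (simp_all add: e1_def e2_def)
    have "whp (\<lambda>N \<omega>. \<forall>i\<in>{1..N}. real_of_int (Q0 N i \<omega>) > (v * q0 + \<delta>) * nlogn N \<longrightarrow> scaled_noise N i 0 t \<omega> \<le> z j)"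
    proof (rule whp_no_joint[where a = "\<lambda>N. real N powr (-e2)" and b = "\<lambda>N. real N powr (-e1)"])
      show "\<forall>\<^sub>F N in sequentially. initial_tail N ((v * q0 + \<delta>) * nlogn N) \<le> real N powr - e2"
        by (rule initial_tail_le[OF v \<delta> e(2)])
      have "e1 < (z j)\<^sup>2 / (2 * (\<alpha> * (t - 0)))" using e(1) a by (simp add: mult.assoc)
      from gaussian_log_mgf_upper_tail[OF scaled_noise_gaussian c _ this] t z
      show "\<forall>\<^sub>F N in sequentially. \<forall>i\<in>{1..N}. prob {\<omega> \<in> space M. z j < scaled_noise N i 0 t \<omega>} \<le> real N powr - e1"
        by (auto elim: eventually_mono)
      show "(\<lambda>N. real N * (real N powr - e2 * real N powr - e1)) \<longlonglongrightarrow> 0"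
        using e(3) by real_asymp
    qed
    then show ?thesis by (rule whp_mono) (use j0 in \<open>auto simp: v_def\<close>)
  qed
  have "whp (\<lambda>N \<omega>. \<forall>j\<in>{..<m}. \<forall>i\<in>{1..N}.
      (j > 0 \<longrightarrow> real_of_int (Q0 N i \<omega>) > (real j / real m * q0 + \<delta>) * nlogn N) \<longrightarrow> scaled_noise N i 0 t \<omega> \<le> z j)"
    (is "whp ?level")
    by (rule whp_ball_finite) (use level in auto)
  from this whp_initial_le[OF \<delta>] show ?thesis
  proof (rule whp_elim2, intro ballI)
    fix N :: nat and \<omega> i
    assume N: "N \<ge> 2" and i: "i \<in> {1..N}" and lev: "?level N \<omega>"
      and top: "\<forall>i\<in>{1..N}. real_of_int (Q0 N i \<omega>) \<le> (q0 + \<delta>) * nlogn N"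
    note sc = nlogn_pos[OF N]
    define w where "w = real_of_int (Q0 N i \<omega>)"
    (* The level of a start is the least one whose upper end is not exceeded; level 0 has no lower end. *)
    define P where "P j \<longleftrightarrow> w \<le> (real (Suc j) / real m * q0 + \<delta>) * nlogn N" for j
    define j where "j = (LEAST j. P j)"
    have "P (m - 1)" using top i m0 by (simp add: P_def w_def)
    then have j: "P j" "j \<le> m - 1" unfolding j_def by (auto intro: LeastI Least_le)
    have "w > (real j / real m * q0 + \<delta>) * nlogn N" if "j > 0"
    proof -
      have "\<not> P (j - 1)" using that unfolding j_def by (intro not_less_Least) simp
      then show ?thesis using that by (simp add: P_def not_le)
    qed
    then have "scaled_noise N i 0 t \<omega> \<le> z j"
      using lev i j(2) m0 by (auto simp: w_def)
    moreover have "w / nlogn N \<le> real (Suc j) / real m * q0 + \<delta>"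
      using j(1) sc unfolding P_def by (simp add: pos_divide_le_eq)
    ultimately show "real_of_int (Q0 N i \<omega>) / nlogn N + scaled_noise N i 0 t \<omega> \<le> x"
      by (simp add: z_def w_def)
  qed
qed

end

section \<open>Lindley's formula and the walk of a server\<close>

lemma ex_grid_cell:
  fixes f :: "nat \<Rightarrow> 'b::linorder"
  assumes "f 0 \<le> x" "x \<le> f m" "m > 0"
  shows "\<exists>l<m. f l \<le> x \<and> x \<le> f (Suc l)"
  using assms(2,3)
proof (induction m)
  case (Suc m)
  show ?case
  proof (cases "m > 0 \<and> x \<le> f m")
    case True
    then show ?thesis using Suc.IH less_SucI by blast
  next
    case False
    then show ?thesis using Suc.prems assms(1) by (intro exI[of _ m]) auto
  qed
qed simp

lemma add_le_of_abs_diff_le: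
  fixes q x g d w b L :: real
  assumes "q + x \<le> g + d" "\<bar>w - (x - b)\<bar> \<le> d" "g - b \<le> L"
  shows "q + w \<le> L + 2 * d"
  using assms by linarith

lemma abs_diff_diff_le:
  fixes x y z w e :: real
  assumes "\<bar>x\<bar> \<le> e" "\<bar>y\<bar> \<le> e" "\<bar>z\<bar> \<le> e"
  shows "\<bar>x - y - z\<bar> \<le> 3 * e"
  using assms by linarith

lemma add_ge_of_abs_diff_le:
  fixes q x g d w b L :: real
  assumes "g - d < q + x" "\<bar>w - (x - b)\<bar> \<le> d" "L \<le> g - b"
  shows "L - 2 * d \<le> q + w"
  using assms by linarith

text \<open>
  The queue length after \<open>n\<close> steps of the walk \<open>W\<close>, reflected at 0 and started from \<open>x\<close> (when \<open>W 0 = 0\<close>).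
\<close>
definition lindley :: "real \<Rightarrow> (nat \<Rightarrow> real) \<Rightarrow> nat \<Rightarrow> real" where
  "lindley x W n = max (Max ((\<lambda>k. W n - W k) ` {..n})) (x + W n)"

lemma lindley_ge_diff: "k \<le> n \<Longrightarrow> W n - W k \<le> lindley x W n"
  unfolding lindley_def by (intro max.coboundedI1 Max_ge) auto

lemma lindley_ge_start: "x + W n \<le> lindley x W n"
  unfolding lindley_def by simp

lemma lindley_nonneg: "0 \<le> lindley x W n"
  using lindley_ge_diff[of n n W x] by simp

lemma lindley_leI:
  assumes "\<And>k. k \<le> n \<Longrightarrow> W n - W k \<le> z" "x + W n \<le> z"
  shows "lindley x W n \<le> z"
  unfolding lindley_def using assms by (intro max.boundedI Max.boundedI) auto

text \<open>
  Both terms of Lindley's formula move by at most \<open>e\<close> when the walk does; only backlogs started after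
  time \<open>m\<close> are new, and they have size at most \<open>2 e\<close>.
\<close>
lemma lindley_modulus:
  assumes "m \<le> n" and W: "\<And>k. k \<in> {m..n} \<Longrightarrow> \<bar>W k - W m\<bar> \<le> e"
  shows "\<bar>lindley x W n - lindley x W m\<bar> \<le> 2 * e"
proof -
  have n: "\<bar>W n - W m\<bar> \<le> e" using W[of n] assms(1) by simp
  have "lindley x W n \<le> lindley x W m + 2 * e"
  proof (rule lindley_leI)
    fix k assume k: "k \<le> n"
    show "W n - W k \<le> lindley x W m + 2 * e"
    proof (cases "k \<le> m")
      case True
      then show ?thesis using lindley_ge_diff[OF True, of W x] n by linarith
    next
      case False
      then have "\<bar>W k - W m\<bar> \<le> e" using k by (intro W) auto
      then show ?thesis using n lindley_nonneg[of x W m] by linarith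
    qed
  qed (use lindley_ge_start[of x W m] n in linarith)
  moreover have "lindley x W m \<le> lindley x W n + 2 * e"
  proof (rule lindley_leI)
    fix k assume "k \<le> m"
    then show "W m - W k \<le> lindley x W n + 2 * e"
      using lindley_ge_diff[of k n W x] n assms(1) by linarith
  qed (use lindley_ge_start[of x W n] n in linarith)
  ultimately show ?thesis by linarith
qed

lemma abs_Max_diff_le:
  fixes f g :: "'b \<Rightarrow> real"
  assumes "finite I" "I \<noteq> {}" "\<And>i. i \<in> I \<Longrightarrow> \<bar>f i - g i\<bar> \<le> d"
  shows "\<bar>Max (f ` I) - Max (g ` I)\<bar> \<le> d"
proof -
  have "Max (f ` I) \<le> Max (g ` I) + d"
  proof (rule Max.boundedI)
    fix z assume "z \<in> f ` I"
    then obtain i where i: "i \<in> I" "z = f i" by blast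
    moreover have "g i \<le> Max (g ` I)" using assms(1) i by (intro Max_ge) auto
    ultimately show "z \<le> Max (g ` I) + d" using assms(3)[of i] by linarith
  qed (use assms in auto)
  moreover have "Max (g ` I) \<le> Max (f ` I) + d"
  proof (rule Max.boundedI)
    fix z assume "z \<in> g ` I"
    then obtain i where i: "i \<in> I" "z = g i" by blast
    moreover have "f i \<le> Max (f ` I)" using assms(1) i by (intro Max_ge) auto
    ultimately show "z \<le> Max (f ` I) + d" using assms(3)[of i] by linarith
  qed (use assms in auto)
  ultimately show ?thesis by linarith
qed

lemma centred_refl [simp]: "centred c B m m \<omega> = 0"
  by (simp add: centred_def)

lemma centred_Suc:
  assumes "m \<le> n"
  shows "centred c B m (Suc n) \<omega> = centred c B m n \<omega> + ((1 - c) - of_bool (B (Suc n) \<omega>))"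
proof -
  have "{m<..Suc n} = insert (Suc n) {m<..n}" using assms by auto
  then show ?thesis by (simp add: centred_def)
qed

definition empty_start_limit :: "real \<Rightarrow> real \<Rightarrow> real \<Rightarrow> real" where
  "empty_start_limit \<alpha> \<beta> t = (sqrt (2 * \<alpha> * t) - \<beta> * t) * of_bool (t < \<alpha> / (2 * \<beta>\<^sup>2))
            + \<alpha> / (2 * \<beta>) * of_bool (t \<ge> \<alpha> / (2 * \<beta>\<^sup>2))"

text \<open>
  The parabola \<open>sqrt (2 \<alpha> s) - \<beta> s\<close>, stopped at its peak \<open>s = \<alpha> / (2 \<beta>\<^sup>2)\<close>.
\<close>
lemma empty_start_limit_eq:
  assumes "\<alpha> > 0" "\<beta> > 0"
  shows "empty_start_limit \<alpha> \<beta> t =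
    sqrt (2 * \<alpha> * min t (\<alpha> / (2 * \<beta>\<^sup>2))) - \<beta> * min t (\<alpha> / (2 * \<beta>\<^sup>2))"
proof -
  have "2 * \<alpha> * (\<alpha> / (2 * \<beta>\<^sup>2)) = (\<alpha> / \<beta>)\<^sup>2" by (simp add: power2_eq_square)
  then have "sqrt (2 * \<alpha> * (\<alpha> / (2 * \<beta>\<^sup>2))) = \<alpha> / \<beta>" using assms by simp
  moreover have "\<beta> * (\<alpha> / (2 * \<beta>\<^sup>2)) = \<alpha> / (2 * \<beta>)" using assms by (simp add: power2_eq_square)
  ultimately show ?thesis
    by (cases "t < \<alpha> / (2 * \<beta>\<^sup>2)") (simp_all add: empty_start_limit_def min_def field_simps)
qed

lemma parabola_le_empty_start_limit:
  assumes "\<alpha> > 0" "\<beta> > 0" "0 \<le> s" "s \<le> t"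
  shows "sqrt (2 * \<alpha> * s) - \<beta> * s \<le> empty_start_limit \<alpha> \<beta> t"
proof -
  define x where "x = sqrt s"
  define y where "y = sqrt (min t (\<alpha> / (2 * \<beta>\<^sup>2)))"
  define a where "a = sqrt (2 * \<alpha>)"
  have nn: "0 \<le> min t (\<alpha> / (2 * \<beta>\<^sup>2))" using assms by simp
  have x: "x \<ge> 0" "s = x\<^sup>2" using assms by (auto simp: x_def)
  have y: "y \<ge> 0" "min t (\<alpha> / (2 * \<beta>\<^sup>2)) = y\<^sup>2" using nn by (auto simp: y_def)
  have a: "a > 0" "a\<^sup>2 = 2 * \<alpha>" using assms by (auto simp: a_def)
  have s1: "sqrt (2 * \<alpha> * s) = a * x" by (simp add: a_def x_def real_sqrt_mult)
  have s2: "sqrt (2 * \<alpha> * min t (\<alpha> / (2 * \<beta>\<^sup>2))) = a * y"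
    by (simp add: a_def y_def real_sqrt_mult)
  have "(2 * \<beta> * y)\<^sup>2 = 4 * \<beta>\<^sup>2 * min t (\<alpha> / (2 * \<beta>\<^sup>2))"
    unfolding y(2) by (simp add: power_mult_distrib)
  also have "\<dots> \<le> 4 * \<beta>\<^sup>2 * (\<alpha> / (2 * \<beta>\<^sup>2))" by (intro mult_left_mono) auto
  also have "\<dots> = a\<^sup>2" using a assms by simp
  finally have ya: "2 * \<beta> * y \<le> a" by (rule power2_le_imp_le) (use a(1) in simp)
  have "a * x - \<beta> * x\<^sup>2 \<le> a * y - \<beta> * y\<^sup>2"
  proof (cases "x \<le> y")
    case True
    then have "\<beta> * (x + y) \<le> \<beta> * (2 * y)" using assms(2) by (intro mult_left_mono) auto
    also have "\<dots> \<le> a" using ya by (simp add: mult_ac)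
    finally have "0 \<le> (y - x) * (a - \<beta> * (x + y))" using True by simp
    then show ?thesis by (simp add: algebra_simps power2_eq_square)
  next
    case False
    have "y\<^sup>2 = \<alpha> / (2 * \<beta>\<^sup>2)"
    proof (rule ccontr)
      assume "y\<^sup>2 \<noteq> \<alpha> / (2 * \<beta>\<^sup>2)"
      then have "y\<^sup>2 = t" using y(2) by (auto simp: min_def split: if_splits)
      then have "x\<^sup>2 \<le> y\<^sup>2" using x assms by simp
      then have "x \<le> y" by (rule power2_le_imp_le) (rule y(1))
      then show False using False by simp
    qed
    then have "(2 * \<beta> * y)\<^sup>2 = a\<^sup>2" using a assms by (simp add: power_mult_distrib)
    then have "2 * \<beta> * y = a" by (rule power2_eq_imp_eq) (use a(1) y(1) assms(2) in simp_all)
    then have "a * y - \<beta> * y\<^sup>2 - (a * x - \<beta> * x\<^sup>2) = \<beta> * (x - y)\<^sup>2"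
      by (auto simp: algebra_simps power2_eq_square)
    moreover have "\<beta> * (x - y)\<^sup>2 \<ge> 0" using assms by simp
    ultimately show ?thesis by linarith
  qed
  then show ?thesis
    unfolding empty_start_limit_eq[OF assms(1,2)] s1 s2 unfolding y(2) x(2) .
qed

lemma empty_start_limit_attained:
  assumes "\<alpha> > 0" "\<beta> > 0" "0 \<le> t"
  obtains s where "0 \<le> s" "s \<le> t" "empty_start_limit \<alpha> \<beta> t = sqrt (2 * \<alpha> * s) - \<beta> * s"
  using that[of "min t (\<alpha> / (2 * \<beta>\<^sup>2))"] empty_start_limit_eq[OF assms(1,2), of t] assms by auto

lemma continuous_on_empty_start_limit:
  assumes "\<alpha> > 0" "\<beta> > 0"
  shows "continuous_on A (empty_start_limit \<alpha> \<beta>)"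
  unfolding empty_start_limit_eq[OF assms, abs_def] by (intro continuous_intros)

context fork_join_model
begin

definition walk :: "nat \<Rightarrow> nat \<Rightarrow> 'a \<Rightarrow> nat \<Rightarrow> real" where
  "walk N i \<omega> n = (\<Sum>j = 1..n. of_bool (X N j \<omega>)) - (\<Sum>j = 1..n. of_bool (Y N i j \<omega>))"

lemma walk_0 [simp]: "walk N i \<omega> 0 = 0"
  by (simp add: walk_def)

lemma walk_diff:
  assumes "m \<le> n"
  shows "walk N i \<omega> n - walk N i \<omega> m =
    service_noise N i m n \<omega> - arrival_noise N m n \<omega> - real (n - m) * (\<beta> / (real N)\<^sup>2)"
  using assms
proof (induction n rule: dec_induct)
  case base
  then show ?case by (simp add: service_noise_def arrival_noise_def)
next
  case (step n)
  have "walk N i \<omega> (Suc n) = walk N i \<omega> n + of_bool (X N (Suc n) \<omega>) - of_bool (Y N i (Suc n) \<omega>)"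
    by (simp add: walk_def)
  moreover have "service_noise N i m (Suc n) \<omega> =
      service_noise N i m n \<omega> + ((1 - \<alpha> / real N) - of_bool (Y N i (Suc n) \<omega>))"
    using \<open>m \<le> n\<close> by (simp add: service_noise_def centred_Suc)
  moreover have "arrival_noise N m (Suc n) \<omega> =
      arrival_noise N m n \<omega> + ((1 - (\<alpha> / real N + \<beta> / (real N)\<^sup>2)) - of_bool (X N (Suc n) \<omega>))"
    using \<open>m \<le> n\<close> by (simp add: arrival_noise_def centred_Suc)
  moreover have "real (Suc n - m) * (\<beta> / (real N)\<^sup>2) = real (n - m) * (\<beta> / (real N)\<^sup>2) + \<beta> / (real N)\<^sup>2"
    using \<open>m \<le> n\<close> by (simp add: Suc_diff_le ring_distribs add_divide_distrib)
  ultimately show ?case using step.IH by linarith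
qed

text \<open>
  All processes are constant between integer times, so the supremum over real times is a maximum over
  slots.
\<close>
lemma max_queue_eq_lindley:
  assumes "t \<ge> 0"
  shows "max_queue X Y Q0 N (t * real N ^ 3 * ln (real N)) \<omega> =
    Max ((\<lambda>i. lindley (real_of_int (Q0 N i \<omega>)) (walk N i \<omega>) (slot N t)) ` {1..N})"
proof -
  let ?n = "t * real N ^ 3 * ln (real N)"
  have n: "?n \<ge> 0" using assms by (cases "N = 0") (auto intro!: mult_nonneg_nonneg)
  have img: "(\<lambda>k. nat \<lfloor>k\<rfloor>) ` {0..?n} = {..slot N t}"
  proof (intro equalityI subsetI)
    fix k assume "k \<in> {..slot N t}"
    then have "real k \<in> {0..?n}" using slot_le[OF assms, of N] by auto
    then show "k \<in> (\<lambda>k. nat \<lfloor>k\<rfloor>) ` {0..?n}" by (intro image_eqI[of _ _ "real k"]) auto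
  qed (auto simp: slot_def intro!: nat_mono floor_mono)
  have backlog: "(SUP k\<in>{0..?n}. (arrivals X N ?n \<omega> - arrivals X N k \<omega>) - (services Y N i ?n \<omega> - services Y N i k \<omega>))
      = Max ((\<lambda>k. walk N i \<omega> (slot N t) - walk N i \<omega> k) ` {..slot N t})" for i
  proof -
    have "(arrivals X N ?n \<omega> - arrivals X N k \<omega>) - (services Y N i ?n \<omega> - services Y N i k \<omega>)
       = walk N i \<omega> (slot N t) - walk N i \<omega> (nat \<lfloor>k\<rfloor>)" for k
      by (simp add: arrivals_def services_def walk_def slot_def)
    then have "(SUP k\<in>{0..?n}. (arrivals X N ?n \<omega> - arrivals X N k \<omega>) - (services Y N i ?n \<omega> - services Y N i k \<omega>))
      = Sup ((\<lambda>k. walk N i \<omega> (slot N t) - walk N i \<omega> k) ` (\<lambda>k. nat \<lfloor>k\<rfloor>) ` {0..?n})"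
      by (simp add: image_image)
    also have "\<dots> = Max ((\<lambda>k. walk N i \<omega> (slot N t) - walk N i \<omega> k) ` {..slot N t})"
      unfolding img by (intro cSup_eq_Max) auto
    finally show ?thesis .
  qed
  have start: "real_of_int (Q0 N i \<omega>) + arrivals X N ?n \<omega> - services Y N i ?n \<omega> =
     real_of_int (Q0 N i \<omega>) + walk N i \<omega> (slot N t)" for i
    by (simp add: arrivals_def services_def walk_def slot_def)
  show ?thesis unfolding max_queue_def lindley_def backlog start ..
qed

end

context fork_join_iid_start
begin

lemma whp_arrival_noise_le:
  assumes "0 \<le> s" "s < t" "\<epsilon> > 0"
  shows "whp (\<lambda>N \<omega>. \<bar>arrival_noise N (slot N s) (slot N t) \<omega> / nlogn N\<bar> \<le> \<epsilon>)"
proof -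
  define A where "A N i \<omega> = arrival_noise N (slot N s) (slot N t) \<omega> / nlogn N" for N and i :: nat and \<omega>
  have c: "\<alpha> * (t - s) > 0" using alpha_pos assms by simp
  have "\<forall>\<^sub>F N in sequentially. \<forall>i\<in>{0::nat}. bernoulli_stream (\<alpha> / real N + \<beta> / (real N)\<^sup>2) (X N)"
    using eventually_admissible by eventually_elim (simp add: arrival_stream)
  from stream_gaussian_log_mgf[OF alpha_pos assms(1,2) this]
  have G: "gaussian_log_mgf (\<alpha> * (t - s)) (\<lambda>N. {0}) A"
    by (simp add: A_def[abs_def] arrival_noise_def nlogn_def)
  have "0 < \<epsilon>\<^sup>2 / (2 * (\<alpha> * (t - s)))" using c assms by simp
  then obtain d where d: "d > 0" "d < \<epsilon>\<^sup>2 / (2 * (\<alpha> * (t - s)))" using dense by blast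
  have lim: "(\<lambda>N::nat. real N powr (-d)) \<longlonglongrightarrow> 0" using d(1) by real_asymp
  have *: "whp (\<lambda>N \<omega>. Z N 0 \<omega> \<le> \<epsilon>)" if Z: "gaussian_log_mgf (\<alpha> * (t - s)) (\<lambda>N. {0::nat}) Z" for Z
  proof (rule whp_prob_boundI[OF _ lim])
    show "\<forall>\<^sub>F N in sequentially. {\<omega> \<in> space M. \<not> Z N 0 \<omega> \<le> \<epsilon>} \<in> events \<and>
        prob {\<omega> \<in> space M. \<not> Z N 0 \<omega> \<le> \<epsilon>} \<le> real N powr - d"
      using gaussian_log_mgf_upper_tail[OF Z c _ d(2)] assms(3)
      by (auto simp: not_le elim!: eventually_mono)
  qed
  show ?thesis
    by (rule whp_mono2[OF *[OF G] *[OF gaussian_log_mgf_uminus[OF G]]]) (intro always_eventually allI ballI impI, unfold A_def, linarith)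
qed

lemma whp_walk_increment:
  assumes "0 \<le> s" "s < t" "\<epsilon> > 0"
  shows "whp (\<lambda>N \<omega>. \<forall>i\<in>{1..N}. \<bar>(walk N i \<omega> (slot N t) - walk N i \<omega> (slot N s)) / nlogn N
      - (scaled_noise N i s t \<omega> - \<beta> * (t - s))\<bar> \<le> \<epsilon>)"
proof (rule whp_mono[OF whp_arrival_noise_le[OF assms(1,2)]])
  show "\<epsilon> / 2 > 0" using assms by simp
  have error: "\<bar>x - y - z - (x - z')\<bar> \<le> \<epsilon>" if "\<bar>y\<bar> \<le> \<epsilon> / 2" "\<bar>z - z'\<bar> < \<epsilon> / 2" for x y z z'
    using that by linarith
  have "(\<lambda>N. \<beta> * (real (slot N t - slot N s) / (real N ^ 3 * ln (real N)))) \<longlonglongrightarrow> \<beta> * (t - s)"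
    using assms by (intro tendsto_mult_left slot_diff_asymp) auto
  then have "\<forall>\<^sub>F N in sequentially. \<bar>\<beta> * (real (slot N t - slot N s) / (real N ^ 3 * ln (real N))) - \<beta> * (t - s)\<bar> < \<epsilon> / 2"
    using assms(3) tendstoD[of _ "\<beta> * (t - s)" sequentially "\<epsilon> / 2"] by (simp add: dist_real_def)
  then show "\<forall>\<^sub>F N in sequentially. \<forall>\<omega>\<in>space M. \<bar>arrival_noise N (slot N s) (slot N t) \<omega> / nlogn N\<bar> \<le> \<epsilon> / 2 \<longrightarrow>
    (\<forall>i\<in>{1..N}. \<bar>(walk N i \<omega> (slot N t) - walk N i \<omega> (slot N s)) / nlogn N
      - (scaled_noise N i s t \<omega> - \<beta> * (t - s))\<bar> \<le> \<epsilon>)"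
    using eventually_ge_at_top[of 2]
  proof eventually_elim
    case (elim N)
    have "slot N s \<le> slot N t" using assms by (intro slot_mono) simp
    note wd = walk_diff[OF this]
    have drift: "real (slot N t - slot N s) * (\<beta> / (real N)\<^sup>2) / nlogn N =
        \<beta> * (real (slot N t - slot N s) / (real N ^ 3 * ln (real N)))"
      using elim(2) by (simp add: nlogn_def power2_eq_square power3_eq_cube mult_ac)
    show ?case
    proof (intro ballI impI)
      fix \<omega> i assume "\<bar>arrival_noise N (slot N s) (slot N t) \<omega> / nlogn N\<bar> \<le> \<epsilon> / 2"
      moreover have "(walk N i \<omega> (slot N t) - walk N i \<omega> (slot N s)) / nlogn N =
          scaled_noise N i s t \<omega> - arrival_noise N (slot N s) (slot N t) \<omega> / nlogn N
            - \<beta> * (real (slot N t - slot N s) / (real N ^ 3 * ln (real N)))"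
        unfolding wd diff_divide_distrib drift scaled_noise_def ..
      ultimately show "\<bar>(walk N i \<omega> (slot N t) - walk N i \<omega> (slot N s)) / nlogn N
          - (scaled_noise N i s t \<omega> - \<beta> * (t - s))\<bar> \<le> \<epsilon>"
        by (simp only: error[OF _ elim(1)])
    qed
  qed
qed

text \<open>
  A third of the allowance each goes to service noise, arrival noise and drift.
\<close>
lemma whp_walk_modulus:
  assumes "\<epsilon> > 0"
  obtains \<Delta>0 where "\<Delta>0 > 0"
    "\<And>s \<Delta>. s \<ge> 0 \<Longrightarrow> \<Delta> > 0 \<Longrightarrow> \<Delta> \<le> \<Delta>0 \<Longrightarrow>
       whp (\<lambda>N \<omega>. \<forall>i\<in>{1..N}. \<forall>k\<in>{slot N s..slot N (s + \<Delta>)}.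
         \<bar>walk N i \<omega> k - walk N i \<omega> (slot N s)\<bar> \<le> \<epsilon> * nlogn N)"
proof -
  define e where "e = \<epsilon> / 3"
  have e: "e > 0" using assms by (simp add: e_def)
  define \<Delta>0 where "\<Delta>0 = min (e\<^sup>2 / (48 * \<alpha>)) (e / (2 * \<beta>))"
  have "\<Delta>0 > 0" using e alpha_pos beta_pos by (simp add: \<Delta>0_def)
  moreover have "whp (\<lambda>N \<omega>. \<forall>i\<in>{1..N}. \<forall>k\<in>{slot N s..slot N (s + \<Delta>)}.
         \<bar>walk N i \<omega> k - walk N i \<omega> (slot N s)\<bar> \<le> \<epsilon> * nlogn N)"
    if s: "s \<ge> 0" and \<Delta>: "\<Delta> > 0" "\<Delta> \<le> \<Delta>0" for s \<Delta>
  proof -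
    have \<Delta>1: "\<Delta> \<le> e\<^sup>2 / (48 * \<alpha>)" and \<Delta>2: "\<Delta> \<le> e / (2 * \<beta>)" using \<Delta> by (auto simp: \<Delta>0_def)
    have "\<forall>\<^sub>F N in sequentially. \<forall>i\<in>{1..N}. bernoulli_stream (\<alpha> / real N + 0 / (real N)\<^sup>2) (Y N i)"
      using eventually_admissible by eventually_elim (simp add: service_stream)
    from stream_modulus[OF alpha_pos e s \<Delta>(1) \<Delta>1 _ _ this]
    have S: "whp (\<lambda>N \<omega>. \<forall>i\<in>{1..N}. \<forall>k\<in>{slot N s..slot N (s + \<Delta>)}. \<bar>service_noise N i (slot N s) k \<omega>\<bar> \<le> e * nlogn N)"
      (is "whp ?S") by (simp add: service_noise_def nlogn_def)
    have "\<forall>\<^sub>F N in sequentially. \<forall>i\<in>{0::nat}. bernoulli_stream (\<alpha> / real N + \<beta> / (real N)\<^sup>2) (X N)"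
      using eventually_admissible by eventually_elim (simp add: arrival_stream)
    from stream_modulus[OF alpha_pos e s \<Delta>(1) \<Delta>1 _ _ this]
    have A: "whp (\<lambda>N \<omega>. \<forall>k\<in>{slot N s..slot N (s + \<Delta>)}. \<bar>arrival_noise N (slot N s) k \<omega>\<bar> \<le> e * nlogn N)"
      (is "whp ?A") by (simp add: arrival_noise_def nlogn_def)
    have "(\<lambda>N. real (slot N (s + \<Delta>) - slot N s) / (real N ^ 3 * ln (real N))) \<longlonglongrightarrow> s + \<Delta> - s"
      by (rule slot_diff_asymp) (use s \<Delta> in auto)
    then have "\<forall>\<^sub>F N in sequentially. real (slot N (s + \<Delta>) - slot N s) / (real N ^ 3 * ln (real N)) < 2 * \<Delta>"
      by (rule order_tendstoD(2)) (use \<Delta> in simp)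
    then have D: "\<forall>\<^sub>F N in sequentially. \<forall>k\<in>{slot N s..slot N (s + \<Delta>)}.
        \<bar>real (k - slot N s) * (\<beta> / (real N)\<^sup>2)\<bar> \<le> e * nlogn N" (is "eventually ?D _")
      using eventually_ge_at_top[of 2]
    proof eventually_elim
      case (elim N)
      have L: "ln (real N) > 0" "real N > 0" using elim by auto
      show ?case
      proof
        fix k assume k: "k \<in> {slot N s..slot N (s + \<Delta>)}"
        have "real (k - slot N s) \<le> real (slot N (s + \<Delta>) - slot N s)" using k by auto
        also have "\<dots> \<le> 2 * \<Delta> * (real N ^ 3 * ln (real N))"
          using elim(1) L by (simp add: divide_simps)
        finally have "real (k - slot N s) * (\<beta> / (real N)\<^sup>2) \<le> 2 * \<Delta> * (real N ^ 3 * ln (real N)) * (\<beta> / (real N)\<^sup>2)"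
          using beta_pos by (intro mult_right_mono) auto
        also have "\<dots> = (2 * \<beta> * \<Delta>) * nlogn N"
          using L by (simp add: nlogn_def power2_eq_square power3_eq_cube)
        also have "\<dots> \<le> e * nlogn N"
          using \<Delta>2 beta_pos nlogn_pos[OF elim(2)] by (intro mult_right_mono) (auto simp: field_simps)
        finally show "\<bar>real (k - slot N s) * (\<beta> / (real N)\<^sup>2)\<bar> \<le> e * nlogn N"
          using beta_pos by (simp only: abs_of_nonneg mult_nonneg_nonneg of_nat_0_le_iff divide_nonneg_nonneg
              zero_le_power2 less_imp_le)
      qed
    qed
    have D': "whp (\<lambda>N \<omega>. ?D N)" by (rule whp_eventually) (use D in simp)
    show ?thesis
    proof (rule whp_elim3[OF S A D'], intro ballI)
      fix N :: nat and \<omega> i k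
      assume i: "i \<in> {1..N}" and k: "k \<in> {slot N s..slot N (s + \<Delta>)}" and "?S N \<omega>" "?A N \<omega>" "?D N"
      then have b: "\<bar>service_noise N i (slot N s) k \<omega>\<bar> \<le> e * nlogn N" "\<bar>arrival_noise N (slot N s) k \<omega>\<bar> \<le> e * nlogn N"
        "\<bar>real (k - slot N s) * (\<beta> / (real N)\<^sup>2)\<bar> \<le> e * nlogn N"
        using i k by blast+
      have wd: "walk N i \<omega> k - walk N i \<omega> (slot N s) = service_noise N i (slot N s) k \<omega>
          - arrival_noise N (slot N s) k \<omega> - real (k - slot N s) * (\<beta> / (real N)\<^sup>2)"
        using k by (intro walk_diff) simp
      have eq: "\<epsilon> * nlogn N = 3 * (e * nlogn N)" by (simp add: e_def)
      show "\<bar>walk N i \<omega> k - walk N i \<omega> (slot N s)\<bar> \<le> \<epsilon> * nlogn N"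
        unfolding wd eq by (rule abs_diff_diff_le[OF b])
    qed
  qed
  ultimately show ?thesis using that by blast
qed

end

section \<open>The maximum queue at a fixed time\<close>

context fork_join_iid_start
begin

text \<open>
  The starting slot of a backlog is moved to a grid point below it, at the price of one block oscillation.
  At the finitely many grid points the bound for the maximal noise applies.
\<close>
lemma whp_all_backlogs_le:
  assumes t: "t > 0" and "\<epsilon> > 0"
  shows "whp (\<lambda>N \<omega>. \<forall>i\<in>{1..N}. \<forall>k\<le>slot N t.
     walk N i \<omega> (slot N t) - walk N i \<omega> k \<le> (empty_start_limit \<alpha> \<beta> t + \<epsilon>) * nlogn N)"
proof -
  define e where "e = \<epsilon> / 3"
  have e: "e > 0" using assms by (simp add: e_def)
  obtain \<Delta>0 where \<Delta>0: "\<Delta>0 > 0" and modulus: "\<And>s \<Delta>. s \<ge> 0 \<Longrightarrow> \<Delta> > 0 \<Longrightarrow> \<Delta> \<le> \<Delta>0 \<Longrightarrow>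
       whp (\<lambda>N \<omega>. \<forall>i\<in>{1..N}. \<forall>k\<in>{slot N s..slot N (s + \<Delta>)}.
         \<bar>walk N i \<omega> k - walk N i \<omega> (slot N s)\<bar> \<le> e * nlogn N)"
    by (rule whp_walk_modulus[OF e]) blast
  obtain m :: nat where m: "t / \<Delta>0 < real m" using reals_Archimedean2 by blast
  have m0: "m > 0"
  proof -
    have "0 < t / \<Delta>0" using t \<Delta>0 by simp
    then have "0 < real m" using m by linarith
    then show ?thesis by simp
  qed
  have mesh: "t / real m \<le> \<Delta>0" using m m0 \<Delta>0 by (simp add: field_simps)
  define s where "s l = t * real l / real m" for l
  have s: "0 \<le> s l" "s (Suc l) = s l + t / real m" for l
    using t by (simp_all add: s_def add_divide_distrib ring_distribs)
  have st: "s l < t" if "l < m" for l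
    using that t m0 by (simp add: s_def field_simps)
  have 1: "whp (\<lambda>N \<omega>. \<forall>l\<in>{..<m}. \<forall>i\<in>{1..N}. scaled_noise N i (s l) t \<omega> \<le> sqrt (2 * \<alpha> * (t - s l)) + e)"
    (is "whp ?A") by (intro whp_ball_finite whp_max_noise_le) (use s st e in auto)
  have 2: "whp (\<lambda>N \<omega>. \<forall>l\<in>{..<m}. \<forall>i\<in>{1..N}. \<bar>(walk N i \<omega> (slot N t) - walk N i \<omega> (slot N (s l))) / nlogn N
      - (scaled_noise N i (s l) t \<omega> - \<beta> * (t - s l))\<bar> \<le> e)" (is "whp ?B")
    by (intro whp_ball_finite whp_walk_increment) (use s st e in auto)
  have 3: "whp (\<lambda>N \<omega>. \<forall>l\<in>{..<m}. \<forall>i\<in>{1..N}. \<forall>k\<in>{slot N (s l)..slot N (s (Suc l))}.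
         \<bar>walk N i \<omega> k - walk N i \<omega> (slot N (s l))\<bar> \<le> e * nlogn N)"
    (is "whp ?C") unfolding s(2) by (intro whp_ball_finite modulus) (use s t m0 mesh in auto)
  show ?thesis
  proof (rule whp_elim3[OF 1 2 3], intro ballI allI impI)
    fix N :: nat and \<omega> i k
    assume N: "N \<ge> 2" and n1: "?A N \<omega>" and n2: "?B N \<omega>" and n3: "?C N \<omega>"
      and i: "i \<in> {1..N}" and k: "k \<le> slot N t"
    note sc = nlogn_pos[OF N]
    have "\<exists>l<m. slot N (s l) \<le> k \<and> k \<le> slot N (s (Suc l))"
      by (rule ex_grid_cell[where f = "\<lambda>l. slot N (s l)"]) (use k m0 in \<open>auto simp: s_def\<close>)
    then obtain l where l: "l < m" "k \<in> {slot N (s l)..slot N (s (Suc l))}" by auto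
    have "0 + scaled_noise N i (s l) t \<omega> \<le> sqrt (2 * \<alpha> * (t - s l)) + e"
      unfolding add_0 using n1 l i by blast
    moreover have "\<bar>(walk N i \<omega> (slot N t) - walk N i \<omega> (slot N (s l))) / nlogn N
         - (scaled_noise N i (s l) t \<omega> - \<beta> * (t - s l))\<bar> \<le> e" using n2 l i by blast
    moreover have "sqrt (2 * \<alpha> * (t - s l)) - \<beta> * (t - s l) \<le> empty_start_limit \<alpha> \<beta> t"
      by (rule parabola_le_empty_start_limit[OF alpha_pos beta_pos]) (use st[OF l(1)] s in auto)
    ultimately have "0 + (walk N i \<omega> (slot N t) - walk N i \<omega> (slot N (s l))) / nlogn N \<le> empty_start_limit \<alpha> \<beta> t + 2 * e"
      by (rule add_le_of_abs_diff_le)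
    then have "walk N i \<omega> (slot N t) - walk N i \<omega> (slot N (s l)) \<le> (empty_start_limit \<alpha> \<beta> t + 2 * e) * nlogn N"
      using sc by (simp add: pos_divide_le_eq)
    moreover have "\<bar>walk N i \<omega> k - walk N i \<omega> (slot N (s l))\<bar> \<le> e * nlogn N" using n3 l i by blast
    moreover have "(empty_start_limit \<alpha> \<beta> t + \<epsilon>) * nlogn N =
        (empty_start_limit \<alpha> \<beta> t + 2 * e) * nlogn N + e * nlogn N" by (simp add: e_def algebra_simps)
    moreover have "x - z \<le> c" if "x - y \<le> a" "\<bar>z - y\<bar> \<le> b" "c = a + b" for x y z a b c :: real
      using that by linarith
    ultimately show "walk N i \<omega> (slot N t) - walk N i \<omega> k \<le> (empty_start_limit \<alpha> \<beta> t + \<epsilon>) * nlogn N"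
      by blast
  qed
qed

lemma whp_ex_backlog_ge:
  assumes t: "t > 0" and "\<epsilon> > 0"
  shows "whp (\<lambda>N \<omega>. \<exists>i\<in>{1..N}. \<exists>k\<le>slot N t.
     walk N i \<omega> (slot N t) - walk N i \<omega> k \<ge> (empty_start_limit \<alpha> \<beta> t - \<epsilon>) * nlogn N)"
  (is "whp ?R")
proof -
  obtain s where s: "0 \<le> s" "s \<le> t" "empty_start_limit \<alpha> \<beta> t = sqrt (2 * \<alpha> * s) - \<beta> * s"
    by (rule empty_start_limit_attained[OF alpha_pos beta_pos less_imp_le[OF t]])
  show ?thesis
  proof (cases "s = 0")
    case True
    have "\<forall>\<^sub>F N in sequentially. \<forall>\<omega>\<in>space M. ?R N \<omega>"
      using eventually_ge_at_top[of 2]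
    proof eventually_elim
      case (elim N)
      have "(empty_start_limit \<alpha> \<beta> t - \<epsilon>) * nlogn N \<le> 0"
        using True s(3) nlogn_pos[OF elim] assms by (simp add: mult_nonpos_nonneg)
      then show ?case using elim by (auto intro!: bexI[of _ 1] exI[of _ "slot N t"])
    qed
    then show ?thesis by (rule whp_eventually)
  next
    case False
    then have s0: "0 \<le> t - s" "t - s < t" using s by auto
    have 1: "whp (\<lambda>N \<omega>. \<exists>i\<in>{1..N}. scaled_noise N i (t - s) t \<omega> > sqrt (2 * \<alpha> * s) - \<epsilon> / 2)"
      (is "whp ?A") by (rule whp_ex_noise_gt[OF s0]) (use assms in simp)
    have "\<epsilon> / 2 > 0" using assms by simp
    note 2 = whp_walk_increment[OF s0 this]
    show ?thesis
    proof (rule whp_elim2[OF 1 2])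
      fix N :: nat and \<omega>
      assume N: "N \<ge> 2" and "?A N \<omega>"
      then obtain i where i: "i \<in> {1..N}" "scaled_noise N i (t - s) t \<omega> > sqrt (2 * \<alpha> * s) - \<epsilon> / 2" by blast
      assume "\<forall>i\<in>{1..N}. \<bar>(walk N i \<omega> (slot N t) - walk N i \<omega> (slot N (t - s))) / nlogn N
          - (scaled_noise N i (t - s) t \<omega> - \<beta> * (t - (t - s)))\<bar> \<le> \<epsilon> / 2"
      then have "\<bar>(walk N i \<omega> (slot N t) - walk N i \<omega> (slot N (t - s))) / nlogn N
        - (scaled_noise N i (t - s) t \<omega> - \<beta> * s)\<bar> \<le> \<epsilon> / 2" using i by simp
      then have "empty_start_limit \<alpha> \<beta> t - 2 * (\<epsilon> / 2) \<le> 0 + (walk N i \<omega> (slot N t) - walk N i \<omega> (slot N (t - s))) / nlogn N"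
        by (rule add_ge_of_abs_diff_le[rotated]) (use i(2) s(3) in simp_all)
      then show "?R N \<omega>"
        using i nlogn_pos[OF N] slot_mono[of "t - s" t N] s
        by (intro bexI[of _ i] exI[of _ "slot N (t - s)"]) (auto simp: pos_le_divide_eq)
    qed
  qed
qed

end

context fork_join_start_profile
begin

definition profile_limit :: "real \<Rightarrow> real" where
  "profile_limit t = max (empty_start_limit \<alpha> \<beta> t) (constrained_growth H (sqrt (2 * \<alpha> * t)) q0 - \<beta> * t)"

lemma whp_max_queue_le:
  assumes t: "t > 0" and "\<epsilon> > 0"
  shows "whp (\<lambda>N \<omega>. \<forall>i\<in>{1..N}.
    lindley (real_of_int (Q0 N i \<omega>)) (walk N i \<omega>) (slot N t) \<le> (profile_limit t + \<epsilon>) * nlogn N)"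
  (is "whp ?R")
proof -
  define g where "g = constrained_growth H (sqrt (2 * \<alpha> * t)) q0"
  have e: "\<epsilon> / 2 > 0" using assms by simp
  have 1: "whp (\<lambda>N \<omega>. \<forall>i\<in>{1..N}. real_of_int (Q0 N i \<omega>) / nlogn N + scaled_noise N i 0 t \<omega> \<le> g + \<epsilon> / 2)" (is "whp ?A")
    by (rule whp_start_plus_noise_le[OF t]) (use e in \<open>simp add: g_def\<close>)
  have 2: "whp (\<lambda>N \<omega>. \<forall>i\<in>{1..N}.
      \<bar>walk N i \<omega> (slot N t) / nlogn N - (scaled_noise N i 0 t \<omega> - \<beta> * t)\<bar> \<le> \<epsilon> / 2)" (is "whp ?B")
    using whp_walk_increment[OF order_refl t e] by simp
  note 3 = whp_all_backlogs_le[OF assms]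
  show ?thesis
  proof (rule whp_elim3[OF 1 2 3], intro ballI)
    fix N :: nat and \<omega> i
    assume N: "N \<ge> 2" and n1: "?A N \<omega>" and n2: "?B N \<omega>" and i: "i \<in> {1..N}"
      and n3: "\<forall>i\<in>{1..N}. \<forall>k\<le>slot N t.
         walk N i \<omega> (slot N t) - walk N i \<omega> k \<le> (empty_start_limit \<alpha> \<beta> t + \<epsilon>) * nlogn N"
    note sc = nlogn_pos[OF N]
    show "lindley (real_of_int (Q0 N i \<omega>)) (walk N i \<omega>) (slot N t) \<le> (profile_limit t + \<epsilon>) * nlogn N"
    proof (rule lindley_leI)
      fix k assume "k \<le> slot N t"
      then have "walk N i \<omega> (slot N t) - walk N i \<omega> k \<le> (empty_start_limit \<alpha> \<beta> t + \<epsilon>) * nlogn N"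
        using n3 i by blast
      also have "\<dots> \<le> (profile_limit t + \<epsilon>) * nlogn N"
        using sc by (intro mult_right_mono) (auto simp: profile_limit_def)
      finally show "walk N i \<omega> (slot N t) - walk N i \<omega> k \<le> (profile_limit t + \<epsilon>) * nlogn N" .
    next
      have "real_of_int (Q0 N i \<omega>) / nlogn N + scaled_noise N i 0 t \<omega> \<le> g + \<epsilon> / 2"
        using n1 i by blast
      moreover have "\<bar>walk N i \<omega> (slot N t) / nlogn N - (scaled_noise N i 0 t \<omega> - \<beta> * t)\<bar> \<le> \<epsilon> / 2"
        using n2 i by blast
      moreover have "g - \<beta> * t \<le> profile_limit t" by (simp add: profile_limit_def g_def)
      ultimately have "real_of_int (Q0 N i \<omega>) / nlogn N + walk N i \<omega> (slot N t) / nlogn N \<le> profile_limit t + 2 * (\<epsilon> / 2)"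
        by (rule add_le_of_abs_diff_le)
      then show "real_of_int (Q0 N i \<omega>) + walk N i \<omega> (slot N t) \<le> (profile_limit t + \<epsilon>) * nlogn N"
        using sc by (simp add: pos_divide_le_eq flip: add_divide_distrib)
    qed
  qed
qed

lemma whp_max_queue_ge:
  assumes t: "t > 0" and "\<epsilon> > 0"
  shows "whp (\<lambda>N \<omega>. \<exists>i\<in>{1..N}.
    lindley (real_of_int (Q0 N i \<omega>)) (walk N i \<omega>) (slot N t) \<ge> (profile_limit t - \<epsilon>) * nlogn N)"
  (is "whp ?R")
proof -
  define g where "g = constrained_growth H (sqrt (2 * \<alpha> * t)) q0"
  have e: "\<epsilon> / 2 > 0" using assms by simp
  have 1: "whp (\<lambda>N \<omega>. \<exists>i\<in>{1..N}. real_of_int (Q0 N i \<omega>) / nlogn N + scaled_noise N i 0 t \<omega> > g - \<epsilon> / 2)" (is "whp ?A")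
    by (rule whp_ex_start_plus_noise_gt[OF t]) (use e in \<open>simp add: g_def\<close>)
  have 2: "whp (\<lambda>N \<omega>. \<forall>i\<in>{1..N}.
      \<bar>walk N i \<omega> (slot N t) / nlogn N - (scaled_noise N i 0 t \<omega> - \<beta> * t)\<bar> \<le> \<epsilon> / 2)" (is "whp ?B")
    using whp_walk_increment[OF order_refl t e] by simp
  note 3 = whp_ex_backlog_ge[OF assms]
  show ?thesis
  proof (rule whp_elim3[OF 1 2 3])
    fix N :: nat and \<omega>
    assume N: "N \<ge> 2" and n1: "?A N \<omega>" and n2: "?B N \<omega>"
      and n3: "\<exists>i\<in>{1..N}. \<exists>k\<le>slot N t.
         walk N i \<omega> (slot N t) - walk N i \<omega> k \<ge> (empty_start_limit \<alpha> \<beta> t - \<epsilon>) * nlogn N"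
    note sc = nlogn_pos[OF N]
    show "?R N \<omega>"
    proof (cases "profile_limit t = empty_start_limit \<alpha> \<beta> t")
      case True
      obtain i k where "i \<in> {1..N}" "k \<le> slot N t"
        "walk N i \<omega> (slot N t) - walk N i \<omega> k \<ge> (empty_start_limit \<alpha> \<beta> t - \<epsilon>) * nlogn N"
        using n3 by blast
      then show ?thesis
        using True lindley_ge_diff[of k "slot N t" "walk N i \<omega>" "real_of_int (Q0 N i \<omega>)"]
        by (intro bexI[of _ i]) auto
    next
      case False
      then have pl: "profile_limit t = g - \<beta> * t" by (auto simp: profile_limit_def g_def max_def split: if_splits)
      obtain i where i: "i \<in> {1..N}" "real_of_int (Q0 N i \<omega>) / nlogn N + scaled_noise N i 0 t \<omega> > g - \<epsilon> / 2"
        using n1 by blast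
      have "\<bar>walk N i \<omega> (slot N t) / nlogn N - (scaled_noise N i 0 t \<omega> - \<beta> * t)\<bar> \<le> \<epsilon> / 2"
        using n2 i(1) by blast
      from i(2) this have "profile_limit t - 2 * (\<epsilon> / 2) \<le> real_of_int (Q0 N i \<omega>) / nlogn N + walk N i \<omega> (slot N t) / nlogn N"
        by (rule add_ge_of_abs_diff_le) (simp add: pl)
      then have "real_of_int (Q0 N i \<omega>) + walk N i \<omega> (slot N t) \<ge> (profile_limit t - \<epsilon>) * nlogn N"
        using sc by (simp add: pos_le_divide_eq flip: add_divide_distrib)
      then show ?thesis
        using i(1) lindley_ge_start[of "real_of_int (Q0 N i \<omega>)" "walk N i \<omega>" "slot N t"]
        by (intro bexI[of _ i]) auto
    qed
  qed
qed

lemma whp_max_queue_fixed_time: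
  assumes "t > 0" "\<epsilon> > 0"
  shows "whp (\<lambda>N \<omega>. \<bar>max_queue X Y Q0 N (t * real N ^ 3 * ln (real N)) \<omega> / nlogn N - profile_limit t\<bar> \<le> \<epsilon>)"
proof (rule whp_elim2[OF whp_max_queue_le[OF assms] whp_max_queue_ge[OF assms]])
  fix N :: nat and \<omega>
  assume N: "N \<ge> 2"
  note sc = nlogn_pos[OF N]
  let ?f = "\<lambda>i. lindley (real_of_int (Q0 N i \<omega>)) (walk N i \<omega>) (slot N t)"
  assume u: "\<forall>i\<in>{1..N}. ?f i \<le> (profile_limit t + \<epsilon>) * nlogn N"
    and l: "\<exists>i\<in>{1..N}. ?f i \<ge> (profile_limit t - \<epsilon>) * nlogn N"
  have "Max (?f ` {1..N}) \<le> (profile_limit t + \<epsilon>) * nlogn N"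
    using u N by (intro Max.boundedI) auto
  moreover have "(profile_limit t - \<epsilon>) * nlogn N \<le> Max (?f ` {1..N})"
    using l by (auto intro: order_trans[OF _ Max_ge])
  ultimately have "\<bar>Max (?f ` {1..N}) / nlogn N - profile_limit t\<bar> \<le> \<epsilon>"
    using sc by (simp add: abs_le_iff divide_simps algebra_simps)
  then show "\<bar>max_queue X Y Q0 N (t * real N ^ 3 * ln (real N)) \<omega> / nlogn N - profile_limit t\<bar> \<le> \<epsilon>"
    using assms(1) by (subst max_queue_eq_lindley) auto
qed

end

section \<open>Tail profiles of the initial queue lengths\<close>

lemma one_minus_ge_exp_minus_double:
  fixes b :: real
  assumes "0 \<le> b" "b \<le> 1 / 2"
  shows "exp (- (2 * b)) \<le> 1 - b"
proof -
  have "2 * b\<^sup>2 \<le> b" using mult_left_mono[OF assms(2), of "2 * b"] assms(1) by (simp add: power2_eq_square)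
  moreover have "- b - 2 * b\<^sup>2 \<le> ln (1 - b)" by (rule ln_one_minus_pos_lower_bound[OF assms])
  ultimately have "exp (- (2 * b)) \<le> exp (ln (1 - b))" unfolding exp_le_cancel_iff by linarith
  then show ?thesis using assms by simp
qed

context prob_space
begin

lemma tail_prob_antimono:
  assumes "random_variable borel Z" "x \<le> y"
  shows "tail_prob M Z y \<le> tail_prob M Z x"
proof -
  have [measurable]: "Z \<in> borel_measurable M" by fact
  show ?thesis unfolding tail_prob_def using assms(2) by (intro finite_measure_mono) auto
qed

lemma tail_prob_bounds: "0 \<le> tail_prob M Z x" "tail_prob M Z x \<le> 1"
  by (auto simp: tail_prob_def)

lemma tail_prob_tendsto_0:
  assumes "random_variable borel Z"
  shows "(tail_prob M Z \<longlongrightarrow> 0) at_top"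
proof -
  have [measurable]: "Z \<in> borel_measurable M" by fact
  interpret D: real_distribution "distr M borel Z"
    by (rule real_distribution_distr[OF assms])
  have "tail_prob M Z x = 1 - cdf (distr M borel Z) x" for x
  proof -
    have "tail_prob M Z x = prob {\<omega>\<in>space M. \<not> Z \<omega> \<le> x}" by (simp add: tail_prob_def not_le)
    also have "\<dots> = 1 - prob {\<omega>\<in>space M. Z \<omega> \<le> x}" by (rule prob_neg) measurable
    also have "prob {\<omega>\<in>space M. Z \<omega> \<le> x} = cdf (distr M borel Z) x"
      by (simp add: cdf_def measure_distr vimage_def Int_def conj_commute)
    finally show ?thesis .
  qed
  then have "tail_prob M Z = (\<lambda>x. 1 - cdf (distr M borel Z) x)" by (rule ext)
  moreover have "((\<lambda>x. 1 - cdf (distr M borel Z) x) \<longlongrightarrow> 1 - 1) at_top"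
    by (intro tendsto_diff tendsto_const D.cdf_lim_at_top_prob)
  ultimately show ?thesis by simp
qed

lemma log_tail_ratio_bounds:
  assumes Z: "random_variable borel Z" and pos: "\<forall>t. tail_prob M Z t > 0"
    and "0 \<le> v" "v \<le> 1" "0 \<le> t"
  shows "0 \<le> log_tail_ratio M Z v t" "log_tail_ratio M Z v t \<le> 1"
proof -
  have "v * t \<le> t" using assms(3-5) by (simp add: mult_left_le_one_le)
  then have "tail_prob M Z t \<le> tail_prob M Z (v * t)" by (rule tail_prob_antimono[OF Z])
  then have le: "- ln (tail_prob M Z (v * t)) \<le> - ln (tail_prob M Z t)" using pos by simp
  have nn: "0 \<le> - ln (tail_prob M Z x)" for x using pos tail_prob_bounds(2)[of Z x] by simp
  have "0 \<le> a / b \<and> a / b \<le> 1" if "0 \<le> a" "a \<le> b" for a b :: real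
    using that by (auto simp: divide_le_eq_1)
  from this[OF nn le] show "0 \<le> log_tail_ratio M Z v t" "log_tail_ratio M Z v t \<le> 1"
    unfolding log_tail_ratio_def by blast+
qed

lemma log_tail_ratio_tendsto:
  assumes "regular_unbounded_tail M Z" "0 \<le> v" "v \<le> 1"
  shows "(log_tail_ratio M Z v \<longlongrightarrow> tail_exponent M Z v) at_top"
proof -
  obtain l where l: "(log_tail_ratio M Z v \<longlongrightarrow> l) at_top"
    using assms unfolding regular_unbounded_tail_def by (meson atLeastAtMost_iff)
  then have "tail_exponent M Z v = l"
    unfolding tail_exponent_def by (intro tendsto_Lim) auto
  with l show ?thesis by simp
qed

lemma tail_exponent_bounds:
  assumes Z: "random_variable borel Z" and "regular_unbounded_tail M Z" "0 \<le> v" "v \<le> 1"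
  shows "0 \<le> tail_exponent M Z v" "tail_exponent M Z v \<le> 1"
proof -
  have pos: "\<forall>t. tail_prob M Z t > 0" using assms(2) by (simp add: regular_unbounded_tail_def)
  note lim = log_tail_ratio_tendsto[OF assms(2-4)]
  show "0 \<le> tail_exponent M Z v"
    by (rule tendsto_lowerbound[OF lim])
       (use eventually_ge_at_top[of 0] in eventually_elim, auto intro: log_tail_ratio_bounds[OF Z pos assms(3,4)])
  show "tail_exponent M Z v \<le> 1"
    by (rule tendsto_upperbound[OF lim])
       (use eventually_ge_at_top[of 0] in eventually_elim, auto intro: log_tail_ratio_bounds[OF Z pos assms(3,4)])
qed

lemma log_tail_at_top:
  assumes Z: "random_variable borel Z" and pos: "\<forall>t. tail_prob M Z t > 0"
  shows "filterlim (\<lambda>t. - ln (tail_prob M Z t)) at_top at_top"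
proof -
  have "filterlim (tail_prob M Z) (at_right 0) at_top"
    using tail_prob_tendsto_0[OF Z] pos by (auto simp: filterlim_at intro!: always_eventually less_imp_neq[symmetric])
  then have "filterlim (\<lambda>t. ln (tail_prob M Z t)) at_bot at_top"
    by (rule filterlim_compose[OF ln_at_0])
  then show ?thesis by (simp add: filterlim_uminus_at_bot)
qed

text \<open>
  The numerator \<open>- ln P(Z > 0)\<close> is a constant while the denominator diverges.
\<close>
lemma tail_exponent_0:
  assumes Z: "random_variable borel Z" and reg: "regular_unbounded_tail M Z"
  shows "tail_exponent M Z 0 = 0"
proof -
  have pos: "\<forall>t. tail_prob M Z t > 0" using reg by (simp add: regular_unbounded_tail_def)
  have "((\<lambda>t. (- ln (tail_prob M Z 0)) / (- ln (tail_prob M Z t))) \<longlongrightarrow> 0) at_top"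
    by (rule real_tendsto_divide_at_top[OF tendsto_const log_tail_at_top[OF Z pos]])
  then have "(log_tail_ratio M Z 0 \<longlongrightarrow> 0) at_top" by (simp add: log_tail_ratio_def[abs_def])
  then show ?thesis
    using log_tail_ratio_tendsto[OF reg, of 0] tendsto_unique trivial_limit_at_top_linorder by fastforce
qed

end

locale fork_join_scaled_start = fork_join_iid_start +
  fixes r :: "nat \<Rightarrow> real" and U :: "nat \<Rightarrow> 'a \<Rightarrow> real" and q0 :: real
  assumes r_pos: "\<And>N. admissible \<alpha> \<beta> N \<Longrightarrow> r N > 0"
    and U_measurable: "random_variable borel (U 1)"
    and initial_eq: "\<And>N \<omega>. admissible \<alpha> \<beta> N \<Longrightarrow> \<omega> \<in> space M \<Longrightarrow> Q0 N 1 \<omega> = \<lfloor>r N * U 1 \<omega>\<rfloor>"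
    and q0_nonneg: "q0 \<ge> 0"
    and initial_limit: "\<And>\<epsilon>. \<epsilon> > 0 \<Longrightarrow>
      (\<lambda>N. prob {\<omega> \<in> space M. \<bar>max_queue X Y Q0 N 0 \<omega> / (real N * ln (real N)) - q0\<bar> > \<epsilon>}) \<longlonglongrightarrow> 0"
begin

abbreviation F :: "real \<Rightarrow> real" where
  "F \<equiv> tail_prob M (U 1)"

lemma max_queue_0_eq: "max_queue X Y Q0 N 0 \<omega> = Max ((\<lambda>i. max 0 (real_of_int (Q0 N i \<omega>))) ` {1..N})"
  using max_queue_eq_lindley[of 0 N \<omega>] by (simp add: lindley_def)

lemma whp_max_initial:
  assumes "\<epsilon> > 0"
  shows "whp (\<lambda>N \<omega>. (\<forall>i\<in>{1..N}. max 0 (real_of_int (Q0 N i \<omega>)) \<le> (q0 + \<epsilon>) * nlogn N) \<and>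
    (\<exists>i\<in>{1..N}. max 0 (real_of_int (Q0 N i \<omega>)) \<ge> (q0 - \<epsilon>) * nlogn N))"
  (is "whp ?R")
proof (rule whp_prob_boundI[OF _ initial_limit[OF assms]])
  show "\<forall>\<^sub>F N in sequentially.
     {\<omega> \<in> space M. \<not> ?R N \<omega>} \<in> events \<and>
     prob {\<omega> \<in> space M. \<not> ?R N \<omega>}
       \<le> prob {\<omega> \<in> space M. \<bar>max_queue X Y Q0 N 0 \<omega> / (real N * ln (real N)) - q0\<bar> > \<epsilon>}"
    using eventually_admissible
  proof eventually_elim
    case (elim N)
    then have N: "N \<ge> 2" by (simp add: admissible_def)
    note sc = nlogn_pos[OF N]
    have [measurable]: "Q0 N i \<in> measurable M (count_space UNIV)" if "i \<in> {1..N}" for i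
      using initial_measurable[OF elim that] .
    have eq: "\<bar>max_queue X Y Q0 N 0 \<omega> / (real N * ln (real N)) - q0\<bar> > \<epsilon> \<longleftrightarrow>
      \<not> ?R N \<omega>" for \<omega>
    proof -
      let ?m = "Max ((\<lambda>i. max 0 (real_of_int (Q0 N i \<omega>))) ` {1..N})"
      have "\<bar>max_queue X Y Q0 N 0 \<omega> / (real N * ln (real N)) - q0\<bar> \<le> \<epsilon> \<longleftrightarrow>
          ?m / nlogn N \<le> q0 + \<epsilon> \<and> q0 - \<epsilon> \<le> ?m / nlogn N"
        unfolding max_queue_0_eq nlogn_def[symmetric] abs_le_iff by auto
      also have "\<dots> \<longleftrightarrow> ?m \<le> (q0 + \<epsilon>) * nlogn N \<and> (q0 - \<epsilon>) * nlogn N \<le> ?m"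
        using sc by (simp only: pos_divide_le_eq pos_le_divide_eq)
      also have "?m \<le> (q0 + \<epsilon>) * nlogn N \<longleftrightarrow> (\<forall>i\<in>{1..N}. max 0 (real_of_int (Q0 N i \<omega>)) \<le> (q0 + \<epsilon>) * nlogn N)"
        using N by (subst Max_le_iff) auto
      also have "(q0 - \<epsilon>) * nlogn N \<le> ?m \<longleftrightarrow> (\<exists>i\<in>{1..N}. max 0 (real_of_int (Q0 N i \<omega>)) \<ge> (q0 - \<epsilon>) * nlogn N)"
        using N by (subst Max_ge_iff) auto
      finally show ?thesis by (metis not_le)
    qed
    have "{\<omega> \<in> space M. \<not> ?R N \<omega>} \<in> events"
      by measurable
    then show ?case unfolding eq by simp
  qed
qed

lemma whp_initial_le:
  assumes "\<delta> > 0"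
  shows "whp (\<lambda>N \<omega>. \<forall>i\<in>{1..N}. real_of_int (Q0 N i \<omega>) \<le> (q0 + \<delta>) * nlogn N)"
  by (rule whp_mono[OF whp_max_initial[OF assms]]) auto

lemma prob_all_initial_le:
  assumes N: "admissible \<alpha> \<beta> N"
  shows "prob {\<omega>\<in>space M. \<forall>i\<in>{1..N}. real_of_int (Q0 N i \<omega>) \<le> y} = (1 - initial_tail N y) ^ N"
proof -
  have N1: "{1..N} \<noteq> {}" using N by (auto simp: admissible_def)
  have iv: "indep_vars (\<lambda>_. count_space UNIV) (Q0 N) {1..N}"
    using initial_iid[OF N] by (simp add: iid_vars_def)
  have p: "prob {\<omega>\<in>space M. Q0 N i \<omega> \<in> {k. real_of_int k \<le> y}} = 1 - initial_tail N y" if i: "i \<in> {1..N}" for i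
  proof -
    have [measurable]: "Q0 N i \<in> measurable M (count_space UNIV)" by (rule initial_measurable[OF N i])
    have "prob {\<omega>\<in>space M. \<not> (real_of_int (Q0 N i \<omega>) > y)} = 1 - prob {\<omega>\<in>space M. real_of_int (Q0 N i \<omega>) > y}"
      by (rule prob_neg) measurable
    then show ?thesis by (simp add: prob_initial_eq[OF N i] not_less)
  qed
  have "prob {\<omega>\<in>space M. \<forall>i\<in>{1..N}. Q0 N i \<omega> \<in> {k. real_of_int k \<le> y}} =
      (\<Prod>i\<in>{1..N}. prob {\<omega>\<in>space M. Q0 N i \<omega> \<in> {k. real_of_int k \<le> y}})"
    by (rule indep_vars_prob_Ball[OF iv order_refl _ N1]) auto
  also have "\<dots> = (\<Prod>i\<in>{1..N}. 1 - initial_tail N y)"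
    by (intro prod.cong refl p)
  finally show ?thesis by simp
qed

lemma initial_tail_bounds: "0 \<le> initial_tail N y" "initial_tail N y \<le> 1"
  by (auto simp: initial_tail_def)

text \<open>
  The \<open>1/N\<close>-quantile of the start is at most \<open>q0 + \<delta>\<close>: if the expected number of larger starts were above 1,
  one would occur with probability at least \<open>1 - exp (-1)\<close>.
\<close>
lemma initial_tail_small:
  assumes "\<delta> > 0"
  shows "\<forall>\<^sub>F N in sequentially. real N * initial_tail N ((q0 + \<delta>) * nlogn N) \<le> 1"
proof -
  define b where "b N = initial_tail N ((q0 + \<delta>) * nlogn N)" for N
  have "(\<lambda>N. prob {\<omega>\<in>space M. \<not> (\<forall>i\<in>{1..N}. real_of_int (Q0 N i \<omega>) \<le> (q0 + \<delta>) * nlogn N)}) \<longlonglongrightarrow> 0"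
    by (rule whp_imp_prob_tendsto_0[OF whp_initial_le[OF assms]])
  then have "\<forall>\<^sub>F N in sequentially. prob {\<omega>\<in>space M. \<not> (\<forall>i\<in>{1..N}. real_of_int (Q0 N i \<omega>) \<le> (q0 + \<delta>) * nlogn N)} < 1 - exp (-1)"
    by (rule order_tendstoD(2)) simp
  then show ?thesis
    using eventually_admissible
  proof eventually_elim
    case (elim N)
    have [measurable]: "Q0 N i \<in> measurable M (count_space UNIV)" if "i \<in> {1..N}" for i
      using initial_measurable[OF elim(2) that] .
    have "prob {\<omega>\<in>space M. \<not> (\<forall>i\<in>{1..N}. real_of_int (Q0 N i \<omega>) \<le> (q0 + \<delta>) * nlogn N)}
        = 1 - prob {\<omega>\<in>space M. \<forall>i\<in>{1..N}. real_of_int (Q0 N i \<omega>) \<le> (q0 + \<delta>) * nlogn N}"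
      by (rule prob_neg) measurable
    then have "exp (-1) < (1 - b N) ^ N"
      using elim(1) unfolding prob_all_initial_le[OF elim(2)] b_def by linarith
    also have "\<dots> \<le> exp (- b N) ^ N"
      using exp_ge_add_one_self[of "- b N"] initial_tail_bounds by (intro power_mono) (auto simp: b_def)
    also have "\<dots> = exp (- (real N * b N))" by (simp flip: exp_of_nat_mult)
    finally show ?case by (simp add: b_def)
  qed
qed

text \<open>
  The \<open>1/N\<close>-quantile is at least \<open>q0 - \<delta>\<close>: if the expected number of larger starts stayed below a constant
  \<open>K\<close> and \<open>N \<ge> 2 K\<close>, there would be none with probability at least \<open>exp (-2 K)\<close>.
\<close>
lemma initial_count:
  assumes "\<delta> > 0"
  shows "filterlim (\<lambda>N. real N * initial_tail N ((q0 - \<delta>) * nlogn N)) at_top sequentially"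
proof -
  define b where "b N = initial_tail N ((q0 - \<delta>) * nlogn N)" for N
  have "\<delta> / 2 > 0" using assms by simp
  from whp_max_initial[OF this] whp_initial_nonneg
  have "whp (\<lambda>N \<omega>. \<not> (\<forall>i\<in>{1..N}. real_of_int (Q0 N i \<omega>) \<le> (q0 - \<delta>) * nlogn N))"
  proof (rule whp_elim2)
    fix N :: nat and \<omega>
    assume N: "N \<ge> 2" and "(\<forall>i\<in>{1..N}. max 0 (real_of_int (Q0 N i \<omega>)) \<le> (q0 + \<delta> / 2) * nlogn N) \<and>
        (\<exists>i\<in>{1..N}. max 0 (real_of_int (Q0 N i \<omega>)) \<ge> (q0 - \<delta> / 2) * nlogn N)"
      and "\<forall>i\<in>{1..N}. 0 \<le> Q0 N i \<omega>"
    moreover have "(q0 - \<delta>) * nlogn N < (q0 - \<delta> / 2) * nlogn N"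
      using nlogn_pos[OF N] assms by (intro mult_strict_right_mono) auto
    ultimately show "\<not> (\<forall>i\<in>{1..N}. real_of_int (Q0 N i \<omega>) \<le> (q0 - \<delta>) * nlogn N)" by fastforce
  qed
  then have lim: "(\<lambda>N. prob {\<omega>\<in>space M. \<forall>i\<in>{1..N}. real_of_int (Q0 N i \<omega>) \<le> (q0 - \<delta>) * nlogn N}) \<longlonglongrightarrow> 0"
    using whp_imp_prob_tendsto_0 by fastforce
  (* For K > 0 the bound 1 - b >= exp (-2 b) needs b <= 1/2, which K <= N / 2 ensures. *)
  show ?thesis unfolding b_def[symmetric] filterlim_at_top_gt[where c = 0]
  proof (intro allI impI)
    fix K :: real assume K: "K > 0"
    have "\<forall>\<^sub>F N in sequentially. prob {\<omega>\<in>space M. \<forall>i\<in>{1..N}. real_of_int (Q0 N i \<omega>) \<le> (q0 - \<delta>) * nlogn N} < exp (- (2 * K))"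
      by (rule order_tendstoD(2)[OF lim]) simp
    moreover have "\<forall>\<^sub>F N in sequentially. real N \<ge> 2 * K" by real_asymp
    ultimately show "\<forall>\<^sub>F N in sequentially. K \<le> real N * b N"
      using eventually_admissible
    proof eventually_elim
      case (elim N)
      show ?case
      proof (rule ccontr)
        assume "\<not> K \<le> real N * b N"
        then have bN: "real N * b N \<le> K" by simp
        have "N > 0" using elim(3) by (simp add: admissible_def)
        have "2 * K * b N \<le> real N * b N"
          using elim(2) initial_tail_bounds by (intro mult_right_mono) (auto simp: b_def)
        then have "K * (2 * b N) \<le> K * 1" using bN by simp
        then have "b N \<le> 1 / 2" using K by (simp only: mult_le_cancel_left_pos)
        then have "exp (- (2 * b N)) \<le> 1 - b N"
          using initial_tail_bounds by (intro one_minus_ge_exp_minus_double) (auto simp: b_def)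
        then have "exp (- (2 * b N)) ^ N \<le> (1 - b N) ^ N" by (intro power_mono) auto
        also have "\<dots> < exp (- (2 * K))"
          using elim(1) unfolding prob_all_initial_le[OF elim(3)] b_def .
        finally have "exp (- (2 * (real N * b N))) < exp (- (2 * K))"
          by (simp add: mult_ac flip: exp_of_nat_mult)
        then show False using bN by simp
      qed
    qed
  qed
qed

lemma initial_tail_le_F:
  assumes "admissible \<alpha> \<beta> N"
  shows "initial_tail N y \<le> F (y / r N)"
proof -
  have [measurable]: "U 1 \<in> borel_measurable M" by (rule U_measurable)
  show ?thesis unfolding initial_tail_def tail_prob_def
  proof (intro finite_measure_mono subsetI; clarify?)
    fix \<omega> assume w: "\<omega> \<in> space M" "y < real_of_int (Q0 N 1 \<omega>)"
    then have "y < r N * U 1 \<omega>" using initial_eq[OF assms w(1)] by linarith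
    then show "y / r N < U 1 \<omega>" using r_pos[OF assms] by (simp add: field_simps)
  qed measurable
qed

lemma initial_tail_ge_F:
  assumes "admissible \<alpha> \<beta> N"
  shows "F ((y + 1) / r N) \<le> initial_tail N y"
proof -
  have N: "1 \<in> {1..N}" using assms by (simp add: admissible_def)
  have [measurable]: "Q0 N 1 \<in> measurable M (count_space UNIV)" by (rule initial_measurable[OF assms N])
  show ?thesis unfolding initial_tail_def tail_prob_def
  proof (intro finite_measure_mono subsetI; clarify?)
    fix \<omega> assume w: "\<omega> \<in> space M" "(y + 1) / r N < U 1 \<omega>"
    then have "y + 1 < r N * U 1 \<omega>" using r_pos[OF assms] by (simp add: field_simps)
    then show "y < real_of_int (Q0 N 1 \<omega>)" using initial_eq[OF assms w(1)] by linarith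
  qed measurable
qed

lemma start_profileI:
  assumes "H 0 = 0" "H 1 \<le> 1"
    and "\<And>v \<delta> e. \<lbrakk>0 \<le> v; v \<le> 1; \<delta> > 0; e > H v\<rbrakk> \<Longrightarrow>
      \<forall>\<^sub>F N in sequentially. real N powr (-e) \<le> initial_tail N ((v * q0 - \<delta>) * nlogn N)"
    and "\<And>v \<delta> e. \<lbrakk>0 \<le> v; v \<le> 1; \<delta> > 0; e < H v\<rbrakk> \<Longrightarrow>
      \<forall>\<^sub>F N in sequentially. initial_tail N ((v * q0 + \<delta>) * nlogn N) \<le> real N powr (-e)"
  shows "fork_join_start_profile M \<alpha> \<beta> X Y Q0 q0 H"
  by unfold_locales (use assms q0_nonneg whp_initial_le initial_count in auto)

text \<open>
  Every threshold \<open>v q0 - \<delta>\<close> is negative and every threshold \<open>v q0 + \<delta>\<close> lies above the \<open>1/N\<close>-quantile, so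
  the bounds hold with exponents 0 and 1 respectively, whatever \<open>H\<close> lies between.
\<close>
lemma start_profile_negligible:
  assumes "q0 = 0" "H 0 = 0" "\<And>v. 0 \<le> v \<Longrightarrow> v \<le> 1 \<Longrightarrow> 0 \<le> H v \<and> H v \<le> 1"
  shows "fork_join_start_profile M \<alpha> \<beta> X Y Q0 q0 H"
proof (rule start_profileI)
  fix v \<delta> e :: real assume v: "0 \<le> v" "v \<le> 1" and \<delta>: "\<delta> > 0"
  { assume e: "e > H v"
    then have "e > 0" using assms(3)[OF v] by linarith
    show "\<forall>\<^sub>F N in sequentially. real N powr (-e) \<le> initial_tail N ((v * q0 - \<delta>) * nlogn N)"
      using eventually_admissible
    proof eventually_elim
      case (elim N)
      then have N: "N \<ge> 2" by (simp add: admissible_def)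
      have "(v * q0 - \<delta>) * nlogn N < 0" using nlogn_pos[OF N] \<delta> assms(1) by (simp add: mult_pos_pos)
      then have "initial_tail N ((v * q0 - \<delta>) * nlogn N) = 1" by (rule initial_tail_neg[OF elim])
      moreover have "real N powr (-e) \<le> real N powr 0" using N \<open>e > 0\<close> by (intro powr_mono) auto
      ultimately show ?case using N by simp
    qed }
  { assume e: "e < H v"
    then have "e \<le> 1" using assms(3)[OF v] by linarith
    show "\<forall>\<^sub>F N in sequentially. initial_tail N ((v * q0 + \<delta>) * nlogn N) \<le> real N powr (-e)"
      using initial_tail_small[OF \<delta>] eventually_ge_at_top[of 2]
    proof eventually_elim
      case (elim N)
      have "initial_tail N ((v * q0 + \<delta>) * nlogn N) \<le> 1 / real N"
        using elim assms(1) by (simp add: field_simps)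
      also have "\<dots> = real N powr (-1)" using elim by (simp add: powr_minus_divide)
      also have "\<dots> \<le> real N powr (-e)" using elim \<open>e \<le> 1\<close> by (intro powr_mono) auto
      finally show ?case .
    qed }
qed (use assms in auto)

text \<open>
  The maximal start is near \<open>q0\<close> while \<open>U\<close> never exceeds its right endpoint \<open>b\<close>, so \<open>(q0 - d) N log N\<close> is at most
  \<open>r N * b\<close>. Hence a slightly lower threshold corresponds to a value of \<open>U\<close> bounded away from \<open>b\<close>, which is
  exceeded with a fixed positive probability.
\<close>
lemma start_profile_bounded:
  assumes "q0 > 0" and fin: "finite_right_endpoint M (U 1)"
  shows "fork_join_start_profile M \<alpha> \<beta> X Y Q0 q0 (\<lambda>_. 0)"
proof (rule start_profileI)
  fix v \<delta> e :: real assume v: "0 \<le> v" "v \<le> 1" and \<delta>: "\<delta> > 0"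
  { assume e: "e < 0"
    show "\<forall>\<^sub>F N in sequentially. initial_tail N ((v * q0 + \<delta>) * nlogn N) \<le> real N powr (-e)"
      using eventually_ge_at_top[of 2]
    proof eventually_elim
      case (elim N)
      have "initial_tail N ((v * q0 + \<delta>) * nlogn N) \<le> real N powr 0"
        using elim initial_tail_bounds by simp
      also have "\<dots> \<le> real N powr (-e)" using elim e by (intro powr_mono) auto
      finally show ?case .
    qed }
  { assume e: "e > 0"
    obtain b where b: "right_endpoint M (U 1) = ereal b"
      using fin unfolding finite_right_endpoint_def by (cases "right_endpoint M (U 1)") auto
    have F_pos_imp: "x \<le> b" if "F x > 0" for x
    proof -
      have "ereal x \<le> right_endpoint M (U 1)" unfolding right_endpoint_def using that by (intro SUP_upper) auto
      then show ?thesis unfolding b by simp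
    qed
    have F_pos: "F x > 0" if "x < b" for x
    proof -
      have "ereal x < (SUP x\<in>{x. F x > 0}. ereal x)" using that b by (simp add: right_endpoint_def)
      then obtain y where "F y > 0" "x < y" by (auto simp: less_SUP_iff)
      then show ?thesis using tail_prob_antimono[OF U_measurable, of x y] by linarith
    qed
    define d where "d = min \<delta> (q0 / 2) / 3"
    have d: "d > 0" "3 * d \<le> \<delta>" "3 * d \<le> q0 / 2" using \<delta> \<open>q0 > 0\<close> by (auto simp: d_def)
    (* Of the margin 3 d, one part pays for the rounding, one for the distance of the maximum from q0,
       and the last one is the factor rho < 1. *)
    define \<rho> where "\<rho> = (q0 - 2 * d) / (q0 - d)"
    have \<rho>: "0 < \<rho>" "\<rho> < 1" using d \<open>q0 > 0\<close> by (auto simp: \<rho>_def)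
    have "\<forall>\<^sub>F N in sequentially. real N * initial_tail N ((q0 - d) * nlogn N) \<ge> 1"
      using initial_count[OF d(1)] by (simp add: filterlim_at_top)
    moreover have "\<forall>\<^sub>F N in sequentially. nlogn N \<ge> 1 / d"
      using filterlim_nlogn by (simp add: filterlim_at_top)
    ultimately have lower: "\<forall>\<^sub>F N in sequentially. b > 0 \<and> F (\<rho> * b) \<le> initial_tail N ((v * q0 - \<delta>) * nlogn N)"
      using eventually_admissible
    proof eventually_elim
      case (elim N)
      then have N: "N \<ge> 2" by (simp add: admissible_def)
      note sc = nlogn_pos[OF N]
      note rN = r_pos[OF elim(3)]
      have "initial_tail N ((q0 - d) * nlogn N) > 0"
        using elim(1) initial_tail_bounds[of N "(q0 - d) * nlogn N"] by (cases "initial_tail N ((q0 - d) * nlogn N) = 0") auto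
      then have "F ((q0 - d) * nlogn N / r N) > 0"
        using initial_tail_le_F[OF elim(3), of "(q0 - d) * nlogn N"] by linarith
      then have le_b: "(q0 - d) * nlogn N / r N \<le> b" by (rule F_pos_imp)
      have q0d: "q0 - d > 0" using d \<open>q0 > 0\<close> by linarith
      then have "(q0 - d) * nlogn N / r N > 0" using sc rN by simp
      then have "b > 0" using le_b by linarith
      have v_le: "v * q0 \<le> q0" using v \<open>q0 > 0\<close> by (simp add: mult_left_le_one_le)
      have one: "1 \<le> d * nlogn N" using elim(2) d(1) by (simp add: field_simps)
      have "(v * q0 - \<delta>) * nlogn N + 1 \<le> (v * q0 - \<delta> + d) * nlogn N" using one by (simp add: algebra_simps)
      also have "\<dots> \<le> (q0 - 2 * d) * nlogn N"
        using v_le d sc by (intro mult_right_mono) linarith+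
      also have "\<dots> = \<rho> * ((q0 - d) * nlogn N)" using q0d by (simp add: \<rho>_def)
      finally have "((v * q0 - \<delta>) * nlogn N + 1) / r N \<le> \<rho> * ((q0 - d) * nlogn N / r N)"
        using rN by (simp add: divide_right_mono)
      also have "\<dots> \<le> \<rho> * b" using le_b \<rho> by (intro mult_left_mono) auto
      finally have "F (\<rho> * b) \<le> F (((v * q0 - \<delta>) * nlogn N + 1) / r N)"
        by (rule tail_prob_antimono[OF U_measurable])
      also have "\<dots> \<le> initial_tail N ((v * q0 - \<delta>) * nlogn N)" by (rule initial_tail_ge_F[OF elim(3)])
      finally show ?case using \<open>b > 0\<close> by simp
    qed
    then have "b > 0" using eventually_happens by fastforce
    then have "\<rho> * b < b" using \<rho> by simp
    then have "F (\<rho> * b) > 0" by (rule F_pos)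
    moreover have "(\<lambda>N::nat. real N powr (-e)) \<longlonglongrightarrow> 0" using e by real_asymp
    ultimately have "\<forall>\<^sub>F N::nat in sequentially. real N powr (-e) < F (\<rho> * b)" by (intro order_tendstoD(2))
    with lower show "\<forall>\<^sub>F N in sequentially. real N powr (-e) \<le> initial_tail N ((v * q0 - \<delta>) * nlogn N)"
      by eventually_elim linarith }
qed auto

text \<open>
  If \<open>N log N / r\<^sub>N\<close> stayed below \<open>K\<close>, a start above \<open>(q0 + 1) N log N\<close> would have a probability bounded from
  below, in contradiction to the bound \<open>1/N\<close>.
\<close>
lemma nlogn_over_r_at_top:
  assumes pos: "\<forall>t. F t > 0"
  shows "filterlim (\<lambda>N. nlogn N / r N) at_top sequentially"
  unfolding filterlim_at_top_gt[where c = 0]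
proof (intro allI impI)
  fix K :: real assume "K > 0"
  have "filterlim (\<lambda>N. real N * \<kappa>) at_top sequentially" if "\<kappa> > 0" for \<kappa> :: real
    using that by real_asymp
  from this[OF pos[rule_format, of "(q0 + 2) * K"]] have "\<forall>\<^sub>F N in sequentially. real N * F ((q0 + 2) * K) > 1" by (simp add: filterlim_at_top_dense)
  moreover have "\<forall>\<^sub>F N in sequentially. nlogn N \<ge> 1"
    using filterlim_nlogn by (simp add: filterlim_at_top)
  moreover have "\<forall>\<^sub>F N in sequentially. real N * initial_tail N ((q0 + 1) * nlogn N) \<le> 1"
    by (rule initial_tail_small) simp
  ultimately show "\<forall>\<^sub>F N in sequentially. K \<le> nlogn N / r N"
    using eventually_admissible
  proof eventually_elim
    case (elim N)
    note rN = r_pos[OF elim(4)]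
    show ?case
    proof (rule ccontr)
      assume "\<not> K \<le> nlogn N / r N"
      then have "(q0 + 2) * (nlogn N / r N) \<le> (q0 + 2) * K" using q0_nonneg by (intro mult_left_mono) auto
      moreover have "((q0 + 1) * nlogn N + 1) / r N \<le> (q0 + 2) * (nlogn N / r N)"
        using elim(2) rN by (simp add: divide_right_mono algebra_simps)
      ultimately have "F ((q0 + 2) * K) \<le> F (((q0 + 1) * nlogn N + 1) / r N)"
        by (intro tail_prob_antimono[OF U_measurable]) linarith
      also have "\<dots> \<le> initial_tail N ((q0 + 1) * nlogn N)" by (rule initial_tail_ge_F[OF elim(4)])
      finally have "real N * F ((q0 + 2) * K) \<le> real N * initial_tail N ((q0 + 1) * nlogn N)"
        by (intro mult_left_mono) auto
      then show False using elim by linarith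
    qed
  qed
qed

text \<open>
  The quantile bounds sandwich \<open>log N\<close> between \<open>- ln (F x)\<close> at points \<open>x\<close> just below and just above
  \<open>q0 N log N / r\<^sub>N\<close>. Multiplying such a point by \<open>v\<close> multiplies \<open>- ln (F x)\<close> by \<open>h(v)\<close> in the limit, and the
  margin \<open>\<delta>\<close> absorbs both the distance to the quantile and the rounding of the start.
\<close>
lemma start_profile_regular:
  assumes "q0 > 0" and reg: "regular_unbounded_tail M (U 1)"
  shows "fork_join_start_profile M \<alpha> \<beta> X Y Q0 q0 (tail_exponent M (U 1))"
proof (rule start_profileI)
  define H where "H = tail_exponent M (U 1)"
  have pos: "\<forall>t. F t > 0" using reg by (simp add: regular_unbounded_tail_def)
  have log_top: "filterlim (\<lambda>t. - ln (F t)) at_top at_top" by (rule log_tail_at_top[OF U_measurable pos])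
  have F_powr: "F x = exp (- (- ln (F x)))" for x using pos by simp
  have N_powr: "real N powr (-e) = exp (- (e * ln (real N)))" if "N \<ge> 2" for N e
    using that by (simp add: powr_def)
  have H_bounds: "0 \<le> H v" "H v \<le> 1" if "0 \<le> v" "v \<le> 1" for v
    using tail_exponent_bounds[OF U_measurable reg that] by (auto simp: H_def)
  fix v \<delta> e :: real assume v: "0 \<le> v" "v \<le> 1" and \<delta>: "\<delta> > 0"
  have ratio: "(log_tail_ratio M (U 1) v \<longlongrightarrow> H v) at_top"
    unfolding H_def by (rule log_tail_ratio_tendsto[OF reg v])
  have ev_scale: "\<forall>\<^sub>F N in sequentially. nlogn N \<ge> 2 / \<delta>"
    using filterlim_nlogn by (simp add: filterlim_at_top)
  { assume "e > tail_exponent M (U 1) v"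
    then have e: "e > H v" "e > 0" using H_bounds[OF v] by (auto simp: H_def)
    define d where "d = min \<delta> q0 / 2"
    have d: "d > 0" "d \<le> \<delta> / 2" "q0 - d > 0" using \<delta> \<open>q0 > 0\<close> by (auto simp: d_def)
    define x where "x N = (q0 - d) * (nlogn N / r N)" for N
    have x_top: "filterlim x at_top sequentially"
      unfolding x_def by (rule filterlim_tendsto_pos_mult_at_top[OF tendsto_const d(3) nlogn_over_r_at_top[OF pos]])
    have "\<forall>\<^sub>F N in sequentially. log_tail_ratio M (U 1) v (x N) < e"
      by (rule order_tendstoD(2)[OF filterlim_compose[OF ratio x_top] e(1)])
    moreover have "\<forall>\<^sub>F N in sequentially. - ln (F (x N)) > 0"
      using filterlim_compose[OF log_top x_top] unfolding filterlim_at_top_dense by blast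
    moreover have "\<forall>\<^sub>F N in sequentially. real N * initial_tail N ((q0 - d) * nlogn N) \<ge> 1"
      using initial_count[OF d(1)] by (simp add: filterlim_at_top)
    ultimately show "\<forall>\<^sub>F N in sequentially. real N powr (-e) \<le> initial_tail N ((v * q0 - \<delta>) * nlogn N)"
      using ev_scale eventually_admissible
    proof eventually_elim
      case (elim N)
      then have N: "N \<ge> 2" by (simp add: admissible_def)
      note sc = nlogn_pos[OF N]
      note rN = r_pos[OF elim(5)]
      have "1 \<le> real N * F (x N)"
        using elim(3) mult_left_mono[OF initial_tail_le_F[OF elim(5), of "(q0 - d) * nlogn N"], of "real N"]
        by (simp add: x_def)
      then have "0 \<le> ln (real N * F (x N))" by simp
      then have ln_le: "- ln (F (x N)) \<le> ln (real N)" using N pos[rule_format, of "x N"] by (simp add: ln_mult)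
      have "- ln (F (v * x N)) \<le> e * (- ln (F (x N)))"
        using elim(1) unfolding log_tail_ratio_def pos_divide_less_eq[OF elim(2)] by (rule less_imp_le)
      also have "\<dots> \<le> e * ln (real N)" using ln_le e(2) by (intro mult_left_mono) auto
      finally have "exp (- (e * ln (real N))) \<le> exp (- (- ln (F (v * x N))))"
        by (simp only: exp_le_cancel_iff neg_le_iff_le)
      then have "real N powr (-e) \<le> F (v * x N)"
        by (simp only: N_powr[OF N] F_powr[symmetric])
      also have "\<dots> \<le> F (((v * q0 - \<delta>) * nlogn N + 1) / r N)"
      proof (rule tail_prob_antimono[OF U_measurable])
        have "v * d \<le> \<delta> / 2" using v d mult_left_le_one_le[of d v] by linarith
        then have "\<delta> / 2 * nlogn N \<le> (\<delta> - v * d) * nlogn N" using sc by (intro mult_right_mono) auto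
        moreover have "1 \<le> \<delta> / 2 * nlogn N" using elim(4) \<delta> by (simp add: field_simps)
        ultimately have "1 \<le> (\<delta> - v * d) * nlogn N" by linarith
        then have "(v * q0 - \<delta>) * nlogn N + 1 \<le> v * ((q0 - d) * nlogn N)" by (simp add: algebra_simps)
        then show "((v * q0 - \<delta>) * nlogn N + 1) / r N \<le> v * x N"
          using rN by (simp add: x_def divide_right_mono)
      qed
      also have "\<dots> \<le> initial_tail N ((v * q0 - \<delta>) * nlogn N)" by (rule initial_tail_ge_F[OF elim(5)])
      finally show ?case .
    qed }
  { assume "e < tail_exponent M (U 1) v"
    then have e: "e < H v" by (simp add: H_def)
    show "\<forall>\<^sub>F N in sequentially. initial_tail N ((v * q0 + \<delta>) * nlogn N) \<le> real N powr (-e)"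
    proof (cases "e > 0")
      case False
      show ?thesis
        using eventually_ge_at_top[of 2]
      proof eventually_elim
        case (elim N)
        have "initial_tail N ((v * q0 + \<delta>) * nlogn N) \<le> real N powr 0"
          using elim initial_tail_bounds by simp
        also have "\<dots> \<le> real N powr (-e)" using elim False by (intro powr_mono) auto
        finally show ?case .
      qed
    next
      case True
      define d where "d = \<delta> / 2"
      have d: "d > 0" using \<delta> by (simp add: d_def)
      define x where "x N = ((q0 + d) * nlogn N + 1) / r N" for N
      have x_top: "filterlim x at_top sequentially"
      proof (rule filterlim_at_top_mono)
        show "filterlim (\<lambda>N. q0 * (nlogn N / r N)) at_top sequentially"
          by (rule filterlim_tendsto_pos_mult_at_top[OF tendsto_const \<open>q0 > 0\<close> nlogn_over_r_at_top[OF pos]])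
        show "\<forall>\<^sub>F N in sequentially. q0 * (nlogn N / r N) \<le> x N"
          using eventually_admissible
        proof eventually_elim
          case (elim N)
          then have "nlogn N > 0" by (intro nlogn_pos) (simp add: admissible_def)
          then show ?case using r_pos[OF elim] d by (simp add: x_def divide_right_mono algebra_simps)
        qed
      qed
      have "\<forall>\<^sub>F N in sequentially. log_tail_ratio M (U 1) v (x N) > e"
        by (rule order_tendstoD(1)[OF filterlim_compose[OF ratio x_top] e(1)])
      moreover have "\<forall>\<^sub>F N in sequentially. - ln (F (x N)) > 0"
        using filterlim_compose[OF log_top x_top] unfolding filterlim_at_top_dense by blast
      moreover note initial_tail_small[OF d]
      ultimately show ?thesis
        using ev_scale eventually_admissible
      proof eventually_elim
        case (elim N)
        then have N: "N \<ge> 2" by (simp add: admissible_def)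
        note sc = nlogn_pos[OF N]
        note rN = r_pos[OF elim(5)]
        have "real N * F (x N) \<le> 1"
          using elim(3) mult_left_mono[OF initial_tail_ge_F[OF elim(5), of "(q0 + d) * nlogn N"], of "real N"]
          by (simp add: x_def)
        then have "ln (real N * F (x N)) \<le> 0" using N pos by simp
        then have ln_ge: "ln (real N) \<le> - ln (F (x N))" using N pos[rule_format, of "x N"] by (simp add: ln_mult)
        have "e * ln (real N) \<le> e * (- ln (F (x N)))" using ln_ge True by (intro mult_left_mono) auto
        also have "\<dots> \<le> - ln (F (v * x N))"
          using elim(1) unfolding log_tail_ratio_def pos_less_divide_eq[OF elim(2)] by (rule less_imp_le)
        finally have "exp (- (- ln (F (v * x N)))) \<le> exp (- (e * ln (real N)))"
          by (simp only: exp_le_cancel_iff neg_le_iff_le)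
        then have le: "F (v * x N) \<le> real N powr (-e)"
          by (simp only: N_powr[OF N] F_powr[symmetric])
        have "initial_tail N ((v * q0 + \<delta>) * nlogn N) \<le> F ((v * q0 + \<delta>) * nlogn N / r N)"
          by (rule initial_tail_le_F[OF elim(5)])
        also have "\<dots> \<le> F (v * x N)"
        proof (rule tail_prob_antimono[OF U_measurable])
          have "v * d \<le> \<delta> / 2" using v d mult_left_le_one_le[of d v] by (simp add: d_def)
          then have "v * d * nlogn N \<le> \<delta> / 2 * nlogn N" using sc by (intro mult_right_mono) auto
          moreover have "1 \<le> \<delta> / 2 * nlogn N" using elim(4) \<delta> by (simp add: field_simps)
          ultimately have "v * d * nlogn N + v \<le> \<delta> * nlogn N" using v(2) by linarith
          then have "v * ((q0 + d) * nlogn N + 1) \<le> (v * q0 + \<delta>) * nlogn N" by (simp add: algebra_simps)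
          then show "v * x N \<le> (v * q0 + \<delta>) * nlogn N / r N"
            using rN by (simp add: x_def divide_right_mono)
        qed
        finally show ?case using le by linarith
      qed
    qed }
qed (use tail_exponent_0[OF U_measurable reg] tail_exponent_bounds[OF U_measurable reg] in auto)

end

section \<open>Uniformity in time\<close>

text \<open>
  The coefficient \<open>u\<close> of \<open>a\<close> lies in the unit interval.
\<close>
lemma constrained_growth_lipschitz:
  assumes "H 0 \<le> 1" "0 \<le> q"
  shows "1-lipschitz_on {0..} (\<lambda>a. constrained_growth H a q)"
proof (rule lipschitz_onI)
  have le: "constrained_growth H a q \<le> constrained_growth H b q + \<bar>a - b\<bar>" if ab: "0 \<le> a" "0 \<le> b" for a b
  proof (rule ccontr)
    assume "\<not> ?thesis"
    then have "constrained_growth H b q + \<bar>a - b\<bar> < constrained_growth H a q" by simp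
    then obtain u v where uv: "constrained_growth H b q + \<bar>a - b\<bar> < a * u + q * v" "u\<^sup>2 + H v \<le> 1"
      "0 \<le> u" "u \<le> 1" "0 \<le> v" "v \<le> 1"
      by (rule less_constrained_growthE) (use assms ab in auto)
    have "b * u + q * v \<le> constrained_growth H b q"
      by (rule constrained_growth_upper) (use uv assms ab in auto)
    moreover have "(a - b) * u \<le> \<bar>a - b\<bar> * 1" using uv by (intro mult_mono) auto
    ultimately show False using uv(1) by (simp add: algebra_simps)
  qed
  fix a b :: real assume "a \<in> {0..}" "b \<in> {0..}"
  then show "dist (constrained_growth H a q) (constrained_growth H b q) \<le> 1 * dist a b"
    using le[of a b] le[of b a] by (simp add: dist_real_def abs_le_iff abs_minus_commute)
qed simp

lemma constrained_growth_unconstrained: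
  assumes "0 \<le> a" "0 \<le> q"
  shows "constrained_growth (\<lambda>_. 0) a q = q + a"
proof (rule antisym)
  show "q + a \<le> constrained_growth (\<lambda>_. 0) a q"
    using constrained_growth_upper[of a q 1 "\<lambda>_. 0" 1] assms by simp
  show "constrained_growth (\<lambda>_. 0) a q \<le> q + a"
  proof (rule ccontr)
    assume "\<not> ?thesis"
    then have "q + a < constrained_growth (\<lambda>_. 0) a q" by simp
    then obtain u v :: real where uv: "q + a < a * u + q * v" "u \<le> 1" "v \<le> 1"
      by (rule less_constrained_growthE) (use assms in auto)
    then show False using assms mult_left_mono[of u 1 a] mult_left_mono[of v 1 q] by simp
  qed
qed

context fork_join_start_profile
begin

lemma continuous_on_profile_limit: "continuous_on {0..} profile_limit"
proof -
  have "continuous_on {0..} (\<lambda>a. constrained_growth H a q0)"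
    by (rule lipschitz_on_continuous_on[OF constrained_growth_lipschitz]) (use H_0 q0_nonneg in auto)
  then have "continuous_on {0..} (\<lambda>t. constrained_growth H (sqrt (2 * \<alpha> * t)) q0)"
    by (rule continuous_on_compose2) (use alpha_pos in \<open>auto intro!: continuous_intros\<close>)
  then show ?thesis
    unfolding profile_limit_def
    by (intro continuous_intros continuous_on_empty_start_limit alpha_pos beta_pos)
qed

text \<open>
  The whole block is compared with its left endpoint \<open>s\<close>, so two times in the block differ by twice the
  bound of \<open>lindley_modulus\<close>.
\<close>
lemma max_queue_diff_le:
  assumes "s \<le> t" "t \<le> s'" and N: "N \<ge> 1"
    and W: "\<forall>i\<in>{1..N}. \<forall>k\<in>{slot N s..slot N s'}. \<bar>walk N i \<omega> k - walk N i \<omega> (slot N s)\<bar> \<le> e"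
    and "0 \<le> s"
  shows "\<bar>max_queue X Y Q0 N (t * real N ^ 3 * ln (real N)) \<omega>
      - max_queue X Y Q0 N (s' * real N ^ 3 * ln (real N)) \<omega>\<bar> \<le> 4 * e"
proof -
  let ?x = "\<lambda>i. real_of_int (Q0 N i \<omega>)"
  have mono: "slot N s \<le> slot N t" "slot N t \<le> slot N s'" using assms by (auto intro: slot_mono)
  have "\<bar>lindley (?x i) (walk N i \<omega>) (slot N t) - lindley (?x i) (walk N i \<omega>) (slot N s')\<bar> \<le> 4 * e"
    if i: "i \<in> {1..N}" for i
  proof -
    have "\<bar>lindley (?x i) (walk N i \<omega>) (slot N t) - lindley (?x i) (walk N i \<omega>) (slot N s)\<bar> \<le> 2 * e"
      using W i mono by (intro lindley_modulus) auto
    moreover have "\<bar>lindley (?x i) (walk N i \<omega>) (slot N s') - lindley (?x i) (walk N i \<omega>) (slot N s)\<bar> \<le> 2 * e"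
      using W i mono by (intro lindley_modulus) auto
    ultimately show ?thesis by linarith
  qed
  then have "\<bar>Max ((\<lambda>i. lindley (?x i) (walk N i \<omega>) (slot N t)) ` {1..N})
     - Max ((\<lambda>i. lindley (?x i) (walk N i \<omega>) (slot N s')) ` {1..N})\<bar> \<le> 4 * e"
    using N by (intro abs_Max_diff_le) auto
  then show ?thesis using assms by (simp add: max_queue_eq_lindley)
qed

lemma whp_max_queue_uniform:
  assumes T: "T > 0" and "\<epsilon> > 0"
  shows "whp (\<lambda>N \<omega>. \<forall>t\<in>{0..T}.
    \<bar>max_queue X Y Q0 N (t * real N ^ 3 * ln (real N)) \<omega> / nlogn N - profile_limit t\<bar> \<le> \<epsilon>)"
proof -
  define e where "e = \<epsilon> / 6"
  have e: "e > 0" using assms by (simp add: e_def)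
  have "uniformly_continuous_on {0..T} profile_limit"
    by (intro compact_uniformly_continuous continuous_on_subset[OF continuous_on_profile_limit]) auto
  then obtain d where d: "d > 0" and cont: "\<And>x y. x \<in> {0..T} \<Longrightarrow> y \<in> {0..T} \<Longrightarrow> \<bar>x - y\<bar> < d \<Longrightarrow>
      \<bar>profile_limit x - profile_limit y\<bar> < e"
    unfolding uniformly_continuous_on_def dist_real_def using e by metis
  obtain \<Delta>0 where \<Delta>0: "\<Delta>0 > 0" and modulus: "\<And>s \<Delta>. s \<ge> 0 \<Longrightarrow> \<Delta> > 0 \<Longrightarrow> \<Delta> \<le> \<Delta>0 \<Longrightarrow>
       whp (\<lambda>N \<omega>. \<forall>i\<in>{1..N}. \<forall>k\<in>{slot N s..slot N (s + \<Delta>)}.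
         \<bar>walk N i \<omega> k - walk N i \<omega> (slot N s)\<bar> \<le> e * nlogn N)"
    by (rule whp_walk_modulus[OF e]) blast
  define D where "D = min \<Delta>0 (d / 2)"
  have D: "D > 0" "D \<le> \<Delta>0" "D < d" using d \<Delta>0 by (auto simp: D_def)
  obtain m :: nat where m: "T / D < real m" using reals_Archimedean2 by blast
  have m0: "m > 0"
  proof -
    have "0 < T / D" using T D by simp
    then have "0 < real m" using m by linarith
    then show ?thesis by simp
  qed
  have mesh: "T / real m \<le> D" using m m0 D by (simp add: field_simps)
  define s where "s l = T * real l / real m" for l
  have s: "0 \<le> s l" "s (Suc l) = s l + T / real m" for l
    using T by (simp_all add: s_def add_divide_distrib ring_distribs)
  have s_le: "s (Suc l) \<le> T" if "l < m" for l
  proof -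
    have "T * real (Suc l) \<le> T * real m" using that T by (intro mult_left_mono) auto
    then show ?thesis using m0 by (simp add: s_def pos_divide_le_eq del: of_nat_Suc)
  qed
  (* Right ends of the cells are used as reference times: they are positive, as the fixed-time limit demands. *)
  have s_pos: "s (Suc l) > 0" for l
    using T m0 by (simp add: s_def)
  have 1: "whp (\<lambda>N \<omega>. \<forall>l\<in>{..<m}.
      \<bar>max_queue X Y Q0 N (s (Suc l) * real N ^ 3 * ln (real N)) \<omega> / nlogn N - profile_limit (s (Suc l))\<bar> \<le> e)"
    (is "whp ?A") by (intro whp_ball_finite whp_max_queue_fixed_time s_pos e) auto
  have 2: "whp (\<lambda>N \<omega>. \<forall>l\<in>{..<m}. \<forall>i\<in>{1..N}. \<forall>k\<in>{slot N (s l)..slot N (s (Suc l))}.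
         \<bar>walk N i \<omega> k - walk N i \<omega> (slot N (s l))\<bar> \<le> e * nlogn N)"
    (is "whp ?B") unfolding s(2) by (intro whp_ball_finite modulus) (use s T m0 mesh D in auto)
  show ?thesis
  proof (rule whp_elim2[OF 1 2], intro ballI)
    fix N :: nat and \<omega> t
    assume N: "N \<ge> 2" and grid: "?A N \<omega>" and W: "?B N \<omega>" and t: "t \<in> {0..T}"
    note sc = nlogn_pos[OF N]
    let ?Q = "\<lambda>t. max_queue X Y Q0 N (t * real N ^ 3 * ln (real N)) \<omega>"
    have "\<exists>l<m. s l \<le> t \<and> t \<le> s (Suc l)"
      by (rule ex_grid_cell) (use t m0 in \<open>auto simp: s_def\<close>)
    then obtain l where l: "l < m" "s l \<le> t" "t \<le> s (Suc l)" by blast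
    have "\<bar>?Q t - ?Q (s (Suc l))\<bar> \<le> 4 * (e * nlogn N)"
      using l W s N by (intro max_queue_diff_le[where s = "s l"]) auto
    then have "\<bar>?Q t - ?Q (s (Suc l))\<bar> / nlogn N \<le> 4 * e" using sc by (simp add: pos_divide_le_eq)
    then have A: "\<bar>?Q t / nlogn N - ?Q (s (Suc l)) / nlogn N\<bar> \<le> 4 * e"
      using sc by (simp add: diff_divide_distrib[symmetric])
    have B: "\<bar>?Q (s (Suc l)) / nlogn N - profile_limit (s (Suc l))\<bar> \<le> e" using grid l by blast
    have "\<bar>t - s (Suc l)\<bar> < d" using l s(2)[of l] mesh D by linarith
    then have C: "\<bar>profile_limit t - profile_limit (s (Suc l))\<bar> < e"
      using t s(1) s_le[OF l(1)] by (intro cont) auto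
    have "\<bar>x - z\<bar> \<le> \<epsilon>" if "\<bar>x - y\<bar> \<le> 4 * e" "\<bar>y - w\<bar> \<le> e" "\<bar>z - w\<bar> < e" for x y z w :: real
    proof -
      have "\<epsilon> = 6 * e" by (simp add: e_def)
      then show ?thesis using that by linarith
    qed
    from this[OF A B C] show "\<bar>?Q t / nlogn N - profile_limit t\<bar> \<le> \<epsilon>" .
  qed
qed

lemma prob_sup_deviation_tendsto_0:
  assumes "T > 0" "\<epsilon> > 0"
  shows "(\<lambda>N. prob {\<omega> \<in> space M.
     (SUP t\<in>{0..T}. \<bar>max_queue X Y Q0 N (t * real N ^ 3 * ln (real N)) \<omega> / nlogn N - profile_limit t\<bar>) > \<epsilon>}) \<longlonglongrightarrow> 0"
proof -
  have "whp (\<lambda>N \<omega>. \<not> (SUP t\<in>{0..T}.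
     \<bar>max_queue X Y Q0 N (t * real N ^ 3 * ln (real N)) \<omega> / nlogn N - profile_limit t\<bar>) > \<epsilon>)"
    by (rule whp_mono[OF whp_max_queue_uniform[OF assms]])
       (use assms in \<open>auto simp: not_less intro!: always_eventually cSUP_least\<close>)
  from whp_imp_prob_tendsto_0[OF this] show ?thesis by simp
qed

end

theorem theorem2p1:
  fixes M :: "'a measure"
    and \<alpha> \<beta> q0 :: real
    and r :: "nat \<Rightarrow> real"
    and X :: "nat \<Rightarrow> nat \<Rightarrow> 'a \<Rightarrow> bool"
    and Y :: "nat \<Rightarrow> nat \<Rightarrow> nat \<Rightarrow> 'a \<Rightarrow> bool"
    and Q0 :: "nat \<Rightarrow> nat \<Rightarrow> 'a \<Rightarrow> int"
    and U :: "nat \<Rightarrow> 'a \<Rightarrow> real"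
  assumes "\<alpha> > 0" and "\<beta> > 0"
    and model: "fork_join_model M \<alpha> \<beta> X Y Q0"
    and initial_iid: "\<And>N. admissible \<alpha> \<beta> N \<Longrightarrow>
      prob_space.iid_vars M (count_space UNIV) (Q0 N) {1..N}"
    and initial_nonneg: "\<And>N i. admissible \<alpha> \<beta> N \<Longrightarrow> i \<in> {1..N} \<Longrightarrow> AE \<omega> in M. Q0 N i \<omega> \<ge> 0"
    and r_pos: "\<And>N. admissible \<alpha> \<beta> N \<Longrightarrow> r N > 0"
    and U_iid: "prob_space.iid_vars M borel U {1..}"
    and initial_eq: "\<And>N i \<omega>. admissible \<alpha> \<beta> N \<Longrightarrow> i \<in> {1..N} \<Longrightarrow> \<omega> \<in> space M \<Longrightarrow>
      Q0 N i \<omega> = \<lfloor>r N * U i \<omega>\<rfloor>"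
    and "q0 \<ge> 0"
    and initial_limit: "\<And>\<epsilon>. \<epsilon> > 0 \<Longrightarrow>
      (\<lambda>N. measure M {\<omega> \<in> space M.
         \<bar>max_queue X Y Q0 N 0 \<omega> / (real N * ln (real N)) - q0\<bar> > \<epsilon>}) \<longlonglongrightarrow> 0"
    and tail: "finite_right_endpoint M (U 1) \<or> regular_unbounded_tail M (U 1)"
  shows "\<forall>T > 0. \<forall>\<epsilon> > 0.
      (\<lambda>N. measure M {\<omega> \<in> space M.
         (SUP t\<in>{0..T}.
            \<bar>max_queue X Y Q0 N (t * real N ^ 3 * ln (real N)) \<omega> / (real N * ln (real N))
              - fluid_limit M (U 1) \<alpha> \<beta> q0 t\<bar>) > \<epsilon>}) \<longlonglongrightarrow> 0"
proof (intro allI impI)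
  fix T \<epsilon> :: real assume T: "T > 0" and \<epsilon>: "\<epsilon> > 0"
  interpret fork_join_model M \<alpha> \<beta> X Y Q0 by (rule model)
  interpret fork_join_scaled_start M \<alpha> \<beta> X Y Q0 r U q0
  proof unfold_locales
    show "random_variable borel (U 1)"
      using U_iid by (auto simp: iid_vars_def indep_vars_def)
    show "Q0 N 1 \<omega> = \<lfloor>r N * U 1 \<omega>\<rfloor>" if "admissible \<alpha> \<beta> N" "\<omega> \<in> space M" for N \<omega>
      using that by (intro initial_eq) (auto simp: admissible_def)
  qed (use assms in auto)
  have "\<exists>H. fork_join_start_profile M \<alpha> \<beta> X Y Q0 q0 H \<and>
     (\<forall>t\<ge>0. initial_growth M (U 1) \<alpha> t q0 = constrained_growth H (sqrt (2 * \<alpha> * t)) q0)"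
  proof (cases "finite_right_endpoint M (U 1)")
    case True
    have "fork_join_start_profile M \<alpha> \<beta> X Y Q0 q0 (\<lambda>_. 0)"
    proof (cases "q0 = 0")
      case True
      then show ?thesis by (intro start_profile_negligible) auto
    next
      case False
      then show ?thesis using True q0_nonneg by (intro start_profile_bounded) auto
    qed
    moreover have "initial_growth M (U 1) \<alpha> t q0 = constrained_growth (\<lambda>_. 0) (sqrt (2 * \<alpha> * t)) q0" if "t \<ge> 0" for t
      using True that alpha_pos q0_nonneg
      by (simp add: initial_growth_def constrained_growth_unconstrained)
    ultimately show ?thesis by blast
  next
    case False
    then have reg: "regular_unbounded_tail M (U 1)" using tail by blast
    have "fork_join_start_profile M \<alpha> \<beta> X Y Q0 q0 (tail_exponent M (U 1))"
    proof (cases "q0 = 0")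
      case True
      then show ?thesis
        using tail_exponent_0[OF U_measurable reg] tail_exponent_bounds[OF U_measurable reg]
        by (intro start_profile_negligible) auto
    next
      case False
      then show ?thesis using q0_nonneg reg by (intro start_profile_regular) auto
    qed
    moreover have "initial_growth M (U 1) \<alpha> t q0 = constrained_growth (tail_exponent M (U 1)) (sqrt (2 * \<alpha> * t)) q0" for t
      using False by (simp add: initial_growth_def constrained_growth_def)
    ultimately show ?thesis by blast
  qed
  then obtain H where H: "fork_join_start_profile M \<alpha> \<beta> X Y Q0 q0 H"
    and growth: "\<And>t. t \<ge> 0 \<Longrightarrow> initial_growth M (U 1) \<alpha> t q0 = constrained_growth H (sqrt (2 * \<alpha> * t)) q0" by blast
  interpret P: fork_join_start_profile M \<alpha> \<beta> X Y Q0 q0 H by (rule H)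
  have "fluid_limit M (U 1) \<alpha> \<beta> q0 t = P.profile_limit t" if "t \<in> {0..T}" for t
    using that growth[of t] by (simp add: fluid_limit_def P.profile_limit_def empty_start_limit_def)
  then have "(SUP t\<in>{0..T}. \<bar>max_queue X Y Q0 N (t * real N ^ 3 * ln (real N)) \<omega> / (real N * ln (real N))
        - fluid_limit M (U 1) \<alpha> \<beta> q0 t\<bar>) =
      (SUP t\<in>{0..T}. \<bar>max_queue X Y Q0 N (t * real N ^ 3 * ln (real N)) \<omega> / nlogn N - P.profile_limit t\<bar>)" for N \<omega>
    by (intro SUP_cong) (auto simp: nlogn_def)
  then show "(\<lambda>N. measure M {\<omega> \<in> space M.
         (SUP t\<in>{0..T}.
            \<bar>max_queue X Y Q0 N (t * real N ^ 3 * ln (real N)) \<omega> / (real N * ln (real N))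
              - fluid_limit M (U 1) \<alpha> \<beta> q0 t\<bar>) > \<epsilon>}) \<longlonglongrightarrow> 0"
    using P.prob_sup_deviation_tendsto_0[OF T \<epsilon>] by simp
qed

end
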